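(* Let $\mathbb{k}$ be a field and let $M,N\in\mathrm{rep}_0(\mathbb{Z}^2)$ be spread-decomposable representations. Then the following are equivalent: (i) $M\cong N$; (ii) $\partial M\cong\partial N$ in $\mathsf{Bnds}$; (iii) the boundary components of $M$, up to equivalence and counted with multiplicity, are the same as those of $N$.
   Context: $\mathrm{rep}(\mathbb{Z}^2)$ is the category of functors from $\mathbb{Z}^2$ (product order) to finite dimensional $\mathbb{k}$-vector spaces, identified with pointwise finite dimensional bigraded $\mathbb{k}[\mathbf{x},\mathbf{y}]$-modules ($\mathbf{x}:M_i\to M_{i+(1,0)}$, $\mathbf{y}:M_i\to M_{i+(0,1)}$ structure maps). $\mathrm{rep}_0(\mathbb{Z}^2)$ is the full subcategory of representations of finite support. A spread is a non-empty subset $I\subseteq\mathbb{Z}^2$ that is poset-connected (any two elements are joined by a sequence in $I$ whose consecutive elements are comparable) and poset-convex; $\mathbb{k}_I$ is $\mathbb{k}$ on $I$, $0$ elsewhere, with identity structure maps within $I$; a representation is spread-decomposable if it is isomorphic to a direct sum of representations $\mathbb{k}_I$, $I$ a spread. Notation. $C_{xy}M=M/\mathbf{x}\mathbf{y}M$, $C_xM=M/\mathbf{x}M$, $C_yM=M/\mathbf{y}M$; and $\mathcal K_{xy}M,\mathcal K_xM,\mathcal K_yM\subseteq M$ are the subrepresentations of elements annihilated by $\mathbf{x}\mathbf{y}$, $\mathbf{x}$, $\mathbf{y}$ respectively. Category $\mathsf{Bnds}$. A representation is ephemeral if it is annihilated by $\mathbf{x}\mathbf{y}$. An object of $\mathsf{Bnds}$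 is a tuple $(B,D,f,g)$ with $B,D\in\mathrm{rep}(\mathbb{Z}^2)$ ephemeral and morphisms $f:\mathcal K_yD\to C_xB$ and $g:\mathcal K_xD\to C_yB$. A morphism $(B,D,f,g)\to(B',D',f',g')$ is a pair of morphisms $\phi:B\to B'$, $\psi:D\to D'$ such that the induced squares commute: $f'\circ\mathcal K_y\psi=C_x\phi\circ f$ and $g'\circ\mathcal K_x\psi=C_y\phi\circ g$. The boundary of $M$ is $\partial M=(C_{xy}M,\mathcal K_{xy}M,f,g)$, where $f$ is the composite $\mathcal K_y(\mathcal K_{xy}M)=\mathcal K_yM\hookrightarrow M\twoheadrightarrow C_xM=C_x(C_{xy}M)$ and $g$ is the composite $\mathcal K_x(\mathcal K_{xy}M)=\mathcal K_xM\hookrightarrow M\twoheadrightarrow C_yM=C_y(C_{xy}M)$. Boundary components. A discrete closed plane curve is a finite sequence $\gamma=\{\gamma_0,\dots,\gamma_{k-1}\}$ in $\mathbb{Z}^2$ with $\|\gamma_{j+1}-\gamma_j\|_1\le 1$ for all $j\in\mathbb{Z}/k\mathbb{Z}$. It is irreducible if it is not the concatenation of $n\ge 2$ copies of a closed curve. Two closed curves are rotationally equivalent if they agree up to a cyclic shift of indices. A boundary component $(\gamma,\mathcal{T})$ consists of an irreducible discrete closed plane curve $\gamma$ and an invertible square matrix $\mathcal{T}$ over $\mathbb{k}$ that is not similar to a block diagonal matrix with more than one block. Two boundary components are equivalent if the matrices are similar and the curves are rotationally equivalent. The quiver $R$. It has six vertices $u_i,r_i,ur_i,\ell_i,d_i,d\ell_i$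 for each $i\in\mathbb{Z}^2$, and arrows $u_i\to ur_i$, $r_i\to ur_i$, $u_i\to\ell_i$, $r_i\to d_i$, $d\ell_i\to\ell_i$, $d\ell_i\to d_i$, $ur_i\to u_{i+(1,0)}$, $ur_i\to r_{i+(0,1)}$, $d_i\to d\ell_{i+(1,0)}$, $\ell_i\to d\ell_{i+(0,1)}$. The directed graph $S$ has the same vertices and the same underlying edges, oriented as: $ur_i\to u_i$, $u_i\to ur_{i-(1,0)}$, $u_i\to\ell_i$, $\ell_i\to d\ell_i$, $d\ell_i\to\ell_{i-(0,1)}$, $d\ell_i\to d_i$, $d_i\to d\ell_{i+(1,0)}$, $d_i\to r_i$, $r_i\to ur_i$, $ur_i\to r_{i+(0,1)}$. From curves to cycles in $S$. A full turn around $i$ is the oriented cycle $ur_i\to u_i\to\ell_i\to d\ell_i\to d_i\to r_i\to ur_i$, up to rotation; its two halves are $ur_i\to u_i\to\ell_i\to d\ell_i$ and $d\ell_i\to d_i\to r_i\to ur_i$. If $\gamma$ is constant at $i$ of length $k$, its oriented cycle is $k$ full turns around $i$. Otherwise, after rotation, write $\gamma=i_1^{t_1+1}\cdot i_2^{t_2+1}\cdots i_j^{t_j+1}$ (powers denote repetition) with cyclically consecutive $i_m$ distinct. For $m\in\mathbb{Z}/j\mathbb{Z}$ let $\sigma_m=d\ell$ if $i_{m+1}-i_m\in\{(1,0),(0,-1)\}$ and $\sigma_m=ur$ if $i_{m+1}-i_m\in\{(-1,0),(0,1)\}$. The oriented cycle of $\gamma$ is obtained by concatenating, for $m=1,\dots,j$: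 starting at the vertex $(\sigma_{m-1})_{i_m}$, do $t_m$ full turns around $i_m$; then, if $\sigma_m\ne\sigma_{m-1}$, the half turn from $(\sigma_{m-1})_{i_m}$ to $(\sigma_m)_{i_m}$; then the unique shortest (two-edge) path in $S$ from $(\sigma_m)_{i_m}$ to $(\sigma_m)_{i_{m+1}}$. Boundary component representations. Let $(\gamma,\mathcal{T})$ be a boundary component with $\mathcal{T}$ of size $n_0\times n_0$, and let the oriented cycle of $\gamma$ in $S$ have edges $e_0,\dots,e_{n-1}$ with $e_j$ from $v_j$ to $v_{j+1}$ (indices mod $n$). Define a representation $X$ of $R$: $X=\bigoplus_{j\in\mathbb{Z}/n}V_j$, $V_j=\mathbb{k}^{n_0}$ placed at vertex $v_j$; each $e_j$ contributes to the action of the corresponding arrow of $R$ a map $V_j\to V_{j+1}$ (if the arrow of $R$ goes from $v_j$ to $v_{j+1}$) or $V_{j+1}\to V_j$ (if it goes from $v_{j+1}$ to $v_j$), which is the identity for $j\ne n-1$, and for $j=n-1$ is $\mathcal{T}$ in the first case and $\mathcal{T}^{-1}$ in the second; arrows act as the sum of these contributions. Then $\mathbb{k}_{(\gamma,\mathcal{T})}=(B,D,f,g)\in\mathsf{Bnds}$ is given by $B_i=X_{d\ell_i}$, with $\mathbf{x}$ the composite $X_{d\ell_i}\to X_{d_i}\to X_{d\ell_{i+(1,0)}}$ and $\mathbf{y}$ the composite $X_{d\ell_i}\to X_{\ell_i}\to X_{d\ell_{i+(0,1)}}$; $D_i=X_{ur_i}$, with $\mathbf{x}$ the composite $X_{ur_i}\to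 X_{u_{i+(1,0)}}\to X_{ur_{i+(1,0)}}$ and $\mathbf{y}$ the composite $X_{ur_i}\to X_{r_{i+(0,1)}}\to X_{ur_{i+(0,1)}}$; the structure maps of $X$ identify $X_{u_i}\cong(\mathcal K_yD)_i$, $X_{r_i}\cong(\mathcal K_xD)_i$, $X_{\ell_i}\cong(C_xB)_i$, $X_{d_i}\cong(C_yB)_i$, and under these identifications $f$ and $g$ are the structure maps $X_{u_i}\to X_{\ell_i}$ and $X_{r_i}\to X_{d_i}$. Boundary components of $M$. For $M\in\mathrm{rep}_0(\mathbb{Z}^2)$, $\partial M$ decomposes essentially uniquely as a finite direct sum of (indecomposable) objects $\mathbb{k}_{(\gamma,\mathcal{T})}$; the boundary components of $M$ are the equivalence classes of the pairs $(\gamma,\mathcal{T})$ that appear, with multiplicity. *)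

theory Defs
  imports
    "Jordan_Normal_Form.VS_Connect"
    "Jordan_Normal_Form.Gauss_Jordan_Elimination"
    "HOL-Algebra.AbelCoset"
    "HOL-Library.Product_Plus"
    "HOL-Library.Product_Order"
    "HOL-Library.FuncSet"
    "HOL-Library.Multiset"
begin

section \<open>Bigraded modules\<close>

text \<open>The ground field is the type \<open>'k\<close>, seen as a ring with carrier through \<open>class_ring\<close>;
  the elements of the vector spaces have type \<open>'a\<close>.  The order and the addition on
  \<open>int \<times> int\<close> are componentwise.\<close>

record ('k, 'a) rep =
  vsp :: "int \<times> int \<Rightarrow> ('k, 'a) module"
  xact :: "int \<times> int \<Rightarrow> 'a \<Rightarrow> 'a"
  yact :: "int \<times> int \<Rightarrow> 'a \<Rightarrow> 'a"

definition is_rep :: "('k::field, 'a) rep \<Rightarrow> bool" where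
  "is_rep M \<longleftrightarrow>
    (\<forall>i. vectorspace class_ring (vsp M i) \<and> vectorspace.fin_dim class_ring (vsp M i)) \<and>
    (\<forall>i. linear_map class_ring (vsp M i) (vsp M (i + (1,0))) (xact M i)) \<and>
    (\<forall>i. linear_map class_ring (vsp M i) (vsp M (i + (0,1))) (yact M i)) \<and>
    (\<forall>i. \<forall>m\<in>carrier (vsp M i).
       yact M (i + (1,0)) (xact M i m) = xact M (i + (0,1)) (yact M i m))"

definition is_rep0 :: "('k::field, 'a) rep \<Rightarrow> bool" where
  "is_rep0 M \<longleftrightarrow> is_rep M \<and> finite {i. carrier (vsp M i) \<noteq> {\<zero>\<^bsub>vsp M i\<^esub>}}"

definition rep_hom ::
  "('k::field, 'a) rep \<Rightarrow> ('k, 'b) rep \<Rightarrow> (int \<times> int \<Rightarrow> 'a \<Rightarrow> 'b) \<Rightarrow> bool" where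
  "rep_hom M N \<phi> \<longleftrightarrow>
    (\<forall>i. linear_map class_ring (vsp M i) (vsp N i) (\<phi> i)) \<and>
    (\<forall>i. \<forall>m\<in>carrier (vsp M i). \<phi> (i + (1,0)) (xact M i m) = xact N i (\<phi> i m)) \<and>
    (\<forall>i. \<forall>m\<in>carrier (vsp M i). \<phi> (i + (0,1)) (yact M i m) = yact N i (\<phi> i m))"

definition mutually_inverse ::
  "('k, 'a) rep \<Rightarrow> ('k, 'b) rep \<Rightarrow> (int \<times> int \<Rightarrow> 'a \<Rightarrow> 'b) \<Rightarrow> (int \<times> int \<Rightarrow> 'b \<Rightarrow> 'a) \<Rightarrow> bool" where
  "mutually_inverse M N \<phi> \<phi>' \<longleftrightarrow>
    (\<forall>i. \<forall>m\<in>carrier (vsp M i). \<phi>' i (\<phi> i m) = m) \<and>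
    (\<forall>i. \<forall>n\<in>carrier (vsp N i). \<phi> i (\<phi>' i n) = n)"

definition rep_iso :: "('k::field, 'a) rep \<Rightarrow> ('k, 'b) rep \<Rightarrow> bool" where
  "rep_iso M N \<longleftrightarrow> (\<exists>\<phi> \<phi>'. rep_hom M N \<phi> \<and> rep_hom N M \<phi>' \<and> mutually_inverse M N \<phi> \<phi>')"

definition rep_sum :: "'j set \<Rightarrow> ('j \<Rightarrow> ('k, 'a) rep) \<Rightarrow> ('k, 'j \<Rightarrow> 'a) rep" where
  "rep_sum J F = \<lparr>
    vsp = (\<lambda>i. \<lparr>
      carrier = {h \<in> (\<Pi>\<^sub>E j\<in>J. carrier (vsp (F j) i)). finite {j\<in>J. h j \<noteq> \<zero>\<^bsub>vsp (F j) i\<^esub>}},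
      mult = undefined,
      one = undefined,
      zero = (\<lambda>j\<in>J. \<zero>\<^bsub>vsp (F j) i\<^esub>),
      add = (\<lambda>h h'. \<lambda>j\<in>J. h j \<oplus>\<^bsub>vsp (F j) i\<^esub> h' j),
      smult = (\<lambda>c h. \<lambda>j\<in>J. c \<odot>\<^bsub>vsp (F j) i\<^esub> h j)\<rparr>),
    xact = (\<lambda>i h. \<lambda>j\<in>J. xact (F j) i (h j)),
    yact = (\<lambda>i h. \<lambda>j\<in>J. yact (F j) i (h j))\<rparr>"


section \<open>Spreads\<close>

definition spread :: "(int \<times> int) set \<Rightarrow> bool" where
  "spread I \<longleftrightarrow> I \<noteq> {} \<and>
    (\<forall>p\<in>I. \<forall>q\<in>I. (p, q) \<in> {(a, b). a \<in> I \<and> b \<in> I \<and> (a \<le> b \<or> b \<le> a)}\<^sup>*) \<and>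
    (\<forall>p\<in>I. \<forall>q\<in>I. \<forall>r. p \<le> r \<and> r \<le> q \<longrightarrow> r \<in> I)"

definition spread_rep :: "(int \<times> int) set \<Rightarrow> ('k::field, 'k) rep" where
  "spread_rep I = \<lparr>
    vsp = (\<lambda>i. \<lparr>carrier = (if i \<in> I then UNIV else {0}),
      mult = (*), one = 1, zero = 0, add = (+), smult = (*)\<rparr>),
    xact = (\<lambda>i a. if i \<in> I \<and> i + (1,0) \<in> I then a else 0),
    yact = (\<lambda>i a. if i \<in> I \<and> i + (0,1) \<in> I then a else 0)\<rparr>"

text \<open>Index sets of natural numbers suffice: a pointwise finite dimensional direct sum
  of spread representations has only countably many summands.\<close>

definition spread_decomposable :: "('k::field, 'a) rep \<Rightarrow> bool" where
  "spread_decomposable M \<longleftrightarrow>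
    (\<exists>(J :: nat set) I. (\<forall>j\<in>J. spread (I j)) \<and> rep_iso M (rep_sum J (\<lambda>j. spread_rep (I j))))"


section \<open>Kernels and cokernels of x, y and xy\<close>

definition sub_rep :: "('k, 'a) rep \<Rightarrow> (int \<times> int \<Rightarrow> 'a set) \<Rightarrow> ('k, 'a) rep" where
  "sub_rep M W = M\<lparr>vsp := (\<lambda>i. (vsp M i)\<lparr>carrier := W i\<rparr>)\<rparr>"

text \<open>Maps between quotients act on cosets by taking the union of the (equal) target cosets of
  the images of all elements.\<close>

definition coset_map :: "('k, 'b) module \<Rightarrow> 'b set \<Rightarrow> ('a \<Rightarrow> 'b) \<Rightarrow> 'a set \<Rightarrow> 'b set" where
  "coset_map V W \<phi> X = (\<Union>a\<in>X. W +>\<^bsub>V\<^esub> \<phi> a)"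

definition quot_space :: "('k, 'a) module \<Rightarrow> 'a set \<Rightarrow> ('k, 'a set) module" where
  "quot_space V W = \<lparr>
    carrier = a_rcosets\<^bsub>V\<^esub> W,
    mult = undefined,
    one = undefined,
    zero = W,
    add = set_add V,
    smult = (\<lambda>c. coset_map V W (\<lambda>v. c \<odot>\<^bsub>V\<^esub> v))\<rparr>"

definition quot_rep :: "('k, 'a) rep \<Rightarrow> (int \<times> int \<Rightarrow> 'a set) \<Rightarrow> ('k, 'a set) rep" where
  "quot_rep M W = \<lparr>
    vsp = (\<lambda>i. quot_space (vsp M i) (W i)),
    xact = (\<lambda>i. coset_map (vsp M (i + (1,0))) (W (i + (1,0))) (xact M i)),
    yact = (\<lambda>i. coset_map (vsp M (i + (0,1))) (W (i + (0,1))) (yact M i))\<rparr>"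

definition im_x :: "('k, 'a) rep \<Rightarrow> int \<times> int \<Rightarrow> 'a set" where
  "im_x M i = xact M (i - (1,0)) ` carrier (vsp M (i - (1,0)))"

definition im_y :: "('k, 'a) rep \<Rightarrow> int \<times> int \<Rightarrow> 'a set" where
  "im_y M i = yact M (i - (0,1)) ` carrier (vsp M (i - (0,1)))"

definition im_xy :: "('k, 'a) rep \<Rightarrow> int \<times> int \<Rightarrow> 'a set" where
  "im_xy M i = (\<lambda>m. xact M (i - (1,0)) (yact M (i - (1,1)) m)) ` carrier (vsp M (i - (1,1)))"

definition Cx :: "('k, 'a) rep \<Rightarrow> ('k, 'a set) rep" where "Cx M = quot_rep M (im_x M)"
definition Cy :: "('k, 'a) rep \<Rightarrow> ('k, 'a set) rep" where "Cy M = quot_rep M (im_y M)"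
definition Cxy :: "('k, 'a) rep \<Rightarrow> ('k, 'a set) rep" where "Cxy M = quot_rep M (im_xy M)"

definition Kx :: "('k, 'a) rep \<Rightarrow> ('k, 'a) rep" where
  "Kx M = sub_rep M (\<lambda>i. {m \<in> carrier (vsp M i). xact M i m = \<zero>\<^bsub>vsp M (i + (1,0))\<^esub>})"

definition Ky :: "('k, 'a) rep \<Rightarrow> ('k, 'a) rep" where
  "Ky M = sub_rep M (\<lambda>i. {m \<in> carrier (vsp M i). yact M i m = \<zero>\<^bsub>vsp M (i + (0,1))\<^esub>})"

definition Kxy :: "('k, 'a) rep \<Rightarrow> ('k, 'a) rep" where
  "Kxy M = sub_rep M (\<lambda>i. {m \<in> carrier (vsp M i).
     xact M (i + (0,1)) (yact M i m) = \<zero>\<^bsub>vsp M (i + (1,1))\<^esub>})"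

definition ephemeral :: "('k, 'a) rep \<Rightarrow> bool" where
  "ephemeral M \<longleftrightarrow> (\<forall>i. \<forall>m\<in>carrier (vsp M i).
     xact M (i + (0,1)) (yact M i m) = \<zero>\<^bsub>vsp M (i + (1,1))\<^esub>)"


section \<open>The category Bnds\<close>

record ('k, 'b, 'd) bnd =
  bndB :: "('k, 'b) rep"
  bndD :: "('k, 'd) rep"
  bndf :: "int \<times> int \<Rightarrow> 'd \<Rightarrow> 'b set"
  bndg :: "int \<times> int \<Rightarrow> 'd \<Rightarrow> 'b set"

definition is_bnd :: "('k::field, 'b, 'd) bnd \<Rightarrow> bool" where
  "is_bnd P \<longleftrightarrow>
    is_rep (bndB P) \<and> ephemeral (bndB P) \<and> is_rep (bndD P) \<and> ephemeral (bndD P) \<and>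
    rep_hom (Ky (bndD P)) (Cx (bndB P)) (bndf P) \<and>
    rep_hom (Kx (bndD P)) (Cy (bndB P)) (bndg P)"

definition bnd_hom ::
  "('k::field, 'b, 'd) bnd \<Rightarrow> ('k, 'b2, 'd2) bnd \<Rightarrow>
   (int \<times> int \<Rightarrow> 'b \<Rightarrow> 'b2) \<Rightarrow> (int \<times> int \<Rightarrow> 'd \<Rightarrow> 'd2) \<Rightarrow> bool" where
  "bnd_hom P Q \<phi> \<psi> \<longleftrightarrow>
    rep_hom (bndB P) (bndB Q) \<phi> \<and> rep_hom (bndD P) (bndD Q) \<psi> \<and>
    (\<forall>i. \<forall>d\<in>carrier (vsp (Ky (bndD P)) i).
       bndf Q i (\<psi> i d) = coset_map (vsp (bndB Q) i) (im_x (bndB Q) i) (\<phi> i) (bndf P i d)) \<and>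
    (\<forall>i. \<forall>d\<in>carrier (vsp (Kx (bndD P)) i).
       bndg Q i (\<psi> i d) = coset_map (vsp (bndB Q) i) (im_y (bndB Q) i) (\<phi> i) (bndg P i d))"

definition bnd_iso :: "('k::field, 'b, 'd) bnd \<Rightarrow> ('k, 'b2, 'd2) bnd \<Rightarrow> bool" where
  "bnd_iso P Q \<longleftrightarrow> is_bnd P \<and> is_bnd Q \<and>
    (\<exists>\<phi> \<psi> \<phi>' \<psi>'. bnd_hom P Q \<phi> \<psi> \<and> bnd_hom Q P \<phi>' \<psi>' \<and>
       mutually_inverse (bndB P) (bndB Q) \<phi> \<phi>' \<and>
       mutually_inverse (bndD P) (bndD Q) \<psi> \<psi>')"

text \<open>The structure maps of a direct sum take the family of cosets \<open>bndf (P j) i (d j)\<close> to the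
  corresponding coset in the direct sum of the \<open>bndB (P j)\<close>.\<close>

definition bnd_sum ::
  "'j set \<Rightarrow> ('j \<Rightarrow> ('k, 'b, 'd) bnd) \<Rightarrow> ('k, 'j \<Rightarrow> 'b, 'j \<Rightarrow> 'd) bnd" where
  "bnd_sum J P = (let B = rep_sum J (\<lambda>j. bndB (P j)) in \<lparr>
    bndB = B,
    bndD = rep_sum J (\<lambda>j. bndD (P j)),
    bndf = (\<lambda>i d. {b \<in> carrier (vsp B i). \<forall>j\<in>J. b j \<in> bndf (P j) i (d j)}),
    bndg = (\<lambda>i d. {b \<in> carrier (vsp B i). \<forall>j\<in>J. b j \<in> bndg (P j) i (d j)})\<rparr>)"

text \<open>The identification of \<open>M / xM\<close> with \<open>Cx (Cxy M)\<close> sends the class of \<open>m\<close> to the class of its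
  class in \<open>Cxy M\<close>, and similarly for \<open>y\<close>.\<close>

definition boundary :: "('k, 'a) rep \<Rightarrow> ('k, 'a set, 'a) bnd" where
  "boundary M = \<lparr>
    bndB = Cxy M,
    bndD = Kxy M,
    bndf = (\<lambda>i m. im_x (Cxy M) i +>\<^bsub>vsp (Cxy M) i\<^esub> (im_xy M i +>\<^bsub>vsp M i\<^esub> m)),
    bndg = (\<lambda>i m. im_y (Cxy M) i +>\<^bsub>vsp (Cxy M) i\<^esub> (im_xy M i +>\<^bsub>vsp M i\<^esub> m))\<rparr>"


section \<open>Discrete closed plane curves and boundary components\<close>

type_synonym curve = "(int \<times> int) list"

definition closed_curve :: "curve \<Rightarrow> bool" where
  "closed_curve \<gamma> \<longleftrightarrow> \<gamma> \<noteq> [] \<and>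
    (\<forall>j<length \<gamma>. let \<delta> = \<gamma> ! (Suc j mod length \<gamma>) - \<gamma> ! j in \<bar>fst \<delta>\<bar> + \<bar>snd \<delta>\<bar> \<le> 1)"

definition irreducible_curve :: "curve \<Rightarrow> bool" where
  "irreducible_curve \<gamma> \<longleftrightarrow>
    \<not> (\<exists>n\<ge>2. \<exists>\<delta>. closed_curve \<delta> \<and> \<gamma> = concat (replicate n \<delta>))"

text \<open>Blocks, and the matrix itself, are required to have positive size: the empty
  matrix would give the zero object.\<close>

definition boundary_component :: "curve \<times> 'k::field mat \<Rightarrow> bool" where
  "boundary_component c \<longleftrightarrow> (case c of (\<gamma>, T) \<Rightarrow>
    closed_curve \<gamma> \<and> irreducible_curve \<gamma> \<and>
    invertible_mat T \<and> dim_row T > 0 \<and>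
    \<not> (\<exists>Ts. length Ts > 1 \<and> (\<forall>A\<in>set Ts. square_mat A \<and> dim_row A > 0) \<and>
         similar_mat T (diag_block_mat Ts)))"

definition rotationally_equivalent :: "curve \<Rightarrow> curve \<Rightarrow> bool" where
  "rotationally_equivalent \<gamma> \<gamma>' \<longleftrightarrow> (\<exists>m. \<gamma>' = rotate m \<gamma>)"

definition bc_equiv :: "curve \<times> 'k::field mat \<Rightarrow> curve \<times> 'k mat \<Rightarrow> bool" where
  "bc_equiv c c' \<longleftrightarrow> rotationally_equivalent (fst c) (fst c') \<and> similar_mat (snd c) (snd c')"

definition bc_class :: "curve \<times> 'k::field mat \<Rightarrow> (curve \<times> 'k mat) set" where
  "bc_class c = {c'. boundary_component c' \<and> bc_equiv c c'}"


section \<open>The oriented cycle of a curve\<close>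

text \<open>Two vertices are joined by at most one edge of the graph \<open>S\<close>, so an oriented cycle with
  edges \<open>e\<^sub>0, \<dots>, e\<^bsub>n-1\<^esub>\<close> is given by the list of the sources \<open>v\<^sub>0, \<dots>, v\<^bsub>n-1\<^esub>\<close> of its
  edges.  Likewise the paths below are lists of vertices without their final vertex, so that
  concatenation of paths is concatenation of lists.\<close>

datatype vkind = vU | vR | vUR | vL | vD | vDL

type_synonym vertex = "vkind \<times> (int \<times> int)"

definition half_turn :: "vkind \<Rightarrow> int \<times> int \<Rightarrow> vertex list" where
  "half_turn \<sigma> i = (if \<sigma> = vUR then [(vUR, i), (vU, i), (vL, i)] else [(vDL, i), (vD, i), (vR, i)])"

definition full_turn :: "vkind \<Rightarrow> int \<times> int \<Rightarrow> vertex list" where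
  "full_turn \<sigma> i = half_turn \<sigma> i @ half_turn (if \<sigma> = vUR then vDL else vUR) i"

definition side :: "int \<times> int \<Rightarrow> int \<times> int \<Rightarrow> vkind" where
  "side i i' = (if i' - i \<in> {(1,0), (0,-1)} then vDL else vUR)"

definition step_path :: "int \<times> int \<Rightarrow> int \<times> int \<Rightarrow> vertex list" where
  "step_path i i' =
    (if i' - i = (1,0) then [(vDL, i), (vD, i)]
     else if i' - i = (0,-1) then [(vDL, i), (vL, i')]
     else if i' - i = (-1,0) then [(vUR, i), (vU, i)]
     else [(vUR, i), (vR, i')])"

text \<open>\<open>runs \<gamma>\<close> is the list of the pairs \<open>(i\<^sub>m, t\<^sub>m)\<close> with
  \<open>\<gamma> = i\<^sub>1\<^bsup>t\<^sub>1+1\<^esup> \<cdots> i\<^sub>j\<^bsup>t\<^sub>j+1\<^esup>\<close> and consecutive \<open>i\<^sub>m\<close> distinct.\<close>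

fun runs :: "'p list \<Rightarrow> ('p \<times> nat) list" where
  "runs [] = []"
| "runs (p # ps) = (case runs ps of
     [] \<Rightarrow> [(p, 0)]
   | (q, t) # rs \<Rightarrow> if p = q then (q, Suc t) # rs else (p, 0) # (q, t) # rs)"

definition oriented_cycle :: "curve \<Rightarrow> vertex list" where
  "oriented_cycle \<gamma> =
    (if set \<gamma> \<subseteq> {hd \<gamma>} then concat (replicate (length \<gamma>) (full_turn vUR (hd \<gamma>)))
     else let
       rs = runs (rotate (LEAST m. hd (rotate m \<gamma>) \<noteq> last (rotate m \<gamma>)) \<gamma>);
       n = length rs;
       pt = (\<lambda>m. fst (rs ! (m mod n)))
     in concat (map (\<lambda>m. let
          i = pt m;
          \<sigma> = side (pt (m + n - 1)) i;
          \<sigma>' = side i (pt (m + 1))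
        in concat (replicate (snd (rs ! m)) (full_turn \<sigma> i)) @
           (if \<sigma>' \<noteq> \<sigma> then half_turn \<sigma> i else []) @
           step_path i (pt (m + 1))) [0..<n]))"


section \<open>Boundary component representations\<close>

text \<open>The representation \<open>X\<close> of the quiver \<open>R\<close> given by a cycle \<open>v\<^sub>0, \<dots>, v\<^bsub>n-1\<^esub>\<close> and a matrix
  \<open>T\<close>: an element of \<open>X\<^sub>v\<close> is a family of vectors \<open>x\<^sub>j \<in> V\<^sub>j\<close>, zero unless \<open>j < n\<close> and \<open>v\<^sub>j = v\<close>.\<close>

definition X_space :: "vertex list \<Rightarrow> 'k::field mat \<Rightarrow> vertex \<Rightarrow> ('k, nat \<Rightarrow> 'k vec) module" where
  "X_space vs T v = \<lparr>
    carrier = {x. \<forall>j. x j \<in> carrier_vec (dim_row T) \<and>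
                 (\<not> (j < length vs \<and> vs ! j = v) \<longrightarrow> x j = 0\<^sub>v (dim_row T))},
    mult = undefined,
    one = undefined,
    zero = (\<lambda>j. 0\<^sub>v (dim_row T)),
    add = (\<lambda>x x' j. x j + x' j),
    smult = (\<lambda>c x j. c \<cdot>\<^sub>v x j)\<rparr>"

definition edge_mat :: "nat \<Rightarrow> 'k::field mat \<Rightarrow> nat \<Rightarrow> 'k mat" where
  "edge_mat n T j = (if j = n - 1 then T else 1\<^sub>m (dim_row T))"

definition edge_mat_inv :: "nat \<Rightarrow> 'k::field mat \<Rightarrow> nat \<Rightarrow> 'k mat" where
  "edge_mat_inv n T j = (if j = n - 1 then the (mat_inverse T) else 1\<^sub>m (dim_row T))"

text \<open>The action of the arrow \<open>s \<rightarrow> t\<close> of \<open>R\<close>.  If \<open>v\<^sub>j = t\<close> then \<open>V\<^sub>j\<close> receives a contribution of the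
  edge \<open>e\<^bsub>j-1\<^esub>\<close> if \<open>v\<^bsub>j-1\<^esub> = s\<close>, and one of the edge \<open>e\<^sub>j\<close>, traversed backwards, if
  \<open>v\<^bsub>j+1\<^esub> = s\<close>.\<close>

definition X_map ::
  "vertex list \<Rightarrow> 'k::field mat \<Rightarrow> vertex \<Rightarrow> vertex \<Rightarrow> (nat \<Rightarrow> 'k vec) \<Rightarrow> nat \<Rightarrow> 'k vec" where
  "X_map vs T s t x j = (let
      n = length vs;
      p = (j + n - 1) mod n;
      q = (j + 1) mod n
    in if j < n \<and> vs ! j = t then
         (if vs ! p = s then edge_mat n T p *\<^sub>v x p else 0\<^sub>v (dim_row T)) +
         (if vs ! q = s then edge_mat_inv n T j *\<^sub>v x q else 0\<^sub>v (dim_row T))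
       else 0\<^sub>v (dim_row T))"

text \<open>In \<open>bndf\<close>, an element \<open>d\<close> of the kernel of \<open>y\<close> on \<open>X\<^bsub>ur\<^esub>\<close> is lifted to \<open>X\<^sub>u\<close> and then mapped
  to \<open>X\<^sub>l\<close>; the corresponding coset of \<open>xB\<close> in \<open>X\<^bsub>dl\<^esub>\<close> is the fibre of \<open>X\<^bsub>dl\<^esub> \<rightarrow> X\<^sub>l\<close> over the
  result.  Similarly for \<open>bndg\<close>.\<close>

definition bc_rep ::
  "curve \<times> 'k::field mat \<Rightarrow> ('k, nat \<Rightarrow> 'k vec, nat \<Rightarrow> 'k vec) bnd" where
  "bc_rep c = (let
      X = X_space (oriented_cycle (fst c)) (snd c);
      A = X_map (oriented_cycle (fst c)) (snd c)
    in \<lparr>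
    bndB = \<lparr>
      vsp = (\<lambda>i. X (vDL, i)),
      xact = (\<lambda>i. A (vD, i) (vDL, i + (1,0)) \<circ> A (vDL, i) (vD, i)),
      yact = (\<lambda>i. A (vL, i) (vDL, i + (0,1)) \<circ> A (vDL, i) (vL, i))\<rparr>,
    bndD = \<lparr>
      vsp = (\<lambda>i. X (vUR, i)),
      xact = (\<lambda>i. A (vU, i + (1,0)) (vUR, i + (1,0)) \<circ> A (vUR, i) (vU, i + (1,0))),
      yact = (\<lambda>i. A (vR, i + (0,1)) (vUR, i + (0,1)) \<circ> A (vUR, i) (vR, i + (0,1)))\<rparr>,
    bndf = (\<lambda>i d. {b \<in> carrier (X (vDL, i)). \<exists>u\<in>carrier (X (vU, i)).
              A (vU, i) (vUR, i) u = d \<and> A (vDL, i) (vL, i) b = A (vU, i) (vL, i) u}),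
    bndg = (\<lambda>i d. {b \<in> carrier (X (vDL, i)). \<exists>r\<in>carrier (X (vR, i)).
              A (vR, i) (vUR, i) r = d \<and> A (vDL, i) (vD, i) b = A (vR, i) (vD, i) r})\<rparr>)"

definition bc_decomposition :: "('k::field, 'a) rep \<Rightarrow> (curve \<times> 'k mat) list \<Rightarrow> bool" where
  "bc_decomposition M cs \<longleftrightarrow> (\<forall>c\<in>set cs. boundary_component c) \<and>
    bnd_iso (boundary M) (bnd_sum {..<length cs} (\<lambda>j. bc_rep (cs ! j)))"

text \<open>The decomposition of \<open>boundary M\<close> exists and is essentially unique when \<open>M\<close> has finite support,
  so the multiset of equivalence classes does not depend on the one chosen here.\<close>

definition boundary_components :: "('k::field, 'a) rep \<Rightarrow> (curve \<times> 'k mat) set multiset" where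
  "boundary_components M =
    image_mset bc_class (mset (SOME cs. bc_decomposition M cs))"

end

(* Isomorphic representations have isomorphic boundaries, and the boundary components are read off
   the boundary, so the point is to go back.  A finite spread I is a union of intervals [b t, d t]
   on consecutive diagonals, where the lower ends b and the upper ends d are lattice paths with
   common end points: convexity forces consecutive lower (upper) ends to be adjacent.  The boundary
   of k_I is therefore the representation of a single component (gamma, 1), where gamma runs along
   b and returns along d.

   A morphism between the boundaries of two spreads is a family of scalars; scalars of an
   endomorphism are constant along each path, and f links the two paths at a corner, so
   endomorphisms are scalars.  A nonzero composite through another spread K thus makes both
   composites invertible, which forces K = I.  Hence in an isomorphism between two sums the blocks
   belonging to a fixed spread are mutually inverse matrices, and multiplicities agree.

   Conversely, equivalent components have isomorphic representations: rotating a curve rotates its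
   oriented cycle, and a change of basis at each vertex moves the matrix along the cycle or
   conjugates it. *)

theory Submission
  imports Defs "HOL-Combinatorics.List_Permutation"
begin

section \<open>Linear bijections and quotients\<close>

text \<open>Slicing by diagonals is dictated by \<open>xy\<close>, which shifts every point by
  (1,1): on a convex set it is the identity wherever source and target both lie in the set. So the
  cokernel of \<open>xy\<close> on a spread representation lives on the bottom points of the
  diagonals and the kernel on their top points.

  The obstacle is that \<open>boundary\<close> nests quotients, and that a decomposition provides
  only an isomorphism, onto a sum whose index set may be infinite. Finite support and pointwise
  finite dimension make the index set finite; after that, quotients are replaced once and for all by
  the scalar model \<open>spread_bnd\<close>, in which the spreads are recovered. Curves and their
  cycles serve (iii): they turn each summand of the model into some \<open>bc_rep\<close>, so that
  the choice in \<open>boundary_components\<close> picks an actual decomposition. Isomorphic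
  boundaries admit the same decompositions and hence the same chosen list, while equal multisets of
  classes are matched by a permutation of the summands.\<close>

abbreviation is_vs :: "('k::field, 'a) module \<Rightarrow> bool" where
  "is_vs V \<equiv> vectorspace class_ring V"

text \<open>\<open>W\<close> is an arbitrary structure here: its vector space axioms are deduced
  from those of \<open>V\<close> in \<open>lin_surj_vs\<close>, which is how quotients acquire
  theirs.\<close>

definition lin_surj :: "('k::field, 'a) module \<Rightarrow> ('k, 'b) module \<Rightarrow> ('a \<Rightarrow> 'b) \<Rightarrow> bool" where
  "lin_surj V W \<phi> \<longleftrightarrow> \<phi> ` carrier V = carrier W \<and>
    (\<forall>u\<in>carrier V. \<forall>v\<in>carrier V. \<phi> (u \<oplus>\<^bsub>V\<^esub> v) = \<phi> u \<oplus>\<^bsub>W\<^esub> \<phi> v) \<and>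
    (\<forall>c. \<forall>v\<in>carrier V. \<phi> (c \<odot>\<^bsub>V\<^esub> v) = c \<odot>\<^bsub>W\<^esub> \<phi> v) \<and>
    \<phi> \<zero>\<^bsub>V\<^esub> = \<zero>\<^bsub>W\<^esub>"

definition lin_iso :: "('k::field, 'a) module \<Rightarrow> ('k, 'b) module \<Rightarrow> ('a \<Rightarrow> 'b) \<Rightarrow> bool" where
  "lin_iso V W \<phi> \<longleftrightarrow> lin_surj V W \<phi> \<and> inj_on \<phi> (carrier V)"

lemma linear_map_iff:
  "linear_map class_ring V W f \<longleftrightarrow> is_vs V \<and> is_vs W \<and>
    (\<forall>v\<in>carrier V. f v \<in> carrier W) \<and>
    (\<forall>u\<in>carrier V. \<forall>v\<in>carrier V. f (u \<oplus>\<^bsub>V\<^esub> v) = f u \<oplus>\<^bsub>W\<^esub> f v) \<and>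
    (\<forall>c. \<forall>v\<in>carrier V. f (c \<odot>\<^bsub>V\<^esub> v) = c \<odot>\<^bsub>W\<^esub> f v)"
  unfolding linear_map_def mod_hom_def mod_hom_axioms_def LinearCombinations.module_hom_def vectorspace_def
  by auto

lemma linear_map_zero:
  assumes "linear_map class_ring V W f"
  shows "f \<zero>\<^bsub>V\<^esub> = \<zero>\<^bsub>W\<^esub>"
proof -
  interpret linear_map class_ring V W f by fact
  show ?thesis by simp
qed

lemma vs_abelian_group: "is_vs V \<Longrightarrow> abelian_group V"
  unfolding vectorspace_def by (meson module.axioms(2))

lemma vs_zero: "is_vs V \<Longrightarrow> \<zero>\<^bsub>V\<^esub> \<in> carrier V"
  using abelian_monoid.zero_closed[of V]
  by (simp add: vs_abelian_group abelian_group.axioms(1))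

lemma vs_add: "is_vs V \<Longrightarrow> u \<in> carrier V \<Longrightarrow> v \<in> carrier V \<Longrightarrow> u \<oplus>\<^bsub>V\<^esub> v \<in> carrier V"
  using abelian_monoid.a_closed[of V u v]
  by (simp add: vs_abelian_group abelian_group.axioms(1))

lemma vs_smult: "is_vs V \<Longrightarrow> v \<in> carrier V \<Longrightarrow> c \<odot>\<^bsub>V\<^esub> v \<in> carrier V"
  unfolding vectorspace_def using module.smult_closed[of class_ring V c v] by simp

lemma vs_l_zero: "is_vs V \<Longrightarrow> v \<in> carrier V \<Longrightarrow> \<zero>\<^bsub>V\<^esub> \<oplus>\<^bsub>V\<^esub> v = v"
  using abelian_monoid.l_zero[of V v]
  by (simp add: vs_abelian_group abelian_group.axioms(1))

lemma vs_r_zero: "is_vs V \<Longrightarrow> v \<in> carrier V \<Longrightarrow> v \<oplus>\<^bsub>V\<^esub> \<zero>\<^bsub>V\<^esub> = v"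
  using abelian_monoid.r_zero[of V v]
  by (simp add: vs_abelian_group abelian_group.axioms(1))

lemma vs_neg:
  assumes "is_vs V" "v \<in> carrier V"
  shows "\<exists>w\<in>carrier V. v \<oplus>\<^bsub>V\<^esub> w = \<zero>\<^bsub>V\<^esub>"
proof -
  interpret vectorspace class_ring V by fact
  show ?thesis using assms(2) M.r_neg M.a_inv_closed by blast
qed

lemma lin_surjD:
  assumes "lin_surj V W \<phi>"
  shows "\<phi> ` carrier V = carrier W"
    and "\<And>u v. u \<in> carrier V \<Longrightarrow> v \<in> carrier V \<Longrightarrow> \<phi> (u \<oplus>\<^bsub>V\<^esub> v) = \<phi> u \<oplus>\<^bsub>W\<^esub> \<phi> v"
    and "\<And>c v. v \<in> carrier V \<Longrightarrow> \<phi> (c \<odot>\<^bsub>V\<^esub> v) = c \<odot>\<^bsub>W\<^esub> \<phi> v"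
    and "\<phi> \<zero>\<^bsub>V\<^esub> = \<zero>\<^bsub>W\<^esub>"
    and "\<And>v. v \<in> carrier V \<Longrightarrow> \<phi> v \<in> carrier W"
  using assms unfolding lin_surj_def by auto

lemma lin_isoD:
  assumes "lin_iso V W \<phi>"
  shows "lin_surj V W \<phi>" "inj_on \<phi> (carrier V)" "bij_betw \<phi> (carrier V) (carrier W)"
  using assms unfolding lin_iso_def lin_surj_def bij_betw_def by auto

lemma vs_assoc:
  assumes "is_vs V" "u \<in> carrier V" "v \<in> carrier V" "w \<in> carrier V"
  shows "u \<oplus>\<^bsub>V\<^esub> v \<oplus>\<^bsub>V\<^esub> w = u \<oplus>\<^bsub>V\<^esub> (v \<oplus>\<^bsub>V\<^esub> w)"
proof -
  interpret vectorspace class_ring V by fact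
  show ?thesis using assms(2-4) by (rule M.a_assoc)
qed

lemma vs_comm:
  assumes "is_vs V" "u \<in> carrier V" "v \<in> carrier V"
  shows "u \<oplus>\<^bsub>V\<^esub> v = v \<oplus>\<^bsub>V\<^esub> u"
proof -
  interpret vectorspace class_ring V by fact
  show ?thesis using assms(2-3) by (rule M.a_comm)
qed

lemma vs_smult_add:
  assumes "is_vs V" "u \<in> carrier V" "v \<in> carrier V"
  shows "c \<odot>\<^bsub>V\<^esub> (u \<oplus>\<^bsub>V\<^esub> v) = c \<odot>\<^bsub>V\<^esub> u \<oplus>\<^bsub>V\<^esub> c \<odot>\<^bsub>V\<^esub> v"
proof -
  interpret vectorspace class_ring V by fact
  show ?thesis using smult_r_distr[OF _ assms(2,3), of c] by simp
qed

lemma vs_add_smult: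
  assumes "is_vs V" "v \<in> carrier V"
  shows "(c + d) \<odot>\<^bsub>V\<^esub> v = c \<odot>\<^bsub>V\<^esub> v \<oplus>\<^bsub>V\<^esub> d \<odot>\<^bsub>V\<^esub> v"
proof -
  interpret vectorspace class_ring V by fact
  show ?thesis using smult_l_distr[OF _ _ assms(2), of c d] by simp
qed

lemma vs_mult_smult:
  assumes "is_vs V" "v \<in> carrier V"
  shows "(c * d) \<odot>\<^bsub>V\<^esub> v = c \<odot>\<^bsub>V\<^esub> (d \<odot>\<^bsub>V\<^esub> v)"
proof -
  interpret vectorspace class_ring V by fact
  show ?thesis using smult_assoc1[OF _ _ assms(2), of c d] by simp
qed

lemma vs_one_smult:
  assumes "is_vs V" "v \<in> carrier V"
  shows "1 \<odot>\<^bsub>V\<^esub> v = v"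
proof -
  interpret vectorspace class_ring V by fact
  show ?thesis using smult_one[OF assms(2)] by simp
qed

text \<open>Every axiom is an equation or the existence of a negative, and each element of
  \<open>W\<close> is the image of one of \<open>V\<close>, so the axioms pass from \<open>V\<close>
  to \<open>W\<close>.\<close>

lemma lin_surj_vs:
  fixes V :: "('k::field, 'a) module"
  assumes V: "is_vs V" and L: "lin_surj V W \<phi>"
  shows "is_vs W"
proof -
  note s = lin_surjD[OF L]
  have im: "\<And>w. w \<in> carrier W \<Longrightarrow> (\<exists>v\<in>carrier V. w = \<phi> v)" using s(1) by auto
  note cl = vs_zero[OF V] vs_add[OF V] vs_smult[OF V]
  note r = s(2)[symmetric] s(3)[symmetric] s(4)[symmetric]
  show ?thesis
  proof (rule vs_criteria)
    show "\<forall>v\<in>carrier W. \<exists>neg_v\<in>carrier W. v \<oplus>\<^bsub>W\<^esub> neg_v = \<zero>\<^bsub>W\<^esub>"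
    proof
      fix w assume "w \<in> carrier W"
      then obtain a where a: "a \<in> carrier V" "w = \<phi> a" using im by blast
      obtain b where b: "b \<in> carrier V" "a \<oplus>\<^bsub>V\<^esub> b = \<zero>\<^bsub>V\<^esub>" using vs_neg[OF V a(1)] by blast
      have "w \<oplus>\<^bsub>W\<^esub> \<phi> b = \<zero>\<^bsub>W\<^esub>" by (simp add: a b r)
      then show "\<exists>x\<in>carrier W. w \<oplus>\<^bsub>W\<^esub> x = \<zero>\<^bsub>W\<^esub>" using s(5)[OF b(1)] by blast
    qed
    show "\<forall>v w x. v \<in> carrier W \<and> w \<in> carrier W \<and> x \<in> carrier W \<longrightarrow>
        v \<oplus>\<^bsub>W\<^esub> w \<oplus>\<^bsub>W\<^esub> x = v \<oplus>\<^bsub>W\<^esub> (w \<oplus>\<^bsub>W\<^esub> x)"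
      by (auto simp: r cl vs_assoc[OF V] dest!: im)
    show "\<forall>v w. v \<in> carrier W \<and> w \<in> carrier W \<longrightarrow> v \<oplus>\<^bsub>W\<^esub> w = w \<oplus>\<^bsub>W\<^esub> v"
      by (auto simp: r cl vs_comm[OF V] dest!: im)
    show "\<forall>a v w. a \<in> carrier class_ring \<and> v \<in> carrier W \<and> w \<in> carrier W \<longrightarrow>
        a \<odot>\<^bsub>W\<^esub> (v \<oplus>\<^bsub>W\<^esub> w) = a \<odot>\<^bsub>W\<^esub> v \<oplus>\<^bsub>W\<^esub> a \<odot>\<^bsub>W\<^esub> w"
      by (auto simp: r cl vs_smult_add[OF V] dest!: im)
    show "\<forall>a b v. a \<in> carrier class_ring \<and> b \<in> carrier class_ring \<and> v \<in> carrier W \<longrightarrow>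
        (a \<oplus>\<^bsub>class_ring\<^esub> b) \<odot>\<^bsub>W\<^esub> v = a \<odot>\<^bsub>W\<^esub> v \<oplus>\<^bsub>W\<^esub> b \<odot>\<^bsub>W\<^esub> v"
      by (auto simp: r cl vs_add_smult[OF V] dest!: im)
    show "\<forall>a b v. a \<in> carrier class_ring \<and> b \<in> carrier class_ring \<and> v \<in> carrier W \<longrightarrow>
        (a \<otimes>\<^bsub>class_ring\<^esub> b) \<odot>\<^bsub>W\<^esub> v = a \<odot>\<^bsub>W\<^esub> (b \<odot>\<^bsub>W\<^esub> v)"
      by (auto simp: r cl vs_mult_smult[OF V] dest!: im)
    show "\<forall>v\<in>carrier W. \<one>\<^bsub>class_ring\<^esub> \<odot>\<^bsub>W\<^esub> v = v"
      by (auto simp: r cl vs_one_smult[OF V] dest!: im)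
    show "\<forall>v w. v \<in> carrier W \<and> w \<in> carrier W \<longrightarrow> v \<oplus>\<^bsub>W\<^esub> w \<in> carrier W"
      by (auto simp: r cl s(5) dest!: im)
    show "\<forall>c v. c \<in> carrier class_ring \<and> v \<in> carrier W \<longrightarrow> c \<odot>\<^bsub>W\<^esub> v \<in> carrier W"
      by (auto simp: r cl s(5) dest!: im)
    show "\<zero>\<^bsub>W\<^esub> \<in> carrier W" by (simp add: r cl s(5))
    show "\<forall>v\<in>carrier W. v \<oplus>\<^bsub>W\<^esub> \<zero>\<^bsub>W\<^esub> = v"
      by (auto simp: r cl vs_r_zero[OF V] dest!: im)
  qed (rule class_field)
qed

lemma lin_surj_linear_map: "is_vs V \<Longrightarrow> lin_surj V W \<phi> \<Longrightarrow> linear_map class_ring V W \<phi>"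
  using lin_surj_vs[of V W \<phi>] lin_surjD(2,3,5)[of V W \<phi>] by (simp add: linear_map_iff)

lemma lin_surj_fin_dim:
  assumes "is_vs V" "lin_surj V W \<phi>" "vectorspace.fin_dim class_ring V"
  shows "vectorspace.fin_dim class_ring W"
proof -
  interpret linear_map class_ring V W \<phi> using assms lin_surj_linear_map by blast
  show ?thesis using surj_fin_dim assms(3) lin_surjD(1)[OF assms(2)] by blast
qed

text \<open>A set that is independent in the subspace is independent in \<open>V\<close>, so its
  size is bounded by the dimension of \<open>V\<close>; a maximal one is a finite basis.\<close>

lemma submodule_fin_dim:
  assumes V: "is_vs V" and fd: "vectorspace.fin_dim class_ring V"
    and W: "submodule class_ring W V"
  shows "is_vs (V\<lparr>carrier := W\<rparr>)" "vectorspace.fin_dim class_ring (V\<lparr>carrier := W\<rparr>)"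
proof -
  interpret V: vectorspace class_ring V by fact
  show VW: "is_vs (V\<lparr>carrier := W\<rparr>)"
    by (rule V.subspace_is_vs) (simp add: subspace_def V W)
  interpret W: vectorspace class_ring "V\<lparr>carrier := W\<rparr>" by fact
  have sub: "W \<subseteq> carrier V" using W by (simp add: submodule.subset)
  let ?P = "\<lambda>S. S \<subseteq> W \<and> \<not> W.lin_dep S"
  have li: "finite S \<and> card S \<le> V.dim" if "?P S" for S
    using V.li_le_dim[OF fd, of S] V.span_li_not_depend(2)[OF _ W, of S] that sub by auto
  have "\<exists>A. finite A \<and> maximal A ?P"
  proof (rule maximal_exists)
    show "?P {}" unfolding W.lin_dep_def by auto
  qed (use li in blast)
  then obtain A where "finite A" "maximal A ?P" by blast
  then have "W.basis A" by (intro W.max_li_is_basis) simp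
  then show "W.fin_dim" unfolding W.fin_dim_def W.basis_def using \<open>finite A\<close> by blast
qed

lemma mem_coset: "y \<in> W +>\<^bsub>V\<^esub> x \<longleftrightarrow> (\<exists>w\<in>W. y = w \<oplus>\<^bsub>V\<^esub> x)"
  unfolding a_r_coset_def' by auto

context
  fixes V :: "('k::field, 'a) module" and W
  assumes V: "is_vs V" and W: "submodule class_ring W V"
begin

lemma submodule_abelian_subgroup: "abelian_subgroup W V"
proof -
  interpret V: vectorspace class_ring V by (rule V)
  have "subgroup W (add_monoid V)"
  proof (rule group.subgroupI)
    show "Group.group (add_monoid V)" by (rule V.M.a_group)
    show "W \<subseteq> carrier (add_monoid V)" using W submodule.subset by auto
    show "W \<noteq> {}" using submodule.zero_closed[OF W] by blast
    fix a b assume a: "a \<in> W" and b: "b \<in> W"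
    show "a \<otimes>\<^bsub>add_monoid V\<^esub> b \<in> W" using submodule.m_closed[OF W a b] by simp
    have "a \<in> carrier V" using a submodule.subset[OF W] by blast
    then have "\<ominus>\<^bsub>V\<^esub> a = (- 1) \<odot>\<^bsub>V\<^esub> a"
      using V.smult_minus_1[of a] by (simp add: class_ring_simps)
    then show "inv\<^bsub>add_monoid V\<^esub> a \<in> W"
      using submodule.smult_closed[OF W, of "-1" a] a by (simp add: a_inv_def)
  qed
  then show ?thesis
    by (intro abelian_subgroupI3 additive_subgroupI V.M.abelian_group_axioms)
qed

lemma submodule_carrier: "w \<in> W \<Longrightarrow> w \<in> carrier V"
  using W submodule.subset by blast

lemma coset_eq_iff:
  assumes x: "x \<in> carrier V" and y: "y \<in> carrier V"
  shows "W +>\<^bsub>V\<^esub> x = W +>\<^bsub>V\<^esub> y \<longleftrightarrow> (\<exists>w\<in>W. y = w \<oplus>\<^bsub>V\<^esub> x)"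
proof -
  interpret W: abelian_subgroup W V by (rule submodule_abelian_subgroup)
  show ?thesis
  proof
    assume eq: "W +>\<^bsub>V\<^esub> x = W +>\<^bsub>V\<^esub> y"
    have "y \<in> W +>\<^bsub>V\<^esub> y" using y by (rule W.a_rcos_self)
    then show "\<exists>w\<in>W. y = w \<oplus>\<^bsub>V\<^esub> x" unfolding eq[symmetric] mem_coset .
  next
    assume "\<exists>w\<in>W. y = w \<oplus>\<^bsub>V\<^esub> x"
    then have "y \<in> W +>\<^bsub>V\<^esub> x" by (simp add: mem_coset)
    then show "W +>\<^bsub>V\<^esub> x = W +>\<^bsub>V\<^esub> y"
      using W.a_repr_independence x W.a_subgroup by blast
  qed
qed

lemma coset_absorb: "x \<in> carrier V \<Longrightarrow> w \<in> W \<Longrightarrow> W +>\<^bsub>V\<^esub> (w \<oplus>\<^bsub>V\<^esub> x) = W +>\<^bsub>V\<^esub> x"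
  using coset_eq_iff[of x "w \<oplus>\<^bsub>V\<^esub> x"] vs_add[OF V] submodule_carrier by metis

lemma coset_eq_self_iff: "x \<in> carrier V \<Longrightarrow> W +>\<^bsub>V\<^esub> x = W \<longleftrightarrow> x \<in> W"
proof -
  assume x: "x \<in> carrier V"
  interpret W: abelian_subgroup W V by (rule submodule_abelian_subgroup)
  have "W +>\<^bsub>V\<^esub> \<zero>\<^bsub>V\<^esub> = W" using W.a_coset_add_zero submodule_carrier by blast
  moreover have "W +>\<^bsub>V\<^esub> \<zero>\<^bsub>V\<^esub> = W +>\<^bsub>V\<^esub> x \<longleftrightarrow> (\<exists>w\<in>W. x = w \<oplus>\<^bsub>V\<^esub> \<zero>\<^bsub>V\<^esub>)"
    using coset_eq_iff[OF vs_zero[OF V] x] .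
  ultimately show ?thesis using vs_r_zero[OF V] submodule_carrier by metis
qed

lemma coset_self_mem: "x \<in> carrier V \<Longrightarrow> x \<in> W +>\<^bsub>V\<^esub> x"
  using abelian_subgroup.a_rcos_self[OF submodule_abelian_subgroup] .

lemma coset_subset: "x \<in> carrier V \<Longrightarrow> W +>\<^bsub>V\<^esub> x \<subseteq> carrier V"
  using vs_add[OF V] submodule_carrier by (auto simp: mem_coset)

end

text \<open>The union runs over equal cosets: two representatives differ by an element of
  \<open>W\<close>, which \<open>f\<close> sends into \<open>W'\<close>.\<close>

lemma coset_map_coset:
  fixes V :: "('k::field, 'a) module" and V' :: "('k, 'b) module"
  assumes V: "is_vs V" and W: "submodule class_ring W V"
    and V': "is_vs V'" and W': "submodule class_ring W' V'"
    and add: "\<And>u v. u \<in> carrier V \<Longrightarrow> v \<in> carrier V \<Longrightarrow> f (u \<oplus>\<^bsub>V\<^esub> v) = f u \<oplus>\<^bsub>V'\<^esub> f v"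
    and cl: "\<And>v. v \<in> carrier V \<Longrightarrow> f v \<in> carrier V'" and fW: "\<And>w. w \<in> W \<Longrightarrow> f w \<in> W'"
    and x: "x \<in> carrier V"
  shows "coset_map V' W' f (W +>\<^bsub>V\<^esub> x) = W' +>\<^bsub>V'\<^esub> f x"
proof -
  have "W' +>\<^bsub>V'\<^esub> f a = W' +>\<^bsub>V'\<^esub> f x" if a: "a \<in> W +>\<^bsub>V\<^esub> x" for a
  proof -
    obtain w where w: "w \<in> W" "a = w \<oplus>\<^bsub>V\<^esub> x" using a unfolding mem_coset by blast
    then have "f a = f w \<oplus>\<^bsub>V'\<^esub> f x" using add submodule_carrier[OF V W] x by blast
    then show ?thesis using coset_absorb[OF V' W' cl[OF x] fW[OF w(1)]] by simp
  qed
  then show ?thesis unfolding coset_map_def using coset_self_mem[OF V W x] by blast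
qed

context
  fixes V :: "('k::field, 'a) module" and W
  assumes V: "is_vs V" and W: "submodule class_ring W V"
begin

lemma lin_surj_quot: "lin_surj V (quot_space V W) (\<lambda>v. W +>\<^bsub>V\<^esub> v)"
proof -
  interpret V: vectorspace class_ring V by (rule V)
  interpret W: abelian_subgroup W V by (rule submodule_abelian_subgroup[OF V W])
  have "coset_map V W (\<lambda>v. c \<odot>\<^bsub>V\<^esub> v) (W +>\<^bsub>V\<^esub> x) = W +>\<^bsub>V\<^esub> (c \<odot>\<^bsub>V\<^esub> x)" if "x \<in> carrier V" for c x
    using that vs_smult[OF V] submodule.smult_closed[OF W] V.smult_r_distr
    by (intro coset_map_coset[OF V W V W]) auto
  moreover have "(\<lambda>v. W +>\<^bsub>V\<^esub> v) ` carrier V = a_rcosets\<^bsub>V\<^esub> W"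
    unfolding A_RCOSETS_def' by auto
  moreover have "W +>\<^bsub>V\<^esub> \<zero>\<^bsub>V\<^esub> = W"
    using coset_eq_self_iff[OF V W vs_zero[OF V]] submodule.zero_closed[OF W] by simp
  ultimately show ?thesis unfolding lin_surj_def quot_space_def
    by (auto simp: W.a_rcos_sum)
qed

lemma quot_space_vs: "is_vs (quot_space V W)"
  using lin_surj_vs[OF V lin_surj_quot] .

lemma quot_space_fin_dim:
  "vectorspace.fin_dim class_ring V \<Longrightarrow> vectorspace.fin_dim class_ring (quot_space V W)"
  using lin_surj_fin_dim[OF V lin_surj_quot] .

end

lemma submodule_iff:
  assumes "is_vs V"
  shows "submodule class_ring W V \<longleftrightarrow> W \<subseteq> carrier V \<and> \<zero>\<^bsub>V\<^esub> \<in> W \<and>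
    (\<forall>u\<in>W. \<forall>v\<in>W. u \<oplus>\<^bsub>V\<^esub> v \<in> W) \<and> (\<forall>c. \<forall>v\<in>W. c \<odot>\<^bsub>V\<^esub> v \<in> W)"
  using assms unfolding submodule_def vectorspace_def by auto

lemma submodule_image:
  assumes "linear_map class_ring V W f"
  shows "submodule class_ring (f ` carrier V) W"
proof -
  interpret linear_map class_ring V W f by fact
  show ?thesis using im_is_submodule unfolding im_def .
qed

lemma submodule_kernel:
  assumes "linear_map class_ring V W f"
  shows "submodule class_ring {v \<in> carrier V. f v = \<zero>\<^bsub>W\<^esub>} V"
proof -
  interpret linear_map class_ring V W f by fact
  show ?thesis using ker_is_submodule unfolding ker_def .
qed

lemma linear_map_comp:
  fixes U :: "('k::field, 'a) module" and V :: "('k, 'b) module" and W :: "('k, 'c) module"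
  assumes "linear_map class_ring U V f" "linear_map class_ring V W g"
  shows "linear_map class_ring U W (\<lambda>u. g (f u))"
  using assms unfolding linear_map_iff by auto

lemma lin_surj_comp:
  assumes f: "lin_surj U V f" and g: "lin_surj V W g"
  shows "lin_surj U W (\<lambda>u. g (f u))"
proof -
  have "(\<lambda>u. g (f u)) ` carrier U = g ` f ` carrier U" by (simp add: image_image)
  then show ?thesis unfolding lin_surj_def
    using lin_surjD[OF f] lin_surjD[OF g] by simp
qed

lemma lin_iso_comp:
  assumes "lin_iso U V f" "lin_iso V W g"
  shows "lin_iso U W (\<lambda>u. g (f u))"
  using assms lin_surj_comp[of U V f W g] lin_surjD(1)[of U V f] comp_inj_on[of f "carrier U" g]
  unfolding lin_iso_def comp_def by simp

lemma lin_iso_inv: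
  assumes V: "is_vs V" and L: "lin_iso V W \<phi>"
  shows "lin_iso W V (the_inv_into (carrier V) \<phi>)"
proof -
  note s = lin_surjD[OF lin_isoD(1)[OF L]] and i = lin_isoD(2)[OF L]
  have im: "\<And>w. w \<in> carrier W \<Longrightarrow> \<exists>v\<in>carrier V. w = \<phi> v" using s(1) by auto
  have inv: "\<And>v. v \<in> carrier V \<Longrightarrow> the_inv_into (carrier V) \<phi> (\<phi> v) = v"
    using the_inv_into_f_f[OF i] .
  have b: "bij_betw (the_inv_into (carrier V) \<phi>) (carrier W) (carrier V)"
    using bij_betw_the_inv_into[OF lin_isoD(3)[OF L]] .
  have "the_inv_into (carrier V) \<phi> (u \<oplus>\<^bsub>W\<^esub> v) =
      the_inv_into (carrier V) \<phi> u \<oplus>\<^bsub>V\<^esub> the_inv_into (carrier V) \<phi> v"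
    if uv: "u \<in> carrier W" "v \<in> carrier W" for u v
  proof -
    obtain a b where ab: "a \<in> carrier V" "b \<in> carrier V" "u = \<phi> a" "v = \<phi> b"
      using im[OF uv(1)] im[OF uv(2)] by blast
    then have "u \<oplus>\<^bsub>W\<^esub> v = \<phi> (a \<oplus>\<^bsub>V\<^esub> b)" by (simp add: s(2))
    then show ?thesis using ab inv vs_add[OF V] by simp
  qed
  moreover have "the_inv_into (carrier V) \<phi> (c \<odot>\<^bsub>W\<^esub> v) = c \<odot>\<^bsub>V\<^esub> the_inv_into (carrier V) \<phi> v"
    if v: "v \<in> carrier W" for c v
  proof -
    obtain a where ab: "a \<in> carrier V" "v = \<phi> a" using im[OF v] by blast
    then have "c \<odot>\<^bsub>W\<^esub> v = \<phi> (c \<odot>\<^bsub>V\<^esub> a)" by (simp add: s(3))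
    then show ?thesis using ab inv vs_smult[OF V] by simp
  qed
  moreover have "the_inv_into (carrier V) \<phi> \<zero>\<^bsub>W\<^esub> = \<zero>\<^bsub>V\<^esub>"
    using inv[OF vs_zero[OF V]] s(4) by simp
  ultimately show ?thesis using b unfolding lin_iso_def lin_surj_def bij_betw_def by auto
qed

section \<open>Isomorphisms of representations\<close>

lemma coset_image:
  assumes add: "\<And>u v. u \<in> carrier V \<Longrightarrow> v \<in> carrier V \<Longrightarrow> f (u \<oplus>\<^bsub>V\<^esub> v) = f u \<oplus>\<^bsub>V'\<^esub> f v"
    and W: "W \<subseteq> carrier V" and v: "v \<in> carrier V"
  shows "f ` (W +>\<^bsub>V\<^esub> v) = (f ` W) +>\<^bsub>V'\<^esub> f v"
proof -
  have "f (w \<oplus>\<^bsub>V\<^esub> v) = f w \<oplus>\<^bsub>V'\<^esub> f v" if "w \<in> W" for w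
    using that add W v by blast
  then show ?thesis unfolding a_r_coset_def' by (auto simp: image_iff)
qed

text \<open>First isomorphism theorem. Only the values of \<open>h\<close> on cosets are prescribed,
  so it serves both for direct images of cosets and for maps evaluated at a chosen
  representative.\<close>

lemma lin_iso_quot:
  fixes V :: "('k::field, 'a) module" and Z :: "('k, 'b) module"
  assumes V: "is_vs V" and W: "submodule class_ring W V" and q: "lin_surj V Z q"
    and h: "\<And>v. v \<in> carrier V \<Longrightarrow> h (W +>\<^bsub>V\<^esub> v) = q v"
    and ker: "\<And>v. v \<in> carrier V \<Longrightarrow> q v = \<zero>\<^bsub>Z\<^esub> \<Longrightarrow> v \<in> W"
  shows "lin_iso (quot_space V W) Z h"
proof -
  let ?p = "\<lambda>v. W +>\<^bsub>V\<^esub> v"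
  note p = lin_surjD[OF lin_surj_quot[OF V W]] and s = lin_surjD[OF q]
  have Z: "is_vs Z" by (rule lin_surj_vs[OF V q])
  have im: "\<exists>v\<in>carrier V. X = ?p v" if "X \<in> carrier (quot_space V W)" for X
    using that p(1) by auto
  have "h ` carrier (quot_space V W) = h ` ?p ` carrier V" by (simp add: p(1))
  also have "\<dots> = q ` carrier V" by (force simp: h image_image)
  finally have 1: "h ` carrier (quot_space V W) = carrier Z" by (simp add: s(1))
  have 2: "h (X \<oplus>\<^bsub>quot_space V W\<^esub> Y) = h X \<oplus>\<^bsub>Z\<^esub> h Y"
    if X: "X \<in> carrier (quot_space V W)" and Y: "Y \<in> carrier (quot_space V W)" for X Y
  proof -
    obtain u v where u: "u \<in> carrier V" "X = ?p u" and v: "v \<in> carrier V" "Y = ?p v"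
      using im[OF X] im[OF Y] by blast
    show ?thesis unfolding u(2) v(2) p(2)[OF u(1) v(1), symmetric]
      by (simp add: h vs_add[OF V] u(1) v(1) s(2))
  qed
  have 3: "h (c \<odot>\<^bsub>quot_space V W\<^esub> X) = c \<odot>\<^bsub>Z\<^esub> h X" if X: "X \<in> carrier (quot_space V W)" for c X
  proof -
    obtain u where u: "u \<in> carrier V" "X = ?p u" using im[OF X] by blast
    show ?thesis unfolding u(2) p(3)[OF u(1), symmetric] by (simp add: h vs_smult[OF V] u(1) s(3))
  qed
  have 4: "h \<zero>\<^bsub>quot_space V W\<^esub> = \<zero>\<^bsub>Z\<^esub>"
    unfolding p(4)[symmetric] using h[OF vs_zero[OF V]] s(4) by simp
  have "inj_on h (carrier (quot_space V W))"
  proof (rule inj_onI)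
    fix X Y assume X: "X \<in> carrier (quot_space V W)" and Y: "Y \<in> carrier (quot_space V W)"
      and eq: "h X = h Y"
    obtain u v where u: "u \<in> carrier V" "X = ?p u" and v: "v \<in> carrier V" "Y = ?p v"
      using im[OF X] im[OF Y] by blast
    \<comment> \<open>With \<open>u'\<close> the negative of \<open>u\<close>, the difference of
      \<open>v\<close> and \<open>u\<close> lies in the kernel of \<open>q\<close>, hence in
      \<open>W\<close>.\<close>
    obtain u' where u': "u' \<in> carrier V" "u \<oplus>\<^bsub>V\<^esub> u' = \<zero>\<^bsub>V\<^esub>" using vs_neg[OF V u(1)] by blast
    have "q u = q v" using eq u v by (simp add: h)
    then have "q (v \<oplus>\<^bsub>V\<^esub> u') = q (u \<oplus>\<^bsub>V\<^esub> u')"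
      using s(2)[OF v(1) u'(1)] s(2)[OF u(1) u'(1)] by simp
    then have "v \<oplus>\<^bsub>V\<^esub> u' \<in> W" using ker[OF vs_add[OF V v(1) u'(1)]] u'(2) s(4) by simp
    moreover have "v = v \<oplus>\<^bsub>V\<^esub> u' \<oplus>\<^bsub>V\<^esub> u"
      using u' u(1) v(1) vs_comm[OF V u(1) u'(1)] vs_assoc[OF V v(1) u'(1) u(1)] vs_r_zero[OF V v(1)]
      by simp
    ultimately show "X = Y" unfolding u(2) v(2) coset_eq_iff[OF V W u(1) v(1)] by blast
  qed
  with 1 2 3 4 show ?thesis unfolding lin_iso_def lin_surj_def by blast
qed

text \<open>An isomorphism given by one map: the inverse is recovered as \<open>rep_inv\<close>, and
  that the target is a representation becomes a conclusion.\<close>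

definition rep_bij ::
  "('k::field, 'a) rep \<Rightarrow> ('k, 'b) rep \<Rightarrow> (int \<times> int \<Rightarrow> 'a \<Rightarrow> 'b) \<Rightarrow> bool" where
  "rep_bij M N \<phi> \<longleftrightarrow>
    (\<forall>i. lin_iso (vsp M i) (vsp N i) (\<phi> i)) \<and>
    (\<forall>i. \<forall>m\<in>carrier (vsp M i). \<phi> (i + (1,0)) (xact M i m) = xact N i (\<phi> i m)) \<and>
    (\<forall>i. \<forall>m\<in>carrier (vsp M i). \<phi> (i + (0,1)) (yact M i m) = yact N i (\<phi> i m))"

lemma rep_bijD:
  assumes "rep_bij M N \<phi>"
  shows "lin_iso (vsp M i) (vsp N i) (\<phi> i)" "lin_surj (vsp M i) (vsp N i) (\<phi> i)"
    "m \<in> carrier (vsp M i) \<Longrightarrow> \<phi> (i + (1,0)) (xact M i m) = xact N i (\<phi> i m)"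
    "m \<in> carrier (vsp M i) \<Longrightarrow> \<phi> (i + (0,1)) (yact M i m) = yact N i (\<phi> i m)"
    "m \<in> carrier (vsp M i) \<Longrightarrow> \<phi> i m \<in> carrier (vsp N i)"
    "\<phi> i ` carrier (vsp M i) = carrier (vsp N i)"
    "inj_on (\<phi> i) (carrier (vsp M i))"
  using assms lin_isoD lin_surjD unfolding rep_bij_def by blast+

lemma is_repD:
  assumes "is_rep M"
  shows "is_vs (vsp M i)" "vectorspace.fin_dim class_ring (vsp M i)"
    "linear_map class_ring (vsp M i) (vsp M (i + (1,0))) (xact M i)"
    "linear_map class_ring (vsp M i) (vsp M (i + (0,1))) (yact M i)"
    "m \<in> carrier (vsp M i) \<Longrightarrow> xact M i m \<in> carrier (vsp M (i + (1,0)))"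
    "m \<in> carrier (vsp M i) \<Longrightarrow> yact M i m \<in> carrier (vsp M (i + (0,1)))"
    "m \<in> carrier (vsp M i) \<Longrightarrow> yact M (i + (1,0)) (xact M i m) = xact M (i + (0,1)) (yact M i m)"
  using assms unfolding is_rep_def linear_map_iff by blast+

lemma rep_homD:
  assumes "rep_hom M N \<phi>"
  shows "linear_map class_ring (vsp M i) (vsp N i) (\<phi> i)"
    "m \<in> carrier (vsp M i) \<Longrightarrow> \<phi> (i + (1,0)) (xact M i m) = xact N i (\<phi> i m)"
    "m \<in> carrier (vsp M i) \<Longrightarrow> \<phi> (i + (0,1)) (yact M i m) = yact N i (\<phi> i m)"
    "m \<in> carrier (vsp M i) \<Longrightarrow> \<phi> i m \<in> carrier (vsp N i)"
  using assms unfolding rep_hom_def linear_map_iff by blast+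

lemma rep_hom_comp:
  fixes M :: "('k::field, 'a) rep"
  assumes f: "rep_hom M N \<phi>" and g: "rep_hom N L \<psi>"
  shows "rep_hom M L (\<lambda>i m. \<psi> i (\<phi> i m))"
  unfolding rep_hom_def
  using linear_map_comp[OF rep_homD(1)[OF f] rep_homD(1)[OF g]]
  by (simp add: rep_homD(2,3)[OF f] rep_homD(2,3)[OF g] rep_homD(4)[OF f])

lemma rep_bij_comp:
  fixes M :: "('k::field, 'a) rep"
  assumes f: "rep_bij M N \<phi>" and g: "rep_bij N L \<psi>"
  shows "rep_bij M L (\<lambda>i m. \<psi> i (\<phi> i m))"
  unfolding rep_bij_def
  using lin_iso_comp[OF rep_bijD(1)[OF f] rep_bijD(1)[OF g]]
  by (simp add: rep_bijD(3,4)[OF f] rep_bijD(3,4)[OF g] rep_bijD(5)[OF f])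

lemma rep_bij_act_linear:
  fixes M :: "('k::field, 'a) rep" and N :: "('k, 'b) rep"
  assumes lin: "linear_map class_ring V V' f"
    and a: "lin_iso V U \<phi>" and b: "lin_surj V' U' \<phi>'"
    and f: "\<And>m. m \<in> carrier V \<Longrightarrow> \<phi>' (f m) = g (\<phi> m)"
  shows "linear_map class_ring U U' g"
proof -
  have V: "is_vs V" "is_vs V'" using lin unfolding linear_map_iff by blast+
  note s = lin_surjD[OF lin_isoD(1)[OF a]] and t = lin_surjD[OF b]
  have im: "\<And>w. w \<in> carrier U \<Longrightarrow> \<exists>v\<in>carrier V. w = \<phi> v" using s(1) by auto
  have l: "\<And>v. v \<in> carrier V \<Longrightarrow> f v \<in> carrier V'"
    "\<And>u v. u \<in> carrier V \<Longrightarrow> v \<in> carrier V \<Longrightarrow> f (u \<oplus>\<^bsub>V\<^esub> v) = f u \<oplus>\<^bsub>V'\<^esub> f v"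
    "\<And>c v. v \<in> carrier V \<Longrightarrow> f (c \<odot>\<^bsub>V\<^esub> v) = c \<odot>\<^bsub>V'\<^esub> f v"
    using lin unfolding linear_map_iff by blast+
  have 1: "g u \<in> carrier U'" if "u \<in> carrier U" for u
    using im[OF that] f l(1) t(5) by force
  have 2: "g (u \<oplus>\<^bsub>U\<^esub> v) = g u \<oplus>\<^bsub>U'\<^esub> g v" if "u \<in> carrier U" "v \<in> carrier U" for u v
    using im[OF that(1)] im[OF that(2)]
    by (auto simp: s(2)[symmetric] vs_add[OF V(1)] f[symmetric] l t(2))
  have 3: "g (c \<odot>\<^bsub>U\<^esub> v) = c \<odot>\<^bsub>U'\<^esub> g v" if "v \<in> carrier U" for c v
    using im[OF that] by (auto simp: s(3)[symmetric] vs_smult[OF V(1)] f[symmetric] l t(3))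
  show ?thesis unfolding linear_map_iff
    using 1 2 3 lin_surj_vs[OF V(1) lin_isoD(1)[OF a]] lin_surj_vs[OF V(2) b] by blast
qed

text \<open>Direct sums of spread representations get their structure from here: they occur as
  targets of an isomorphism from a given representation.\<close>

lemma rep_bij_is_rep:
  fixes M :: "('k::field, 'a) rep" and N :: "('k, 'b) rep"
  assumes M: "is_rep M" and b: "rep_bij M N \<phi>"
  shows "is_rep N"
proof -
  note d = is_repD[OF M] and e = rep_bijD[OF b]
  have 1: "is_vs (vsp N i)" for i using lin_surj_vs[OF d(1) e(2)] .
  have 2: "vectorspace.fin_dim class_ring (vsp N i)" for i
    using lin_surj_fin_dim[OF d(1) e(2) d(2)] .
  have 3: "linear_map class_ring (vsp N i) (vsp N (i + (1,0))) (xact N i)" for i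
    by (rule rep_bij_act_linear[OF d(3) e(1) e(2) e(3)])
  have 4: "linear_map class_ring (vsp N i) (vsp N (i + (0,1))) (yact N i)" for i
    by (rule rep_bij_act_linear[OF d(4) e(1) e(2) e(4)])
  have 5: "yact N (i + (1,0)) (xact N i n) = xact N (i + (0,1)) (yact N i n)"
    if n: "n \<in> carrier (vsp N i)" for i n
  proof -
    obtain m where m: "m \<in> carrier (vsp M i)" "n = \<phi> i m" using n e(6) by blast
    have "yact N (i + (1,0)) (xact N i n) = \<phi> (i + (1,0) + (0,1)) (yact M (i + (1,0)) (xact M i m))"
      using m d(5) e(3,4) by simp
    also have "\<dots> = \<phi> (i + (0,1) + (1,0)) (xact M (i + (0,1)) (yact M i m))"
      using d(7)[OF m(1)] by (simp add: add.assoc)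
    also have "\<dots> = xact N (i + (0,1)) (yact N i n)" using m d(6) e(3,4) by simp
    finally show ?thesis .
  qed
  show ?thesis unfolding is_rep_def using 1 2 3 4 5 by blast
qed

definition rep_inv where
  "rep_inv M \<phi> = (\<lambda>i. the_inv_into (carrier (vsp M i)) (\<phi> i))"

lemma rep_inv_inverse:
  assumes b: "rep_bij M N \<phi>"
  shows "m \<in> carrier (vsp M i) \<Longrightarrow> rep_inv M \<phi> i (\<phi> i m) = m"
    "n \<in> carrier (vsp N i) \<Longrightarrow> \<phi> i (rep_inv M \<phi> i n) = n"
    "n \<in> carrier (vsp N i) \<Longrightarrow> rep_inv M \<phi> i n \<in> carrier (vsp M i)"
  unfolding rep_inv_def using rep_bijD(6,7)[OF b]
  by (simp_all add: the_inv_into_f_f f_the_inv_into_f the_inv_into_into)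

lemma rep_bij_inv:
  fixes M :: "('k::field, 'a) rep" and N :: "('k, 'b) rep"
  assumes M: "is_rep M" and b: "rep_bij M N \<phi>"
  shows "rep_bij N M (rep_inv M \<phi>)"
proof -
  note d = is_repD[OF M] and e = rep_bijD[OF b] and v = rep_inv_inverse[OF b]
  have "rep_inv M \<phi> (i + (1,0)) (xact N i n) = xact M i (rep_inv M \<phi> i n)"
    if n: "n \<in> carrier (vsp N i)" for i n
    using e(3)[OF v(3)[OF n]] v(1)[OF d(5)[OF v(3)[OF n]]] v(2)[OF n] by simp
  moreover have "rep_inv M \<phi> (i + (0,1)) (yact N i n) = yact M i (rep_inv M \<phi> i n)"
    if n: "n \<in> carrier (vsp N i)" for i n
    using e(4)[OF v(3)[OF n]] v(1)[OF d(6)[OF v(3)[OF n]]] v(2)[OF n] by simp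
  moreover have "lin_iso (vsp N i) (vsp M i) (rep_inv M \<phi> i)" for i
    unfolding rep_inv_def by (rule lin_iso_inv[OF d(1) e(1)])
  ultimately show ?thesis unfolding rep_bij_def by blast
qed

lemma rep_bij_hom:
  fixes M :: "('k::field, 'a) rep" and N :: "('k, 'b) rep"
  assumes "is_rep M" "rep_bij M N \<phi>"
  shows "rep_hom M N \<phi>"
  unfolding rep_hom_def
  using lin_surj_linear_map[OF is_repD(1)[OF assms(1)] rep_bijD(2)[OF assms(2)]]
    rep_bijD(3,4)[OF assms(2)] by blast

lemma rep_hom_bij:
  assumes f: "rep_hom M N \<phi>" and g: "rep_hom N M \<phi>'" and inv: "mutually_inverse M N \<phi> \<phi>'"
  shows "rep_bij M N \<phi>"
proof -
  have "lin_iso (vsp M i) (vsp N i) (\<phi> i)" for i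
  proof -
    have l: "\<And>m. m \<in> carrier (vsp M i) \<Longrightarrow> \<phi>' i (\<phi> i m) = m"
      and r: "\<And>n. n \<in> carrier (vsp N i) \<Longrightarrow> \<phi> i (\<phi>' i n) = n"
      using inv unfolding mutually_inverse_def by blast+
    have "inj_on (\<phi> i) (carrier (vsp M i))" using l by (rule inj_on_inverseI)
    moreover have "\<phi> i ` carrier (vsp M i) = carrier (vsp N i)"
    proof
      show "\<phi> i ` carrier (vsp M i) \<subseteq> carrier (vsp N i)" using rep_homD(4)[OF f] by blast
      show "carrier (vsp N i) \<subseteq> \<phi> i ` carrier (vsp M i)"
        using rep_homD(4)[OF g] r[symmetric] by blast
    qed
    ultimately show ?thesis
      using rep_homD(1)[OF f, of i] linear_map_zero[OF rep_homD(1)[OF f, of i]]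
      unfolding lin_iso_def lin_surj_def linear_map_iff by blast
  qed
  then show ?thesis using rep_homD(2,3)[OF f] unfolding rep_bij_def by blast
qed

lemma rep_iso_iff:
  fixes M :: "('k::field, 'a) rep" and N :: "('k, 'b) rep"
  assumes M: "is_rep M"
  shows "rep_iso M N \<longleftrightarrow> (\<exists>\<phi>. rep_bij M N \<phi>)"
proof
  assume "rep_iso M N" then show "\<exists>\<phi>. rep_bij M N \<phi>" unfolding rep_iso_def using rep_hom_bij by blast
next
  assume "\<exists>\<phi>. rep_bij M N \<phi>"
  then obtain \<phi> where b: "rep_bij M N \<phi>" by blast
  have "mutually_inverse M N \<phi> (rep_inv M \<phi>)"
    unfolding mutually_inverse_def using rep_inv_inverse[OF b] by blast
  then show "rep_iso M N" unfolding rep_iso_def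
    using rep_bij_hom[OF M b] rep_bij_hom[OF rep_bij_is_rep[OF M b] rep_bij_inv[OF M b]] by blast
qed

section \<open>Subrepresentations and quotients\<close>

definition subrep :: "('k::field, 'a) rep \<Rightarrow> (int \<times> int \<Rightarrow> 'a set) \<Rightarrow> bool" where
  "subrep M W \<longleftrightarrow> (\<forall>i. submodule class_ring (W i) (vsp M i)) \<and>
    (\<forall>i. \<forall>m\<in>W i. xact M i m \<in> W (i + (1,0))) \<and> (\<forall>i. \<forall>m\<in>W i. yact M i m \<in> W (i + (0,1)))"

lemma subrepD:
  assumes "subrep M W"
  shows "submodule class_ring (W i) (vsp M i)" "m \<in> W i \<Longrightarrow> xact M i m \<in> W (i + (1,0))"
    "m \<in> W i \<Longrightarrow> yact M i m \<in> W (i + (0,1))" "W i \<subseteq> carrier (vsp M i)"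
  using assms submodule.subset unfolding subrep_def by blast+

lemma linear_map_restrict:
  fixes V :: "('k::field, 'a) module" and U :: "('k, 'b) module"
  assumes "linear_map class_ring V U f" "submodule class_ring W V"
  shows "linear_map class_ring (V\<lparr>carrier := W\<rparr>) U f"
proof -
  have V: "is_vs V" using assms(1) unfolding linear_map_iff by blast
  have "is_vs (V\<lparr>carrier := W\<rparr>)"
    using vectorspace.subspace_is_vs[OF V, of W] assms(2) V by (simp add: subspace_def)
  moreover have "\<And>w. w \<in> W \<Longrightarrow> w \<in> carrier V" using assms(2) submodule.subset by blast
  ultimately show ?thesis using assms(1) unfolding linear_map_iff by simp
qed

lemma linear_map_corestrict:
  fixes V :: "('k::field, 'a) module" and U :: "('k, 'b) module"
  assumes "linear_map class_ring U V f" "submodule class_ring W V" "\<And>u. u \<in> carrier U \<Longrightarrow> f u \<in> W"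
  shows "linear_map class_ring U (V\<lparr>carrier := W\<rparr>) f"
proof -
  have V: "is_vs V" using assms(1) unfolding linear_map_iff by blast
  have "is_vs (V\<lparr>carrier := W\<rparr>)"
    using vectorspace.subspace_is_vs[OF V, of W] assms(2) V by (simp add: subspace_def)
  then show ?thesis using assms(1,3) unfolding linear_map_iff by auto
qed

lemma sub_rep_is_rep:
  fixes M :: "('k::field, 'a) rep"
  assumes M: "is_rep M" and W: "subrep M W"
  shows "is_rep (sub_rep M W)"
proof -
  note d = is_repD[OF M] and w = subrepD[OF W]
  have "linear_map class_ring ((vsp M i)\<lparr>carrier := W i\<rparr>) ((vsp M (i + (1,0)))\<lparr>carrier := W (i + (1,0))\<rparr>) (xact M i)" for i
    by (rule linear_map_corestrict[OF linear_map_restrict[OF d(3) w(1)] w(1)]) (simp add: w(2))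
  moreover have "linear_map class_ring ((vsp M i)\<lparr>carrier := W i\<rparr>) ((vsp M (i + (0,1)))\<lparr>carrier := W (i + (0,1))\<rparr>) (yact M i)" for i
    by (rule linear_map_corestrict[OF linear_map_restrict[OF d(4) w(1)] w(1)]) (simp add: w(3))
  ultimately show ?thesis
    unfolding is_rep_def sub_rep_def using submodule_fin_dim[OF d(1,2) w(1)] d(7) w(4)
    by (auto simp: subset_iff)
qed

lemma sub_rep_hom:
  fixes M :: "('k::field, 'a) rep"
  assumes f: "rep_hom M N \<phi>" and W: "subrep M W"
  shows "rep_hom (sub_rep M W) N \<phi>"
proof -
  note d = rep_homD[OF f] and w = subrepD[OF W]
  show ?thesis unfolding rep_hom_def
    using linear_map_restrict[OF d(1) w(1)] d(2,3) w(4) by (auto simp: sub_rep_def subset_iff)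
qed

lemma quot_rep_act:
  fixes M :: "('k::field, 'a) rep"
  assumes M: "is_rep M" and W: "subrep M W" and m: "m \<in> carrier (vsp M i)"
  shows "xact (quot_rep M W) i (W i +>\<^bsub>vsp M i\<^esub> m) = W (i + (1,0)) +>\<^bsub>vsp M (i + (1,0))\<^esub> xact M i m"
    "yact (quot_rep M W) i (W i +>\<^bsub>vsp M i\<^esub> m) = W (i + (0,1)) +>\<^bsub>vsp M (i + (0,1))\<^esub> yact M i m"
proof -
  note d = is_repD[OF M] and w = subrepD[OF W]
  have x: "coset_map (vsp M (i + (1,0))) (W (i + (1,0))) (xact M i) (W i +>\<^bsub>vsp M i\<^esub> m) =
      W (i + (1,0)) +>\<^bsub>vsp M (i + (1,0))\<^esub> xact M i m"
    using d(3)[of i] by (intro coset_map_coset d w m) (auto simp: linear_map_iff)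
  have y: "coset_map (vsp M (i + (0,1))) (W (i + (0,1))) (yact M i) (W i +>\<^bsub>vsp M i\<^esub> m) =
      W (i + (0,1)) +>\<^bsub>vsp M (i + (0,1))\<^esub> yact M i m"
    using d(4)[of i] by (intro coset_map_coset d w m) (auto simp: linear_map_iff)
  show "xact (quot_rep M W) i (W i +>\<^bsub>vsp M i\<^esub> m) = W (i + (1,0)) +>\<^bsub>vsp M (i + (1,0))\<^esub> xact M i m"
    "yact (quot_rep M W) i (W i +>\<^bsub>vsp M i\<^esub> m) = W (i + (0,1)) +>\<^bsub>vsp M (i + (0,1))\<^esub> yact M i m"
    using x y by (simp_all add: quot_rep_def)
qed

lemma quot_rep_surj:
  fixes M :: "('k::field, 'a) rep"
  assumes M: "is_rep M" and W: "subrep M W"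
  shows "lin_surj (vsp M i) (vsp (quot_rep M W) i) (\<lambda>m. W i +>\<^bsub>vsp M i\<^esub> m)"
  using lin_surj_quot[OF is_repD(1)[OF M] subrepD(1)[OF W]] by (simp add: quot_rep_def)

lemma quot_rep_elem:
  fixes M :: "('k::field, 'a) rep"
  assumes "is_rep M" "subrep M W" "X \<in> carrier (vsp (quot_rep M W) i)"
  obtains m where "m \<in> carrier (vsp M i)" "X = W i +>\<^bsub>vsp M i\<^esub> m"
  using lin_surjD(1)[OF quot_rep_surj[OF assms(1,2)], of i] assms(3) by blast

lemma quot_rep_is_rep:
  fixes M :: "('k::field, 'a) rep"
  assumes M: "is_rep M" and W: "subrep M W"
  shows "is_rep (quot_rep M W)"
proof -
  note d = is_repD[OF M] and w = subrepD[OF W] and q = quot_rep_act[OF M W]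
  note s = lin_surjD[OF quot_rep_surj[OF M W]]
  have im: "\<And>X i. X \<in> carrier (vsp (quot_rep M W) i) \<Longrightarrow> \<exists>m\<in>carrier (vsp M i). X = W i +>\<^bsub>vsp M i\<^esub> m"
    using s(1) by blast
  have V: "is_vs (vsp (quot_rep M W) i)" for i
    using quot_space_vs[OF d(1) w(1)] by (simp add: quot_rep_def)
  have F: "vectorspace.fin_dim class_ring (vsp (quot_rep M W) i)" for i
    using quot_space_fin_dim[OF d(1) w(1) d(2)] by (simp add: quot_rep_def)
  have x: "linear_map class_ring (vsp (quot_rep M W) i) (vsp (quot_rep M W) (i + (1,0))) (xact (quot_rep M W) i)" for i
  proof -
    have l: "linear_map class_ring (vsp M i) (vsp (quot_rep M W) (i + (1,0))) (\<lambda>m. W (i + (1,0)) +>\<^bsub>vsp M (i + (1,0))\<^esub> xact M i m)"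
      by (rule linear_map_comp[OF d(3) lin_surj_linear_map[OF d(1) quot_rep_surj[OF M W]]])
    note l = l[unfolded linear_map_iff]
    show ?thesis unfolding linear_map_iff using l
      by (auto simp: V q s(2,3)[symmetric] vs_add[OF d(1)] vs_smult[OF d(1)] dest!: im)
  qed
  have y: "linear_map class_ring (vsp (quot_rep M W) i) (vsp (quot_rep M W) (i + (0,1))) (yact (quot_rep M W) i)" for i
  proof -
    have l: "linear_map class_ring (vsp M i) (vsp (quot_rep M W) (i + (0,1))) (\<lambda>m. W (i + (0,1)) +>\<^bsub>vsp M (i + (0,1))\<^esub> yact M i m)"
      by (rule linear_map_comp[OF d(4) lin_surj_linear_map[OF d(1) quot_rep_surj[OF M W]]])
    note l = l[unfolded linear_map_iff]
    show ?thesis unfolding linear_map_iff using l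
      by (auto simp: V q s(2,3)[symmetric] vs_add[OF d(1)] vs_smult[OF d(1)] dest!: im)
  qed
  have xy: "yact (quot_rep M W) (i + (1,0)) (xact (quot_rep M W) i X) =
      xact (quot_rep M W) (i + (0,1)) (yact (quot_rep M W) i X)"
    if X: "X \<in> carrier (vsp (quot_rep M W) i)" for i X
  proof -
    obtain m where m: "m \<in> carrier (vsp M i)" "X = W i +>\<^bsub>vsp M i\<^esub> m" using im[OF X] by blast
    show ?thesis unfolding m(2) q[OF m(1)] q[OF d(5)[OF m(1)]] q[OF d(6)[OF m(1)]] d(7)[OF m(1)]
      by (simp add: add.assoc)
  qed
  show ?thesis unfolding is_rep_def using V F x y xy by blast
qed

lemma quot_rep_hom:
  fixes M :: "('k::field, 'a) rep"
  assumes M: "is_rep M" and W: "subrep M W"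
  shows "rep_hom M (quot_rep M W) (\<lambda>i m. W i +>\<^bsub>vsp M i\<^esub> m)"
  unfolding rep_hom_def
  using lin_surj_linear_map[OF is_repD(1)[OF M] quot_rep_surj[OF M W]] quot_rep_act[OF M W] by simp

lemma rep_bij_sub:
  fixes M :: "('k::field, 'a) rep"
  assumes b: "rep_bij M N \<phi>" and W: "\<And>i. W i \<subseteq> carrier (vsp M i)"
    and im: "\<And>i. \<phi> i ` W i = W' i"
  shows "rep_bij (sub_rep M W) (sub_rep N W') \<phi>"
proof -
  note e = rep_bijD[OF b]
  have "lin_iso ((vsp M i)\<lparr>carrier := W i\<rparr>) ((vsp N i)\<lparr>carrier := W' i\<rparr>) (\<phi> i)" for i
    using lin_surjD(2-4)[OF e(2)[of i]] im[of i] subsetD[OF W[of i]] inj_on_subset[OF e(7)[of i] W[of i]]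
    unfolding lin_iso_def lin_surj_def by simp
  then show ?thesis unfolding rep_bij_def sub_rep_def using e(3,4) W by (auto simp: subset_iff)
qed

lemma subrep_image:
  fixes M :: "('k::field, 'a) rep"
  assumes M: "is_rep M" and b: "rep_bij M N \<phi>" and W: "subrep M W"
  shows "subrep N (\<lambda>i. \<phi> i ` W i)"
proof -
  note e = rep_bijD[OF b] and w = subrepD[OF W]
  have N: "is_rep N" by (rule rep_bij_is_rep[OF M b])
  have "submodule class_ring (\<phi> i ` W i) (vsp N i)" for i
    using submodule_image[OF linear_map_restrict[OF lin_surj_linear_map[OF is_repD(1)[OF M] e(2)] w(1)]] by simp
  moreover have "xact N i n \<in> \<phi> (i + (1,0)) ` W (i + (1,0))" "yact N i n \<in> \<phi> (i + (0,1)) ` W (i + (0,1))"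
    if n: "n \<in> \<phi> i ` W i" for i n
  proof -
    obtain m where m: "m \<in> W i" "n = \<phi> i m" using n by blast
    have c: "m \<in> carrier (vsp M i)" using m(1) w(4) by blast
    show "xact N i n \<in> \<phi> (i + (1,0)) ` W (i + (1,0))" "yact N i n \<in> \<phi> (i + (0,1)) ` W (i + (0,1))"
      unfolding m(2) e(3)[OF c, symmetric] e(4)[OF c, symmetric] using w(2,3)[OF m(1)] by blast+
  qed
  ultimately show ?thesis unfolding subrep_def by blast
qed

lemma rep_bij_quot:
  fixes M :: "('k::field, 'a) rep"
  assumes M: "is_rep M" and b: "rep_bij M N \<phi>" and W: "subrep M W"
    and im: "\<And>i. \<phi> i ` W i = W' i"
  shows "rep_bij (quot_rep M W) (quot_rep N W') (\<lambda>i X. \<phi> i ` X)"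
proof -
  note e = rep_bijD[OF b] and w = subrepD[OF W] and d = is_repD[OF M]
  have N: "is_rep N" by (rule rep_bij_is_rep[OF M b])
  have W': "subrep N W'" using subrep_image[OF M b W] unfolding im .
  have c: "\<phi> i ` (W i +>\<^bsub>vsp M i\<^esub> m) = W' i +>\<^bsub>vsp N i\<^esub> \<phi> i m" if "m \<in> carrier (vsp M i)" for i m
    unfolding im[symmetric] using that lin_surjD(2)[OF e(2)] w(4) by (intro coset_image)
  have "lin_iso (quot_space (vsp M i) (W i)) (vsp (quot_rep N W') i) (\<lambda>X. \<phi> i ` X)" for i
  proof (rule lin_iso_quot[OF d(1) w(1) lin_surj_comp[OF e(2) quot_rep_surj[OF N W']] c])
    fix m assume m: "m \<in> carrier (vsp M i)" and z: "W' i +>\<^bsub>vsp N i\<^esub> \<phi> i m = \<zero>\<^bsub>vsp (quot_rep N W') i\<^esub>"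
    then have "\<phi> i m \<in> W' i"
      using coset_eq_self_iff[OF is_repD(1)[OF N] subrepD(1)[OF W'] e(5)[OF m]]
      by (simp add: quot_rep_def quot_space_def)
    then show "m \<in> W i" unfolding im[symmetric] using e(7) m w(4) by (meson inj_on_image_mem_iff)
  qed
  then have "lin_iso (vsp (quot_rep M W) i) (vsp (quot_rep N W') i) (\<lambda>X. \<phi> i ` X)" for i
    by (simp add: quot_rep_def)
  moreover have "\<phi> (i + (1,0)) ` xact (quot_rep M W) i X = xact (quot_rep N W') i (\<phi> i ` X)"
    "\<phi> (i + (0,1)) ` yact (quot_rep M W) i X = yact (quot_rep N W') i (\<phi> i ` X)"
    if X: "X \<in> carrier (vsp (quot_rep M W) i)" for i X
  proof -
    obtain m where m: "m \<in> carrier (vsp M i)" "X = W i +>\<^bsub>vsp M i\<^esub> m"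
      using quot_rep_elem[OF M W X] .
    show "\<phi> (i + (1,0)) ` xact (quot_rep M W) i X = xact (quot_rep N W') i (\<phi> i ` X)"
      "\<phi> (i + (0,1)) ` yact (quot_rep M W) i X = yact (quot_rep N W') i (\<phi> i ` X)"
      unfolding m(2)
      by (simp_all add: quot_rep_act[OF M W m(1)] c m(1) quot_rep_act[OF N W'] e(3-5) d(5,6))
  qed
  ultimately show ?thesis unfolding rep_bij_def by blast
qed

text \<open>Grid points stay atomic, because the rules below match on shifts such as
  \<open>i + (1,0)\<close>.\<close>

declare split_paired_All [simp del] split_paired_Ex [simp del]

section \<open>The boundary is an object of Bnds and is functorial\<close>

lemma shift:
  "(i :: int \<times> int) + (1,0) + (0,1) = i + (1,1)" "(i :: int \<times> int) + (0,1) + (1,0) = i + (1,1)"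
  "(i :: int \<times> int) + (1,1) - (1,0) = i + (0,1)" "(i :: int \<times> int) + (1,1) - (0,1) = i + (1,0)"
  by (cases i; simp)+

text \<open>The image spaces are indexed by their target, through \<open>i - (1,0)\<close> and the
  like; writing \<open>i\<close> as a shift of the source removes the subtraction.\<close>

lemma shift_cases:
  fixes i :: "int \<times> int"
  obtains j where "i = j + k"
  by (metis diff_add_cancel)

section \<open>Kernels and images of x, y and xy as subrepresentations\<close>

definition kerx where "kerx M i = {m \<in> carrier (vsp M i). xact M i m = \<zero>\<^bsub>vsp M (i + (1,0))\<^esub>}"
definition kery where "kery M i = {m \<in> carrier (vsp M i). yact M i m = \<zero>\<^bsub>vsp M (i + (0,1))\<^esub>}"
definition kerxy where
  "kerxy M i = {m \<in> carrier (vsp M i). xact M (i + (0,1)) (yact M i m) = \<zero>\<^bsub>vsp M (i + (1,1))\<^esub>}"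

lemma K_eq: "Kx M = sub_rep M (kerx M)" "Ky M = sub_rep M (kery M)" "Kxy M = sub_rep M (kerxy M)"
  by (simp_all add: Kx_def Ky_def Kxy_def kerx_def[abs_def] kery_def[abs_def] kerxy_def[abs_def])

lemma K_carrier: "carrier (vsp (Kx M) i) = kerx M i" "carrier (vsp (Ky M) i) = kery M i"
  by (simp_all add: K_eq sub_rep_def)

lemma im_shift:
  "im_x M (j + (1,0)) = xact M j ` carrier (vsp M j)"
  "im_y M (j + (0,1)) = yact M j ` carrier (vsp M j)"
  "im_xy M (j + (1,1)) = (\<lambda>m. xact M (j + (0,1)) (yact M j m)) ` carrier (vsp M j)"
  by (simp_all add: im_x_def im_y_def im_xy_def shift)

context
  fixes M :: "('k::field, 'a) rep"
  assumes M: "is_rep M"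
begin

lemma act_zero:
  "xact M i \<zero>\<^bsub>vsp M i\<^esub> = \<zero>\<^bsub>vsp M (i + (1,0))\<^esub>" "yact M i \<zero>\<^bsub>vsp M i\<^esub> = \<zero>\<^bsub>vsp M (i + (0,1))\<^esub>"
  using linear_map_zero is_repD(3,4)[OF M] by blast+

lemma subrep_im_x: "subrep M (im_x M)"
proof -
  note d = is_repD[OF M]
  have "submodule class_ring (im_x M i) (vsp M i)" for i
  proof -
    obtain j where j: "i = j + (1,0)" by (rule shift_cases)
    show ?thesis unfolding j im_shift by (rule submodule_image[OF d(3)])
  qed
  moreover have "xact M i m \<in> im_x M (i + (1,0))" "yact M i m \<in> im_x M (i + (0,1))" if m: "m \<in> im_x M i" for i m
  proof -
    obtain j where j: "i = j + (1,0)" by (rule shift_cases)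
    obtain n where n: "n \<in> carrier (vsp M j)" "m = xact M j n" using m unfolding j im_shift by blast
    show "xact M i m \<in> im_x M (i + (1,0))" unfolding im_shift n j using d(5)[OF n(1)] by blast
    have e: "j + (1,0) + (0,1) = j + (0,1) + (1,0)" by (simp only: shift)
    show "yact M i m \<in> im_x M (i + (0,1))" unfolding n j e d(7)[OF n(1)] im_shift using d(6)[OF n(1)] by blast
  qed
  ultimately show ?thesis unfolding subrep_def by blast
qed

lemma subrep_im_y: "subrep M (im_y M)"
proof -
  note d = is_repD[OF M]
  have "submodule class_ring (im_y M i) (vsp M i)" for i
  proof -
    obtain j where j: "i = j + (0,1)" by (rule shift_cases)
    show ?thesis unfolding j im_shift by (rule submodule_image[OF d(4)])
  qed
  moreover have "xact M i m \<in> im_y M (i + (1,0))" "yact M i m \<in> im_y M (i + (0,1))" if m: "m \<in> im_y M i" for i m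
  proof -
    obtain j where j: "i = j + (0,1)" by (rule shift_cases)
    obtain n where n: "n \<in> carrier (vsp M j)" "m = yact M j n" using m unfolding j im_shift by blast
    show "yact M i m \<in> im_y M (i + (0,1))" unfolding im_shift n j using d(6)[OF n(1)] by blast
    have e: "j + (0,1) + (1,0) = j + (1,0) + (0,1)" by (simp only: shift)
    show "xact M i m \<in> im_y M (i + (1,0))"
      unfolding n j e d(7)[OF n(1), symmetric] im_shift using d(5)[OF n(1)] by blast
  qed
  ultimately show ?thesis unfolding subrep_def by blast
qed

lemma subrep_im_xy: "subrep M (im_xy M)"
proof -
  note d = is_repD[OF M]
  have "submodule class_ring (im_xy M i) (vsp M i)" for i
  proof -
    obtain j where j: "i = j + (1,1)" by (rule shift_cases)
    show ?thesis unfolding j im_shift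
      using submodule_image[OF linear_map_comp[OF d(4)[of j] d(3)]] by (simp add: shift)
  qed
  moreover have "xact M i m \<in> im_xy M (i + (1,0))" "yact M i m \<in> im_xy M (i + (0,1))" if m: "m \<in> im_xy M i" for i m
  proof -
    obtain j where j: "i = j + (1,1)" by (rule shift_cases)
    obtain n where n: "n \<in> carrier (vsp M j)" "m = xact M (j + (0,1)) (yact M j n)"
      using m unfolding j im_shift by blast
    have e: "j + (1,1) + (1,0) = j + (1,0) + (1,1)" by (cases j) simp
    show "xact M i m \<in> im_xy M (i + (1,0))"
      unfolding n j e d(7)[OF n(1), symmetric] im_shift shift using d(5)[OF n(1)] by blast
    have e: "j + (1,1) + (0,1) = j + (0,1) + (1,1)" by (cases j) simp
    show "yact M i m \<in> im_xy M (i + (0,1))"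
      unfolding n j e im_shift using d(6)[OF n(1)] d(7)[OF d(6)[OF n(1)], unfolded shift] by blast
  qed
  ultimately show ?thesis unfolding subrep_def by blast
qed

lemma subrep_kerx: "subrep M (kerx M)"
proof -
  note d = is_repD[OF M]
  have "submodule class_ring (kerx M i) (vsp M i)" for i
    unfolding kerx_def by (rule submodule_kernel[OF d(3)])
  moreover have "xact M i m \<in> kerx M (i + (1,0))" "yact M i m \<in> kerx M (i + (0,1))" if "m \<in> kerx M i" for i m
    using that d(5,6) d(7)[of m i, symmetric] act_zero(1)[of "i + (1,0)"] act_zero(2)[of "i + (1,0)"]
    by (simp_all add: kerx_def shift vs_zero[OF d(1)])
  ultimately show ?thesis unfolding subrep_def by blast
qed

lemma subrep_kery: "subrep M (kery M)"
proof -
  note d = is_repD[OF M]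
  have "submodule class_ring (kery M i) (vsp M i)" for i
    unfolding kery_def by (rule submodule_kernel[OF d(4)])
  moreover have "xact M i m \<in> kery M (i + (1,0))" "yact M i m \<in> kery M (i + (0,1))" if "m \<in> kery M i" for i m
    using that d(5,6) d(7)[of m i] act_zero(1)[of "i + (0,1)"] act_zero(2)[of "i + (0,1)"]
    by (simp_all add: kery_def shift vs_zero[OF d(1)])
  ultimately show ?thesis unfolding subrep_def by blast
qed

lemma subrep_kerxy: "subrep M (kerxy M)"
proof -
  note d = is_repD[OF M]
  have "submodule class_ring (kerxy M i) (vsp M i)" for i
    using submodule_kernel[OF linear_map_comp[OF d(4)[of i] d(3)]] by (simp add: kerxy_def shift)
  moreover have "xact M i m \<in> kerxy M (i + (1,0))" if m: "m \<in> kerxy M i" for i m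
  proof -
    have c: "m \<in> carrier (vsp M i)" and z: "xact M (i + (0,1)) (yact M i m) = \<zero>\<^bsub>vsp M (i + (1,1))\<^esub>"
      using m by (auto simp: kerxy_def)
    have e: "i + (1,1) + (1,0) = i + (1,0) + (1,1)" by (cases i) simp
    show ?thesis using d(5)[OF c] d(7)[OF c] act_zero(1)[of "i + (1,1)", unfolded e] z
      by (simp add: kerxy_def shift)
  qed
  moreover have "yact M i m \<in> kerxy M (i + (0,1))" if m: "m \<in> kerxy M i" for i m
  proof -
    have c: "m \<in> carrier (vsp M i)" and z: "xact M (i + (0,1)) (yact M i m) = \<zero>\<^bsub>vsp M (i + (1,1))\<^esub>"
      using m by (auto simp: kerxy_def)
    have e: "i + (1,1) + (0,1) = i + (0,1) + (1,1)" by (cases i) simp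
    show ?thesis using d(6)[OF c] d(7)[OF d(6)[OF c]] act_zero(2)[of "i + (1,1)", unfolded e] z
      by (simp add: kerxy_def shift)
  qed
  ultimately show ?thesis unfolding subrep_def by blast
qed

lemma Cxy_is_rep: "is_rep (Cxy M)"
  unfolding Cxy_def by (rule quot_rep_is_rep[OF M subrep_im_xy])

lemma Kxy_is_rep: "is_rep (Kxy M)"
  unfolding K_eq by (rule sub_rep_is_rep[OF M subrep_kerxy])

lemma Kx_is_rep: "is_rep (Kx M)"
  unfolding K_eq by (rule sub_rep_is_rep[OF M subrep_kerx])

lemma Ky_is_rep: "is_rep (Ky M)"
  unfolding K_eq by (rule sub_rep_is_rep[OF M subrep_kery])

end

lemma ephemeral_Cxy:
  fixes M :: "('k::field, 'a) rep"
  assumes M: "is_rep M"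
  shows "ephemeral (Cxy M)"
  unfolding ephemeral_def
proof (intro allI ballI)
  fix i X assume "X \<in> carrier (vsp (Cxy M) i)"
  then obtain m where m: "m \<in> carrier (vsp M i)" "X = im_xy M i +>\<^bsub>vsp M i\<^esub> m"
    unfolding Cxy_def by (rule quot_rep_elem[OF M subrep_im_xy[OF M]])
  note d = is_repD[OF M] and q = quot_rep_act[OF M subrep_im_xy[OF M]]
  have "xact (Cxy M) (i + (0,1)) (yact (Cxy M) i X) =
      im_xy M (i + (1,1)) +>\<^bsub>vsp M (i + (1,1))\<^esub> xact M (i + (0,1)) (yact M i m)"
    unfolding Cxy_def m(2) q(2)[OF m(1)] q(1)[OF d(6)[OF m(1)]] shift ..
  also have "\<dots> = im_xy M (i + (1,1))"
  proof -
    have "xact M (i + (0,1)) (yact M i m) \<in> im_xy M (i + (1,1))" unfolding im_shift using m(1) by blast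
    then show ?thesis
      using coset_eq_self_iff[OF d(1) subrepD(1)[OF subrep_im_xy[OF M]]] subrepD(4)[OF subrep_im_xy[OF M]] by blast
  qed
  finally show "xact (Cxy M) (i + (0,1)) (yact (Cxy M) i X) = \<zero>\<^bsub>vsp (Cxy M) (i + (1,1))\<^esub>"
    by (simp add: Cxy_def quot_rep_def quot_space_def)
qed

text \<open>\<open>bndf\<close> is the projection to \<open>Cxy M\<close>, restricted to the kernel,
  followed by the projection to the cokernel of \<open>x\<close>; as a composite of morphisms it is
  a morphism, and \<open>bndg\<close> likewise.\<close>

lemma is_bnd_boundary:
  fixes M :: "('k::field, 'a) rep"
  assumes M: "is_rep M"
  shows "is_bnd (boundary M)"
proof -
  have C: "is_rep (Cxy M)" and K: "is_rep (Kxy M)" using Cxy_is_rep[OF M] Kxy_is_rep[OF M] .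
  have q: "rep_hom (Kxy M) (Cxy M) (\<lambda>i m. im_xy M i +>\<^bsub>vsp M i\<^esub> m)"
    unfolding K_eq Cxy_def
    by (rule sub_rep_hom[OF quot_rep_hom[OF M subrep_im_xy[OF M]] subrep_kerxy[OF M]])
  have f: "rep_hom (Ky (Kxy M)) (Cx (Cxy M)) (bndf (boundary M))"
    using sub_rep_hom[OF rep_hom_comp[OF q quot_rep_hom[OF C subrep_im_x[OF C]]] subrep_kery[OF K]]
    by (simp add: K_eq(2) Cx_def boundary_def)
  have g: "rep_hom (Kx (Kxy M)) (Cy (Cxy M)) (bndg (boundary M))"
    using sub_rep_hom[OF rep_hom_comp[OF q quot_rep_hom[OF C subrep_im_y[OF C]]] subrep_kerx[OF K]]
    by (simp add: K_eq(1) Cy_def boundary_def)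
  have "ephemeral (Kxy M)" by (simp add: ephemeral_def Kxy_def sub_rep_def)
  then show ?thesis unfolding is_bnd_def using C K f g ephemeral_Cxy[OF M] by (simp add: boundary_def)
qed

text \<open>Values of \<open>bndf\<close> and \<open>bndg\<close> are cosets, so that for bijective \<open>\<phi>\<close> the maps on cosets induced by \<open>\<phi>\<close>
  are plain images.\<close>

definition bnd_bij ::
  "('k::field, 'b, 'd) bnd \<Rightarrow> ('k, 'b2, 'd2) bnd \<Rightarrow>
   (int \<times> int \<Rightarrow> 'b \<Rightarrow> 'b2) \<Rightarrow> (int \<times> int \<Rightarrow> 'd \<Rightarrow> 'd2) \<Rightarrow> bool" where
  "bnd_bij P Q \<phi> \<psi> \<longleftrightarrow> rep_bij (bndB P) (bndB Q) \<phi> \<and> rep_bij (bndD P) (bndD Q) \<psi> \<and>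
    (\<forall>i. \<forall>d\<in>kery (bndD P) i. bndf Q i (\<psi> i d) = \<phi> i ` bndf P i d) \<and>
    (\<forall>i. \<forall>d\<in>kerx (bndD P) i. bndg Q i (\<psi> i d) = \<phi> i ` bndg P i d)"

section \<open>Transport of kernels, images and the boundary along an isomorphism\<close>

lemma image_eq_of_iff:
  assumes "\<And>x. x \<in> C \<Longrightarrow> x \<in> A \<longleftrightarrow> f x \<in> B" "A \<subseteq> C" "B \<subseteq> f ` C"
  shows "f ` A = B"
  using assms by blast

lemma rep_bij_kernels:
  fixes M :: "('k::field, 'a) rep"
  assumes M: "is_rep M" and b: "rep_bij M N \<phi>"
  shows "\<phi> i ` kerx M i = kerx N i" "\<phi> i ` kery M i = kery N i" "\<phi> i ` kerxy M i = kerxy N i"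
proof -
  note e = rep_bijD[OF b] and d = is_repD[OF M]
  have z: "\<phi> i m = \<zero>\<^bsub>vsp N i\<^esub> \<longleftrightarrow> m = \<zero>\<^bsub>vsp M i\<^esub>" if "m \<in> carrier (vsp M i)" for i m
    using lin_surjD(4)[OF e(2)[of i]] e(7)[of i] that vs_zero[OF d(1), of i] by (metis inj_on_def)
  have "m \<in> kerx M i \<longleftrightarrow> \<phi> i m \<in> kerx N i" "m \<in> kery M i \<longleftrightarrow> \<phi> i m \<in> kery N i"
    "m \<in> kerxy M i \<longleftrightarrow> \<phi> i m \<in> kerxy N i"
    if m: "m \<in> carrier (vsp M i)" for m
    using m e(5)[OF m] z[OF d(5)[OF m]] z[OF d(6)[OF m]] z[OF d(5)[OF d(6)[OF m]]]
      e(3)[OF d(6)[OF m]] e(3)[OF m] e(4)[OF m]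
    by (simp_all add: kerx_def kery_def kerxy_def shift)
  note iff = this
  show "\<phi> i ` kerx M i = kerx N i"
    by (rule image_eq_of_iff[OF iff(1)]) (auto simp: kerx_def e(6))
  show "\<phi> i ` kery M i = kery N i"
    by (rule image_eq_of_iff[OF iff(2)]) (auto simp: kery_def e(6))
  show "\<phi> i ` kerxy M i = kerxy N i"
    by (rule image_eq_of_iff[OF iff(3)]) (auto simp: kerxy_def e(6))
qed

lemma rep_bij_images:
  fixes M :: "('k::field, 'a) rep"
  assumes M: "is_rep M" and b: "rep_bij M N \<phi>"
  shows "\<phi> i ` im_x M i = im_x N i" "\<phi> i ` im_y M i = im_y N i" "\<phi> i ` im_xy M i = im_xy N i"
proof -
  note e = rep_bijD[OF b] and d = is_repD[OF M]
  show "\<phi> i ` im_x M i = im_x N i"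
  proof -
    obtain j where j: "i = j + (1,0)" by (rule shift_cases)
    show ?thesis unfolding j im_shift e(6)[symmetric] image_image by (rule image_cong) (simp_all add: e(3))
  qed
  show "\<phi> i ` im_y M i = im_y N i"
  proof -
    obtain j where j: "i = j + (0,1)" by (rule shift_cases)
    show ?thesis unfolding j im_shift e(6)[symmetric] image_image by (rule image_cong) (simp_all add: e(4))
  qed
  show "\<phi> i ` im_xy M i = im_xy N i"
  proof -
    obtain j where j: "i = j + (1,1)" by (rule shift_cases)
    show ?thesis unfolding j im_shift e(6)[symmetric] image_image
      using e(3)[OF d(6), of _ j] by (intro image_cong) (simp_all add: e(4) shift)
  qed
qed

context
  fixes M :: "('k::field, 'a) rep" and N :: "('k, 'b) rep" and \<phi>
  assumes M: "is_rep M" and b: "rep_bij M N \<phi>"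
begin

lemma rep_bij_Kx: "rep_bij (Kx M) (Kx N) \<phi>"
  unfolding K_eq by (rule rep_bij_sub[OF b subrepD(4)[OF subrep_kerx[OF M]] rep_bij_kernels(1)[OF M b]])

lemma rep_bij_Ky: "rep_bij (Ky M) (Ky N) \<phi>"
  unfolding K_eq by (rule rep_bij_sub[OF b subrepD(4)[OF subrep_kery[OF M]] rep_bij_kernels(2)[OF M b]])

lemma rep_bij_Kxy: "rep_bij (Kxy M) (Kxy N) \<phi>"
  unfolding K_eq by (rule rep_bij_sub[OF b subrepD(4)[OF subrep_kerxy[OF M]] rep_bij_kernels(3)[OF M b]])

lemma rep_bij_Cx: "rep_bij (Cx M) (Cx N) (\<lambda>i X. \<phi> i ` X)"
  unfolding Cx_def by (rule rep_bij_quot[OF M b subrep_im_x[OF M] rep_bij_images(1)[OF M b]])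

lemma rep_bij_Cy: "rep_bij (Cy M) (Cy N) (\<lambda>i X. \<phi> i ` X)"
  unfolding Cy_def by (rule rep_bij_quot[OF M b subrep_im_y[OF M] rep_bij_images(2)[OF M b]])

lemma rep_bij_Cxy: "rep_bij (Cxy M) (Cxy N) (\<lambda>i X. \<phi> i ` X)"
  unfolding Cxy_def by (rule rep_bij_quot[OF M b subrep_im_xy[OF M] rep_bij_images(3)[OF M b]])

lemma rep_bij_coset:
  assumes "W \<subseteq> carrier (vsp M i)" "m \<in> carrier (vsp M i)"
  shows "\<phi> i ` (W +>\<^bsub>vsp M i\<^esub> m) = (\<phi> i ` W) +>\<^bsub>vsp N i\<^esub> \<phi> i m"
  using lin_surjD(2)[OF rep_bijD(2)[OF b]] assms by (intro coset_image)

lemma rep_bij_coset_map: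
  assumes W: "subrep M W" and im: "\<And>i. \<phi> i ` W i = W' i"
    and X: "X \<in> carrier (vsp (quot_rep M W) i)"
  shows "coset_map (vsp N i) (W' i) (\<phi> i) X = \<phi> i ` X"
proof -
  note e = rep_bijD[OF b] and w = subrepD[OF W]
  obtain m where m: "m \<in> carrier (vsp M i)" "X = W i +>\<^bsub>vsp M i\<^esub> m" using quot_rep_elem[OF M W X] .
  have N: "is_rep N" by (rule rep_bij_is_rep[OF M b])
  have "coset_map (vsp N i) (W' i) (\<phi> i) X = W' i +>\<^bsub>vsp N i\<^esub> \<phi> i m"
    unfolding m(2) using lin_surjD(2)[OF e(2)] e(5) im[of i] subrepD(1)[OF subrep_image[OF M b W], of i] m(1)
    by (intro coset_map_coset is_repD(1)[OF M] w(1) is_repD(1)[OF N]) auto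
  then show ?thesis unfolding m(2) using rep_bij_coset[OF w(4) m(1)] im[of i] by simp
qed

end

lemma boundary_bij:
  fixes M :: "('k::field, 'a) rep" and N :: "('k, 'b) rep"
  assumes M: "is_rep M" and b: "rep_bij M N \<phi>"
  shows "bnd_bij (boundary M) (boundary N) (\<lambda>i X. \<phi> i ` X) \<phi>"
proof -
  have C: "is_rep (Cxy M)" by (rule Cxy_is_rep[OF M])
  note c = rep_bij_Cxy[OF M b] and k = rep_bij_Kxy[OF M b]
  note w = subrepD(4)[OF subrep_im_xy[OF M]]
  have m: "m \<in> carrier (vsp M i)" if "m \<in> carrier (vsp (Kxy M) i)" for m i
    using that by (simp add: Kxy_def sub_rep_def)
  have e: "\<phi> i ` (im_xy M i +>\<^bsub>vsp M i\<^esub> m) = im_xy N i +>\<^bsub>vsp N i\<^esub> \<phi> i m"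
    if "m \<in> carrier (vsp (Kxy M) i)" for m i
    using rep_bij_coset[OF M b w m[OF that]] rep_bij_images(3)[OF M b] by simp
  have z: "im_xy M i +>\<^bsub>vsp M i\<^esub> m \<in> carrier (vsp (Cxy M) i)" if "m \<in> carrier (vsp (Kxy M) i)" for m i
    using lin_surjD(5)[OF quot_rep_surj[OF M subrep_im_xy[OF M]] m[OF that]] by (simp add: Cxy_def)
  have "bndf (boundary N) i (\<phi> i d) = (\<lambda>X. \<phi> i ` X) ` bndf (boundary M) i d"
    if "d \<in> kery (Kxy M) i" for i d
  proof -
    have d: "d \<in> carrier (vsp (Kxy M) i)" using that by (simp add: kery_def)
    show ?thesis unfolding boundary_def bnd.simps
      using rep_bij_coset[OF C c subrepD(4)[OF subrep_im_x[OF C]] z[OF d]] e[OF d]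
        rep_bij_images(1)[OF C c] by simp
  qed
  moreover have "bndg (boundary N) i (\<phi> i d) = (\<lambda>X. \<phi> i ` X) ` bndg (boundary M) i d"
    if "d \<in> kerx (Kxy M) i" for i d
  proof -
    have d: "d \<in> carrier (vsp (Kxy M) i)" using that by (simp add: kerx_def)
    show ?thesis unfolding boundary_def bnd.simps
      using rep_bij_coset[OF C c subrepD(4)[OF subrep_im_y[OF C]] z[OF d]] e[OF d]
        rep_bij_images(2)[OF C c] by simp
  qed
  ultimately show ?thesis unfolding bnd_bij_def using c k by (simp add: boundary_def)
qed

section \<open>Isomorphisms in Bnds\<close>

lemma is_bndD:
  assumes "is_bnd P"
  shows "is_rep (bndB P)" "is_rep (bndD P)" "rep_hom (Ky (bndD P)) (Cx (bndB P)) (bndf P)"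
    "rep_hom (Kx (bndD P)) (Cy (bndB P)) (bndg P)" "ephemeral (bndB P)" "ephemeral (bndD P)"
    "d \<in> kery (bndD P) i \<Longrightarrow> bndf P i d \<in> carrier (vsp (Cx (bndB P)) i)"
    "d \<in> kerx (bndD P) i \<Longrightarrow> bndg P i d \<in> carrier (vsp (Cy (bndB P)) i)"
proof -
  show "is_rep (bndB P)" "is_rep (bndD P)" "ephemeral (bndB P)" "ephemeral (bndD P)"
    and f: "rep_hom (Ky (bndD P)) (Cx (bndB P)) (bndf P)"
    and g: "rep_hom (Kx (bndD P)) (Cy (bndB P)) (bndg P)"
    using assms unfolding is_bnd_def by blast+
  show "d \<in> kery (bndD P) i \<Longrightarrow> bndf P i d \<in> carrier (vsp (Cx (bndB P)) i)"
    using rep_homD(4)[OF f] by (simp add: K_carrier)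
  show "d \<in> kerx (bndD P) i \<Longrightarrow> bndg P i d \<in> carrier (vsp (Cy (bndB P)) i)"
    using rep_homD(4)[OF g] by (simp add: K_carrier)
qed

lemma bnd_values_subset:
  assumes P: "is_bnd P"
  shows "d \<in> kery (bndD P) i \<Longrightarrow> bndf P i d \<subseteq> carrier (vsp (bndB P) i)"
    "d \<in> kerx (bndD P) i \<Longrightarrow> bndg P i d \<subseteq> carrier (vsp (bndB P) i)"
proof -
  note p = is_bndD[OF P]
  assume "d \<in> kery (bndD P) i"
  then have "bndf P i d \<in> carrier (vsp (quot_rep (bndB P) (im_x (bndB P))) i)"
    using p(7) unfolding Cx_def by blast
  then obtain b where "b \<in> carrier (vsp (bndB P) i)" "bndf P i d = im_x (bndB P) i +>\<^bsub>vsp (bndB P) i\<^esub> b"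
    using quot_rep_elem[OF p(1) subrep_im_x[OF p(1)]] by blast
  then show "bndf P i d \<subseteq> carrier (vsp (bndB P) i)"
    using coset_subset[OF is_repD(1)[OF p(1)] subrepD(1)[OF subrep_im_x[OF p(1)]]] by simp
next
  note p = is_bndD[OF P]
  assume "d \<in> kerx (bndD P) i"
  then have "bndg P i d \<in> carrier (vsp (quot_rep (bndB P) (im_y (bndB P))) i)"
    using p(8) unfolding Cy_def by blast
  then obtain b where "b \<in> carrier (vsp (bndB P) i)" "bndg P i d = im_y (bndB P) i +>\<^bsub>vsp (bndB P) i\<^esub> b"
    using quot_rep_elem[OF p(1) subrep_im_y[OF p(1)]] by blast
  then show "bndg P i d \<subseteq> carrier (vsp (bndB P) i)"
    using coset_subset[OF is_repD(1)[OF p(1)] subrepD(1)[OF subrep_im_y[OF p(1)]]] by simp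
qed

text \<open>A commuting square with bijective sides \<open>\<alpha>\<close> and
  \<open>\<alpha>'\<close> carries the morphism property from \<open>h\<close> to \<open>h'\<close>,
  since every element of \<open>C\<close> is a value of \<open>\<alpha>\<close>.\<close>

lemma rep_hom_transport:
  fixes A :: "('k::field, 'a) rep" and A' :: "('k, 'b) rep" and C :: "('k, 'c) rep" and C' :: "('k, 'd) rep"
  assumes A: "is_rep A" and h: "rep_hom A A' h" and a: "rep_bij A C \<alpha>" and a': "rep_bij A' C' \<alpha>'"
    and c: "\<And>i x. x \<in> carrier (vsp A i) \<Longrightarrow> h' i (\<alpha> i x) = \<alpha>' i (h i x)"
  shows "rep_hom C C' h'"
proof -
  note d = is_repD[OF A] and e = rep_bijD[OF a] and e' = rep_bijD[OF a'] and hh = rep_homD[OF h]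
  have "linear_map class_ring (vsp C i) (vsp C' i) (h' i)" for i
    by (rule rep_bij_act_linear[OF hh(1) e(1) e'(2)]) (simp add: c)
  moreover have "h' (i + (1,0)) (xact C i z) = xact C' i (h' i z)"
    "h' (i + (0,1)) (yact C i z) = yact C' i (h' i z)" if z: "z \<in> carrier (vsp C i)" for i z
  proof -
    obtain x where x: "x \<in> carrier (vsp A i)" "z = \<alpha> i x" using z e(6) by blast
    show "h' (i + (1,0)) (xact C i z) = xact C' i (h' i z)"
      unfolding x(2) e(3)[OF x(1), symmetric] c[OF d(5)[OF x(1)]] c[OF x(1)] hh(2)[OF x(1)]
        e'(3)[OF hh(4)[OF x(1)]] ..
    show "h' (i + (0,1)) (yact C i z) = yact C' i (h' i z)"
      unfolding x(2) e(4)[OF x(1), symmetric] c[OF d(6)[OF x(1)]] c[OF x(1)] hh(3)[OF x(1)]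
        e'(4)[OF hh(4)[OF x(1)]] ..
  qed
  ultimately show ?thesis unfolding rep_hom_def by blast
qed

lemma ephemeral_bij:
  fixes M :: "('k::field, 'a) rep"
  assumes M: "is_rep M" and b: "rep_bij M N \<phi>" and "ephemeral M"
  shows "ephemeral N"
  unfolding ephemeral_def
proof (intro allI ballI)
  fix i n assume "n \<in> carrier (vsp N i)"
  then obtain m where m: "m \<in> carrier (vsp M i)" "n = \<phi> i m" using rep_bijD(6)[OF b] by blast
  have "m \<in> kerxy M i" using assms(3) m(1) by (simp add: ephemeral_def kerxy_def)
  then have "n \<in> kerxy N i" using rep_bij_kernels(3)[OF M b] m(2) by blast
  then show "xact N (i + (0,1)) (yact N i n) = \<zero>\<^bsub>vsp N (i + (1,1))\<^esub>" by (simp add: kerxy_def)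
qed

text \<open>Makes a sum such as \<open>bnd_sum\<close> an object of Bnds as soon as it is the target
  of a bijection from one: both structure maps are transported along the induced maps of kernels and
  cokernels.\<close>

lemma bnd_bij_is_bnd:
  fixes P :: "('k::field, 'b, 'd) bnd" and Q :: "('k, 'b2, 'd2) bnd"
  assumes P: "is_bnd P" and b: "bnd_bij P Q \<phi> \<psi>"
  shows "is_bnd Q"
proof -
  note p = is_bndD[OF P]
  have B: "rep_bij (bndB P) (bndB Q) \<phi>" and D: "rep_bij (bndD P) (bndD Q) \<psi>"
    using b unfolding bnd_bij_def by blast+
  have "rep_hom (Ky (bndD Q)) (Cx (bndB Q)) (bndf Q)"
    using b by (intro rep_hom_transport[OF Ky_is_rep[OF p(2)] p(3) rep_bij_Ky[OF p(2) D] rep_bij_Cx[OF p(1) B]])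
      (simp add: bnd_bij_def K_carrier)
  moreover have "rep_hom (Kx (bndD Q)) (Cy (bndB Q)) (bndg Q)"
    using b by (intro rep_hom_transport[OF Kx_is_rep[OF p(2)] p(4) rep_bij_Kx[OF p(2) D] rep_bij_Cy[OF p(1) B]])
      (simp add: bnd_bij_def K_carrier)
  ultimately show ?thesis unfolding is_bnd_def
    using rep_bij_is_rep[OF p(1) B] rep_bij_is_rep[OF p(2) D] ephemeral_bij[OF p(1) B p(5)]
      ephemeral_bij[OF p(2) D p(6)] by blast
qed

lemma bnd_bij_comp:
  fixes P :: "('k::field, 'b, 'd) bnd" and Q :: "('k, 'b2, 'd2) bnd" and R :: "('k, 'b3, 'd3) bnd"
  assumes P: "is_bnd P" and b: "bnd_bij P Q \<phi> \<psi>" and c: "bnd_bij Q R \<phi>' \<psi>'"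
  shows "bnd_bij P R (\<lambda>i x. \<phi>' i (\<phi> i x)) (\<lambda>i x. \<psi>' i (\<psi> i x))"
proof -
  have D: "rep_bij (bndD P) (bndD Q) \<psi>" using b unfolding bnd_bij_def by blast
  have "\<psi> i d \<in> kery (bndD Q) i" if "d \<in> kery (bndD P) i" for d i
    using rep_bij_kernels(2)[OF is_bndD(2)[OF P] D] that by blast
  moreover have "\<psi> i d \<in> kerx (bndD Q) i" if "d \<in> kerx (bndD P) i" for d i
    using rep_bij_kernels(1)[OF is_bndD(2)[OF P] D] that by blast
  ultimately show ?thesis using b c unfolding bnd_bij_def
    by (simp add: rep_bij_comp[of "bndB P" "bndB Q" \<phi> "bndB R" \<phi>'] rep_bij_comp[of "bndD P" "bndD Q" \<psi> "bndD R" \<psi>'] image_image)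
qed

lemma bnd_bij_inv:
  fixes P :: "('k::field, 'b, 'd) bnd" and Q :: "('k, 'b2, 'd2) bnd"
  assumes P: "is_bnd P" and b: "bnd_bij P Q \<phi> \<psi>"
  shows "bnd_bij Q P (rep_inv (bndB P) \<phi>) (rep_inv (bndD P) \<psi>)"
proof -
  note p = is_bndD[OF P] and s = bnd_values_subset[OF P]
  have B: "rep_bij (bndB P) (bndB Q) \<phi>" and D: "rep_bij (bndD P) (bndD Q) \<psi>"
    using b unfolding bnd_bij_def by blast+
  have im: "rep_inv (bndB P) \<phi> i ` \<phi> i ` X = X" if "X \<subseteq> carrier (vsp (bndB P) i)" for X i
  proof -
    have "\<And>x. x \<in> X \<Longrightarrow> rep_inv (bndB P) \<phi> i (\<phi> i x) = x" using that rep_inv_inverse(1)[OF B] by blast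
    then show ?thesis by (simp add: image_image)
  qed
  have "bndf P i (rep_inv (bndD P) \<psi> i d) = rep_inv (bndB P) \<phi> i ` bndf Q i d" if "d \<in> kery (bndD Q) i" for i d
  proof -
    have "d \<in> \<psi> i ` kery (bndD P) i" using that by (simp add: rep_bij_kernels(2)[OF p(2) D])
    then obtain c where c: "c \<in> kery (bndD P) i" "d = \<psi> i c" by blast
    have "c \<in> carrier (vsp (bndD P) i)" using c(1) by (simp add: kery_def)
    then have "rep_inv (bndD P) \<psi> i d = c" unfolding c(2) by (rule rep_inv_inverse(1)[OF D])
    moreover have "bndf Q i d = \<phi> i ` bndf P i c" using b c unfolding bnd_bij_def by blast
    ultimately show ?thesis using im[OF s(1)[OF c(1)]] by simp
  qed
  moreover have "bndg P i (rep_inv (bndD P) \<psi> i d) = rep_inv (bndB P) \<phi> i ` bndg Q i d" if "d \<in> kerx (bndD Q) i" for i d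
  proof -
    have "d \<in> \<psi> i ` kerx (bndD P) i" using that by (simp add: rep_bij_kernels(1)[OF p(2) D])
    then obtain c where c: "c \<in> kerx (bndD P) i" "d = \<psi> i c" by blast
    have "c \<in> carrier (vsp (bndD P) i)" using c(1) by (simp add: kerx_def)
    then have "rep_inv (bndD P) \<psi> i d = c" unfolding c(2) by (rule rep_inv_inverse(1)[OF D])
    moreover have "bndg Q i d = \<phi> i ` bndg P i c" using b c unfolding bnd_bij_def by blast
    ultimately show ?thesis using im[OF s(2)[OF c(1)]] by simp
  qed
  ultimately show ?thesis unfolding bnd_bij_def
    using rep_bij_inv[OF p(1) B] rep_bij_inv[OF p(2) D] by blast
qed

lemma bnd_coset_map:
  fixes P :: "('k::field, 'b, 'd) bnd"
  assumes P: "is_bnd P" and B: "rep_bij (bndB P) B' \<phi>"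
  shows "d \<in> kery (bndD P) i \<Longrightarrow> coset_map (vsp B' i) (im_x B' i) (\<phi> i) (bndf P i d) = \<phi> i ` bndf P i d"
    "d \<in> kerx (bndD P) i \<Longrightarrow> coset_map (vsp B' i) (im_y B' i) (\<phi> i) (bndg P i d) = \<phi> i ` bndg P i d"
proof -
  note p = is_bndD[OF P]
  show "coset_map (vsp B' i) (im_x B' i) (\<phi> i) (bndf P i d) = \<phi> i ` bndf P i d"
    if "d \<in> kery (bndD P) i"
    by (rule rep_bij_coset_map[OF p(1) B subrep_im_x[OF p(1)] rep_bij_images(1)[OF p(1) B]])
      (use p(7)[OF that] in \<open>simp add: Cx_def\<close>)
  show "coset_map (vsp B' i) (im_y B' i) (\<phi> i) (bndg P i d) = \<phi> i ` bndg P i d"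
    if "d \<in> kerx (bndD P) i"
    by (rule rep_bij_coset_map[OF p(1) B subrep_im_y[OF p(1)] rep_bij_images(2)[OF p(1) B]])
      (use p(8)[OF that] in \<open>simp add: Cy_def\<close>)
qed

lemma bnd_bij_hom:
  fixes P :: "('k::field, 'b, 'd) bnd" and Q :: "('k, 'b2, 'd2) bnd"
  assumes P: "is_bnd P" and b: "bnd_bij P Q \<phi> \<psi>"
  shows "bnd_hom P Q \<phi> \<psi>"
proof -
  have B: "rep_bij (bndB P) (bndB Q) \<phi>" and D: "rep_bij (bndD P) (bndD Q) \<psi>"
    using b unfolding bnd_bij_def by blast+
  show ?thesis unfolding bnd_hom_def K_carrier
    using rep_bij_hom[OF is_bndD(1)[OF P] B] rep_bij_hom[OF is_bndD(2)[OF P] D] bnd_coset_map[OF P B] b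
    by (simp add: bnd_bij_def)
qed

lemma bnd_iso_iff:
  fixes P :: "('k::field, 'b, 'd) bnd" and Q :: "('k, 'b2, 'd2) bnd"
  assumes P: "is_bnd P"
  shows "bnd_iso P Q \<longleftrightarrow> (\<exists>\<phi> \<psi>. bnd_bij P Q \<phi> \<psi>)"
proof
  assume "bnd_iso P Q"
  then obtain \<phi> \<psi> \<phi>' \<psi>' where f: "bnd_hom P Q \<phi> \<psi>" and g: "bnd_hom Q P \<phi>' \<psi>'"
    and i: "mutually_inverse (bndB P) (bndB Q) \<phi> \<phi>'" "mutually_inverse (bndD P) (bndD Q) \<psi> \<psi>'"
    unfolding bnd_iso_def by blast
  have B: "rep_bij (bndB P) (bndB Q) \<phi>" and D: "rep_bij (bndD P) (bndD Q) \<psi>"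
    using f g i rep_hom_bij unfolding bnd_hom_def by blast+
  have "bnd_bij P Q \<phi> \<psi>" unfolding bnd_bij_def
    using B D f bnd_coset_map[OF P B] unfolding bnd_hom_def K_carrier by simp
  then show "\<exists>\<phi> \<psi>. bnd_bij P Q \<phi> \<psi>" by blast
next
  assume "\<exists>\<phi> \<psi>. bnd_bij P Q \<phi> \<psi>"
  then obtain \<phi> \<psi> where b: "bnd_bij P Q \<phi> \<psi>" by blast
  have B: "rep_bij (bndB P) (bndB Q) \<phi>" and D: "rep_bij (bndD P) (bndD Q) \<psi>"
    using b unfolding bnd_bij_def by blast+
  have Q: "is_bnd Q" by (rule bnd_bij_is_bnd[OF P b])
  have "mutually_inverse (bndB P) (bndB Q) \<phi> (rep_inv (bndB P) \<phi>)"
    "mutually_inverse (bndD P) (bndD Q) \<psi> (rep_inv (bndD P) \<psi>)"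
    unfolding mutually_inverse_def using rep_inv_inverse[OF B] rep_inv_inverse[OF D] by blast+
  then show "bnd_iso P Q" unfolding bnd_iso_def
    using P Q bnd_bij_hom[OF P b] bnd_bij_hom[OF Q bnd_bij_inv[OF P b]] by blast
qed

section \<open>Direct sums\<close>

lemma rep_sum_simps:
  "finite J \<Longrightarrow> carrier (vsp (rep_sum J F) i) = (\<Pi>\<^sub>E j\<in>J. carrier (vsp (F j) i))"
  "\<zero>\<^bsub>vsp (rep_sum J F) i\<^esub> = (\<lambda>j\<in>J. \<zero>\<^bsub>vsp (F j) i\<^esub>)"
  "h \<oplus>\<^bsub>vsp (rep_sum J F) i\<^esub> h' = (\<lambda>j\<in>J. h j \<oplus>\<^bsub>vsp (F j) i\<^esub> h' j)"
  "c \<odot>\<^bsub>vsp (rep_sum J F) i\<^esub> h = (\<lambda>j\<in>J. c \<odot>\<^bsub>vsp (F j) i\<^esub> h j)"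
  "xact (rep_sum J F) i h = (\<lambda>j\<in>J. xact (F j) i (h j))"
  "yact (rep_sum J F) i h = (\<lambda>j\<in>J. yact (F j) i (h j))"
  by (simp_all add: rep_sum_def)

text \<open>The index map runs against the arrow: the summand \<open>l\<close> of the target is fed
  from the summand \<open>\<tau> l\<close> of the source, so that reindexing and summandwise maps
  are handled together.\<close>

definition sum_map :: "'l set \<Rightarrow> ('l \<Rightarrow> 'j) \<Rightarrow> ('l \<Rightarrow> 'i \<Rightarrow> 'a \<Rightarrow> 'b) \<Rightarrow> 'i \<Rightarrow> ('j \<Rightarrow> 'a) \<Rightarrow> 'l \<Rightarrow> 'b" where
  "sum_map L \<tau> \<phi> i h = (\<lambda>l\<in>L. \<phi> l i (h (\<tau> l)))"

text \<open>Surjectivity of a reindexed product map: preimages are chosen coordinatewise and moved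
  to the index set \<open>J\<close> by the inverse of \<open>\<tau>\<close>. It is applied to the
  carriers as well as to the cosets that are values of \<open>bndf\<close> and
  \<open>bndg\<close>.\<close>

lemma reindexed_PiE:
  assumes t: "bij_betw \<tau> L J" and ne: "\<And>l. l \<in> L \<Longrightarrow> b l \<in> f l ` A (\<tau> l)" and b: "b \<in> extensional L"
  shows "\<exists>a \<in> (\<Pi>\<^sub>E j\<in>J. A j). (\<lambda>l\<in>L. f l (a (\<tau> l))) = b"
proof -
  obtain c where c: "\<And>l. l \<in> L \<Longrightarrow> c l \<in> A (\<tau> l) \<and> f l (c l) = b l"
  proof -
    have "\<forall>l\<in>L. \<exists>a. a \<in> A (\<tau> l) \<and> f l a = b l" using ne by fastforce
    then show ?thesis using that bchoice[of L "\<lambda>l a. a \<in> A (\<tau> l) \<and> f l a = b l"] by blast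
  qed
  define \<sigma> where "\<sigma> = the_inv_into L \<tau>"
  have \<sigma>: "\<sigma> (\<tau> l) = l" if "l \<in> L" for l
    using that t unfolding \<sigma>_def bij_betw_def by (simp add: the_inv_into_f_f)
  have \<tau>: "\<sigma> j \<in> L \<and> \<tau> (\<sigma> j) = j" if j: "j \<in> J" for j
  proof -
    obtain l where "l \<in> L" "j = \<tau> l" using t j unfolding bij_betw_def by blast
    then show ?thesis using \<sigma> by simp
  qed
  have "(\<lambda>j\<in>J. c (\<sigma> j)) \<in> (\<Pi>\<^sub>E j\<in>J. A j)" using c \<tau> by (force simp: restrict_PiE_iff)
  moreover have "(\<lambda>l\<in>L. f l ((\<lambda>j\<in>J. c (\<sigma> j)) (\<tau> l))) = b"
    using c \<sigma> b bij_betwE[OF t] by (auto simp: fun_eq_iff restrict_def extensional_def)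
  ultimately show ?thesis by blast
qed

lemma rep_bij_sum:
  fixes F :: "'j \<Rightarrow> ('k::field, 'a) rep" and G :: "'l \<Rightarrow> ('k, 'b) rep"
  assumes L: "finite L" and t: "bij_betw \<tau> L J" and b: "\<And>l. l \<in> L \<Longrightarrow> rep_bij (F (\<tau> l)) (G l) (\<phi> l)"
  shows "rep_bij (rep_sum J F) (rep_sum L G) (sum_map L \<tau> \<phi>)"
proof -
  have J: "finite J" using t L bij_betw_finite by blast
  have tJ: "\<And>l. l \<in> L \<Longrightarrow> \<tau> l \<in> J" using bij_betwE[OF t] by blast
  note e = rep_bijD[OF b] and ls = lin_surjD[OF rep_bijD(2)[OF b]]
  have "lin_iso (vsp (rep_sum J F) i) (vsp (rep_sum L G) i) (sum_map L \<tau> \<phi> i)" for i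
  proof -
    have "sum_map L \<tau> \<phi> i ` (\<Pi>\<^sub>E j\<in>J. carrier (vsp (F j) i)) = (\<Pi>\<^sub>E l\<in>L. carrier (vsp (G l) i))"
    proof
      show "sum_map L \<tau> \<phi> i ` (\<Pi>\<^sub>E j\<in>J. carrier (vsp (F j) i)) \<subseteq> (\<Pi>\<^sub>E l\<in>L. carrier (vsp (G l) i))"
        using tJ e(5) by (fastforce simp: sum_map_def PiE_iff)
      show "(\<Pi>\<^sub>E l\<in>L. carrier (vsp (G l) i)) \<subseteq> sum_map L \<tau> \<phi> i ` (\<Pi>\<^sub>E j\<in>J. carrier (vsp (F j) i))"
      proof
        fix h assume h: "h \<in> (\<Pi>\<^sub>E l\<in>L. carrier (vsp (G l) i))"
        have "\<exists>a \<in> (\<Pi>\<^sub>E j\<in>J. carrier (vsp (F j) i)). (\<lambda>l\<in>L. \<phi> l i (a (\<tau> l))) = h"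
          using h e(6) by (intro reindexed_PiE[OF t]) (auto simp: PiE_iff)
        then show "h \<in> sum_map L \<tau> \<phi> i ` (\<Pi>\<^sub>E j\<in>J. carrier (vsp (F j) i))"
          unfolding sum_map_def by blast
      qed
    qed
    moreover have "inj_on (sum_map L \<tau> \<phi> i) (\<Pi>\<^sub>E j\<in>J. carrier (vsp (F j) i))"
    proof (rule inj_onI)
      fix g h assume g: "g \<in> (\<Pi>\<^sub>E j\<in>J. carrier (vsp (F j) i))" and h: "h \<in> (\<Pi>\<^sub>E j\<in>J. carrier (vsp (F j) i))"
        and eq: "sum_map L \<tau> \<phi> i g = sum_map L \<tau> \<phi> i h"
      show "g = h"
      proof (rule PiE_ext[OF g h])
        fix j assume j: "j \<in> J"
        then obtain l where l: "l \<in> L" "j = \<tau> l" using t unfolding bij_betw_def by blast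
        have "\<phi> l i (g j) = \<phi> l i (h j)" using fun_cong[OF eq, of l] l by (simp add: sum_map_def)
        then show "g j = h j" using inj_onD[OF e(7)[OF l(1), of i]] PiE_mem[OF g j] PiE_mem[OF h j] l(2) by blast
      qed
    qed
    moreover have "sum_map L \<tau> \<phi> i (g \<oplus>\<^bsub>vsp (rep_sum J F) i\<^esub> h) =
        sum_map L \<tau> \<phi> i g \<oplus>\<^bsub>vsp (rep_sum L G) i\<^esub> sum_map L \<tau> \<phi> i h"
      if g: "g \<in> (\<Pi>\<^sub>E j\<in>J. carrier (vsp (F j) i))" and h: "h \<in> (\<Pi>\<^sub>E j\<in>J. carrier (vsp (F j) i))" for g h
    proof -
      have "\<phi> l i (g (\<tau> l) \<oplus>\<^bsub>vsp (F (\<tau> l)) i\<^esub> h (\<tau> l)) = \<phi> l i (g (\<tau> l)) \<oplus>\<^bsub>vsp (G l) i\<^esub> \<phi> l i (h (\<tau> l))"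
        if "l \<in> L" for l
        using ls(2)[OF that] PiE_mem[OF g tJ[OF that]] PiE_mem[OF h tJ[OF that]] by blast
      then show ?thesis using tJ by (simp add: sum_map_def rep_sum_simps restrict_def fun_eq_iff)
    qed
    moreover have "sum_map L \<tau> \<phi> i (c \<odot>\<^bsub>vsp (rep_sum J F) i\<^esub> h) =
        c \<odot>\<^bsub>vsp (rep_sum L G) i\<^esub> sum_map L \<tau> \<phi> i h"
      if h: "h \<in> (\<Pi>\<^sub>E j\<in>J. carrier (vsp (F j) i))" for c h
    proof -
      have "\<phi> l i (c \<odot>\<^bsub>vsp (F (\<tau> l)) i\<^esub> h (\<tau> l)) = c \<odot>\<^bsub>vsp (G l) i\<^esub> \<phi> l i (h (\<tau> l))" if "l \<in> L" for l
        using ls(3)[OF that] PiE_mem[OF h tJ[OF that]] by blast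
      then show ?thesis using tJ by (simp add: sum_map_def rep_sum_simps restrict_def fun_eq_iff)
    qed
    moreover have "sum_map L \<tau> \<phi> i \<zero>\<^bsub>vsp (rep_sum J F) i\<^esub> = \<zero>\<^bsub>vsp (rep_sum L G) i\<^esub>"
      using tJ by (simp add: sum_map_def rep_sum_simps restrict_def fun_eq_iff ls(4))
    ultimately show ?thesis unfolding lin_iso_def lin_surj_def rep_sum_simps(1)[OF J] rep_sum_simps(1)[OF L] by blast
  qed
  moreover have "sum_map L \<tau> \<phi> (i + (1,0)) (xact (rep_sum J F) i h) = xact (rep_sum L G) i (sum_map L \<tau> \<phi> i h)"
    "sum_map L \<tau> \<phi> (i + (0,1)) (yact (rep_sum J F) i h) = yact (rep_sum L G) i (sum_map L \<tau> \<phi> i h)"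
    if h: "h \<in> (\<Pi>\<^sub>E j\<in>J. carrier (vsp (F j) i))" for i h
  proof -
    have "\<phi> l (i + (1,0)) (xact (F (\<tau> l)) i (h (\<tau> l))) = xact (G l) i (\<phi> l i (h (\<tau> l)))"
      "\<phi> l (i + (0,1)) (yact (F (\<tau> l)) i (h (\<tau> l))) = yact (G l) i (\<phi> l i (h (\<tau> l)))" if "l \<in> L" for l
      using e(3,4)[OF that] PiE_mem[OF h tJ[OF that]] by blast+
    then show "sum_map L \<tau> \<phi> (i + (1,0)) (xact (rep_sum J F) i h) = xact (rep_sum L G) i (sum_map L \<tau> \<phi> i h)"
      "sum_map L \<tau> \<phi> (i + (0,1)) (yact (rep_sum J F) i h) = yact (rep_sum L G) i (sum_map L \<tau> \<phi> i h)"
      using tJ by (simp_all add: sum_map_def rep_sum_simps(2-) restrict_def fun_eq_iff)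
  qed
  ultimately show ?thesis unfolding rep_bij_def rep_sum_simps(1)[OF J] by blast
qed

lemma kernel_sum:
  assumes J: "finite J"
  shows "h \<in> kerx (rep_sum J F) i \<Longrightarrow> j \<in> J \<Longrightarrow> h j \<in> kerx (F j) i"
    "h \<in> kery (rep_sum J F) i \<Longrightarrow> j \<in> J \<Longrightarrow> h j \<in> kery (F j) i"
  unfolding kerx_def kery_def by (auto simp: rep_sum_simps(1)[OF J] rep_sum_simps(2-) fun_eq_iff PiE_mem) metis+

text \<open>In a finite sum the coset of a family is the product of the cosets of its members, and a
  product of surjections onto the \<open>Y l\<close> is a surjection of products. Shared by
  \<open>bndf\<close> and \<open>bndg\<close>.\<close>

lemma sum_value_image:
  fixes P :: "'j \<Rightarrow> ('k::field, 'a) rep" and Q :: "'l \<Rightarrow> ('k, 'b) rep"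
  assumes L: "finite L" and t: "bij_betw \<tau> L J"
    and im: "\<And>l. l \<in> L \<Longrightarrow> Y l = \<phi> l i ` X (\<tau> l)" and sub: "\<And>j. j \<in> J \<Longrightarrow> X j \<subseteq> carrier (vsp (P j) i)"
    and b: "\<And>l. l \<in> L \<Longrightarrow> rep_bij (P (\<tau> l)) (Q l) (\<phi> l)"
  shows "{b \<in> carrier (vsp (rep_sum L Q) i). \<forall>l\<in>L. b l \<in> Y l} =
    sum_map L \<tau> \<phi> i ` {b \<in> carrier (vsp (rep_sum J P) i). \<forall>j\<in>J. b j \<in> X j}" (is "?A = _ ` ?B")
proof -
  have J: "finite J" using t L bij_betw_finite by blast
  have tJ: "\<And>l. l \<in> L \<Longrightarrow> \<tau> l \<in> J" using bij_betwE[OF t] by blast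
  have B: "?B = (\<Pi>\<^sub>E j\<in>J. X j)" unfolding rep_sum_simps(1)[OF J] using sub by (auto simp: PiE_iff extensional_def)
  have Y: "Y l \<subseteq> carrier (vsp (Q l) i)" if l: "l \<in> L" for l
    unfolding im[OF l]
  proof (rule image_subsetI)
    fix x assume "x \<in> X (\<tau> l)"
    then have "x \<in> carrier (vsp (P (\<tau> l)) i)" using sub[OF tJ[OF l]] by blast
    then show "\<phi> l i x \<in> carrier (vsp (Q l) i)" by (rule rep_bijD(5)[OF b[OF l]])
  qed
  have A: "?A = (\<Pi>\<^sub>E l\<in>L. Y l)" unfolding rep_sum_simps(1)[OF L] using Y by (auto simp: PiE_iff extensional_def)
  show ?thesis unfolding A B
  proof
    show "sum_map L \<tau> \<phi> i ` (\<Pi>\<^sub>E j\<in>J. X j) \<subseteq> (\<Pi>\<^sub>E l\<in>L. Y l)"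
      using tJ im by (fastforce simp: sum_map_def PiE_iff)
    show "(\<Pi>\<^sub>E l\<in>L. Y l) \<subseteq> sum_map L \<tau> \<phi> i ` (\<Pi>\<^sub>E j\<in>J. X j)"
    proof
      fix h assume h: "h \<in> (\<Pi>\<^sub>E l\<in>L. Y l)"
      have "\<exists>a \<in> (\<Pi>\<^sub>E j\<in>J. X j). (\<lambda>l\<in>L. \<phi> l i (a (\<tau> l))) = h"
        using h im by (intro reindexed_PiE[OF t]) (auto simp: PiE_iff)
      then show "h \<in> sum_map L \<tau> \<phi> i ` (\<Pi>\<^sub>E j\<in>J. X j)" unfolding sum_map_def by blast
    qed
  qed
qed

lemma bnd_sum_simps:
  "bndB (bnd_sum J P) = rep_sum J (\<lambda>j. bndB (P j))" "bndD (bnd_sum J P) = rep_sum J (\<lambda>j. bndD (P j))"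
  "bndf (bnd_sum J P) i d = {b \<in> carrier (vsp (rep_sum J (\<lambda>j. bndB (P j))) i). \<forall>j\<in>J. b j \<in> bndf (P j) i (d j)}"
  "bndg (bnd_sum J P) i d = {b \<in> carrier (vsp (rep_sum J (\<lambda>j. bndB (P j))) i). \<forall>j\<in>J. b j \<in> bndg (P j) i (d j)}"
  by (simp_all add: bnd_sum_def Let_def)

lemma bnd_bij_sum:
  fixes P :: "'j \<Rightarrow> ('k::field, 'b, 'd) bnd" and Q :: "'l \<Rightarrow> ('k, 'b2, 'd2) bnd"
  assumes L: "finite L" and t: "bij_betw \<tau> L J"
    and b: "\<And>l. l \<in> L \<Longrightarrow> bnd_bij (P (\<tau> l)) (Q l) (\<phi> l) (\<psi> l)"
    and f: "\<And>j i d. j \<in> J \<Longrightarrow> bndf (P j) i d \<subseteq> carrier (vsp (bndB (P j)) i)"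
    and g: "\<And>j i d. j \<in> J \<Longrightarrow> bndg (P j) i d \<subseteq> carrier (vsp (bndB (P j)) i)"
  shows "bnd_bij (bnd_sum J P) (bnd_sum L Q) (sum_map L \<tau> \<phi>) (sum_map L \<tau> \<psi>)"
proof -
  have J: "finite J" using t L bij_betw_finite by blast
  have tJ: "\<And>l. l \<in> L \<Longrightarrow> \<tau> l \<in> J" using bij_betwE[OF t] by blast
  have B: "\<And>l. l \<in> L \<Longrightarrow> rep_bij (bndB (P (\<tau> l))) (bndB (Q l)) (\<phi> l)"
    and D: "\<And>l. l \<in> L \<Longrightarrow> rep_bij (bndD (P (\<tau> l))) (bndD (Q l)) (\<psi> l)"
    using b unfolding bnd_bij_def by blast+
  have "bndf (bnd_sum L Q) i (sum_map L \<tau> \<psi> i d) = sum_map L \<tau> \<phi> i ` bndf (bnd_sum J P) i d"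
    if d: "d \<in> kery (rep_sum J (\<lambda>j. bndD (P j))) i" for i d
    unfolding bnd_sum_simps
  proof (rule sum_value_image[where P = "\<lambda>j. bndB (P j)" and Q = "\<lambda>l. bndB (Q l)" and \<phi> = \<phi>
        and X = "\<lambda>j. bndf (P j) i (d j)" and Y = "\<lambda>l. bndf (Q l) i (sum_map L \<tau> \<psi> i d l)", OF L t _ f B])
    fix l assume l: "l \<in> L"
    show "bndf (Q l) i (sum_map L \<tau> \<psi> i d l) = \<phi> l i ` bndf (P (\<tau> l)) i (d (\<tau> l))"
      using b[OF l] kernel_sum(2)[OF J d tJ[OF l]] l by (simp add: bnd_bij_def sum_map_def)
  qed
  moreover have "bndg (bnd_sum L Q) i (sum_map L \<tau> \<psi> i d) = sum_map L \<tau> \<phi> i ` bndg (bnd_sum J P) i d"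
    if d: "d \<in> kerx (rep_sum J (\<lambda>j. bndD (P j))) i" for i d
    unfolding bnd_sum_simps
  proof (rule sum_value_image[where P = "\<lambda>j. bndB (P j)" and Q = "\<lambda>l. bndB (Q l)" and \<phi> = \<phi>
        and X = "\<lambda>j. bndg (P j) i (d j)" and Y = "\<lambda>l. bndg (Q l) i (sum_map L \<tau> \<psi> i d l)", OF L t _ g B])
    fix l assume l: "l \<in> L"
    show "bndg (Q l) i (sum_map L \<tau> \<psi> i d l) = \<phi> l i ` bndg (P (\<tau> l)) i (d (\<tau> l))"
      using b[OF l] kernel_sum(1)[OF J d tJ[OF l]] l by (simp add: bnd_bij_def sum_map_def)
  qed
  moreover have "rep_bij (bndB (bnd_sum J P)) (bndB (bnd_sum L Q)) (sum_map L \<tau> \<phi>)"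
    unfolding bnd_sum_simps by (rule rep_bij_sum[where F = "\<lambda>j. bndB (P j)" and G = "\<lambda>l. bndB (Q l)", OF L t B])
  moreover have "rep_bij (bndD (bnd_sum J P)) (bndD (bnd_sum L Q)) (sum_map L \<tau> \<psi>)"
    unfolding bnd_sum_simps by (rule rep_bij_sum[where F = "\<lambda>j. bndD (P j)" and G = "\<lambda>l. bndD (Q l)", OF L t D])
  ultimately show ?thesis unfolding bnd_bij_def bnd_sum_simps(2) by blast
qed

section \<open>The boundary of a sum of spread representations\<close>

lemma spread_rep_simps:
  "carrier (vsp (spread_rep I) i) = (if i \<in> I then UNIV else {0})"
  "\<zero>\<^bsub>vsp (spread_rep I) i\<^esub> = 0" "a \<oplus>\<^bsub>vsp (spread_rep I) i\<^esub> b = a + b"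
  "a \<odot>\<^bsub>vsp (spread_rep I) i\<^esub> b = a * b"
  "xact (spread_rep I) i a = (if i \<in> I \<and> i + (1,0) \<in> I then a else 0)"
  "yact (spread_rep I) i a = (if i \<in> I \<and> i + (0,1) \<in> I then a else 0)"
  by (simp_all add: spread_rep_def)

definition convex_set :: "(int \<times> int) set \<Rightarrow> bool" where
  "convex_set I \<longleftrightarrow> (\<forall>p\<in>I. \<forall>q\<in>I. \<forall>r. p \<le> r \<and> r \<le> q \<longrightarrow> r \<in> I)"

lemma convex_setD: "convex_set I \<Longrightarrow> p \<in> I \<Longrightarrow> q \<in> I \<Longrightarrow> p \<le> r \<Longrightarrow> r \<le> q \<Longrightarrow> r \<in> I"
  unfolding convex_set_def by blast

text \<open>For convex \<open>I\<close>, the supports of the cokernel (\<open>low\<close>) and of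
  the kernel (\<open>upp\<close>) of \<open>xy\<close> on the spread representation.\<close>

definition low :: "(int \<times> int) set \<Rightarrow> (int \<times> int) set" where "low I = {i \<in> I. i - (1,1) \<notin> I}"
definition upp :: "(int \<times> int) set \<Rightarrow> (int \<times> int) set" where "upp I = {i \<in> I. i + (1,1) \<notin> I}"

text \<open>The boundary of the spread representation of \<open>I\<close>, in coordinates: a coset of the image of \<open>x\<close>
  at \<open>i\<close> is the whole line if \<open>i - (1,0)\<close> also lies in \<open>low I\<close>, and a single scalar otherwise.\<close>

definition spread_bnd :: "(int \<times> int) set \<Rightarrow> ('k::field, 'k, 'k) bnd" where
  "spread_bnd I = \<lparr>bndB = spread_rep (low I), bndD = spread_rep (upp I),
    bndf = (\<lambda>i d. {b \<in> carrier (vsp (spread_rep (low I)) i). i \<in> low I \<and> i - (1,0) \<notin> low I \<longrightarrow> b = d}),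
    bndg = (\<lambda>i d. {b \<in> carrier (vsp (spread_rep (low I)) i). i \<in> low I \<and> i - (0,1) \<notin> low I \<longrightarrow> b = d})\<rparr>"

lemma spread_bnd_simps:
  "bndB (spread_bnd I) = spread_rep (low I)" "bndD (spread_bnd I) = spread_rep (upp I)"
  "bndf (spread_bnd I) i d = {b \<in> carrier (vsp (spread_rep (low I)) i). i \<in> low I \<and> i - (1,0) \<notin> low I \<longrightarrow> b = d}"
  "bndg (spread_bnd I) i d = {b \<in> carrier (vsp (spread_rep (low I)) i). i \<in> low I \<and> i - (0,1) \<notin> low I \<longrightarrow> b = d}"
  by (simp_all add: spread_bnd_def)

text \<open>Avoids the nested quotients: a surjection \<open>q\<close> with kernel
  \<open>im_xy\<close> stands in for the projection to \<open>Cxy M\<close>, so that the values of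
  \<open>bndf\<close> and \<open>bndg\<close> are compared with single cosets in
  \<open>bndB Q\<close>.\<close>

lemma boundary_bij_criterion:
  fixes M :: "('k::field, 'a) rep" and Q :: "('k, 'b, 'd) bnd"
  assumes M: "is_rep M" and q: "\<And>i. lin_surj (vsp M i) (vsp (bndB Q) i) (q i)"
    and ker: "\<And>i m. m \<in> carrier (vsp M i) \<Longrightarrow> q i m = \<zero>\<^bsub>vsp (bndB Q) i\<^esub> \<longleftrightarrow> m \<in> im_xy M i"
    and x: "\<And>i m. m \<in> carrier (vsp M i) \<Longrightarrow> q (i + (1,0)) (xact M i m) = xact (bndB Q) i (q i m)"
    and y: "\<And>i m. m \<in> carrier (vsp M i) \<Longrightarrow> q (i + (0,1)) (yact M i m) = yact (bndB Q) i (q i m)"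
    and D: "rep_bij (Kxy M) (bndD Q) \<psi>"
    and f: "\<And>i m. m \<in> kery (Kxy M) i \<Longrightarrow> bndf Q i (\<psi> i m) = im_x (bndB Q) i +>\<^bsub>vsp (bndB Q) i\<^esub> q i m"
    and g: "\<And>i m. m \<in> kerx (Kxy M) i \<Longrightarrow> bndg Q i (\<psi> i m) = im_y (bndB Q) i +>\<^bsub>vsp (bndB Q) i\<^esub> q i m"
  shows "bnd_bij (boundary M) Q (\<lambda>i X. q i (SOME m. m \<in> X)) \<psi>"
proof -
  let ?h = "\<lambda>i X. q i (SOME m. m \<in> X)"
  note d = is_repD[OF M] and w = subrepD[OF subrep_im_xy[OF M]] and s = lin_surjD[OF q]
  have V: "is_vs (vsp (bndB Q) i)" for i using lin_surj_vs[OF d(1) q] .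
  have h: "?h i (im_xy M i +>\<^bsub>vsp M i\<^esub> m) = q i m" if m: "m \<in> carrier (vsp M i)" for i m
  proof -
    \<comment> \<open>The chosen representative differs from \<open>m\<close> by an element of
      \<open>im_xy\<close>, which \<open>q\<close> kills.\<close>
    have "(SOME n. n \<in> im_xy M i +>\<^bsub>vsp M i\<^esub> m) \<in> im_xy M i +>\<^bsub>vsp M i\<^esub> m"
      using coset_self_mem[OF d(1) w(1) m] by (rule someI)
    then obtain n where n: "n \<in> im_xy M i" "(SOME n. n \<in> im_xy M i +>\<^bsub>vsp M i\<^esub> m) = n \<oplus>\<^bsub>vsp M i\<^esub> m"
      unfolding mem_coset by blast
    have nc: "n \<in> carrier (vsp M i)" using n(1) w(4) by blast
    show ?thesis unfolding n(2) s(2)[OF nc m] using ker[OF nc] n(1) vs_l_zero[OF V s(5)[OF m]] by simp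
  qed
  have B: "rep_bij (Cxy M) (bndB Q) ?h"
  proof -
    have "lin_iso (vsp (Cxy M) i) (vsp (bndB Q) i) (?h i)" for i
      using lin_iso_quot[OF d(1) w(1) q h] ker by (simp add: Cxy_def quot_rep_def)
    moreover have "?h (i + (1,0)) (xact (Cxy M) i X) = xact (bndB Q) i (?h i X)"
      "?h (i + (0,1)) (yact (Cxy M) i X) = yact (bndB Q) i (?h i X)" if X: "X \<in> carrier (vsp (Cxy M) i)" for i X
    proof -
      obtain m where m: "m \<in> carrier (vsp M i)" "X = im_xy M i +>\<^bsub>vsp M i\<^esub> m"
        using X unfolding Cxy_def by (rule quot_rep_elem[OF M subrep_im_xy[OF M]])
      note a = quot_rep_act[OF M subrep_im_xy[OF M] m(1), folded Cxy_def]
      show "?h (i + (1,0)) (xact (Cxy M) i X) = xact (bndB Q) i (?h i X)"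
        unfolding m(2) a h[OF m(1)] h[OF d(5)[OF m(1)]] x[OF m(1)] ..
      show "?h (i + (0,1)) (yact (Cxy M) i X) = yact (bndB Q) i (?h i X)"
        unfolding m(2) a h[OF m(1)] h[OF d(6)[OF m(1)]] y[OF m(1)] ..
    qed
    ultimately show ?thesis unfolding rep_bij_def by blast
  qed
  have C: "is_rep (Cxy M)" by (rule Cxy_is_rep[OF M])
  have mc: "m \<in> carrier (vsp M i)" "im_xy M i +>\<^bsub>vsp M i\<^esub> m \<in> carrier (vsp (Cxy M) i)"
    if "m \<in> carrier (vsp (Kxy M) i)" for i m
  proof -
    show "m \<in> carrier (vsp M i)" using that by (simp add: Kxy_def sub_rep_def)
    then show "im_xy M i +>\<^bsub>vsp M i\<^esub> m \<in> carrier (vsp (Cxy M) i)"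
      using lin_surjD(5)[OF quot_rep_surj[OF M subrep_im_xy[OF M]]] by (simp add: Cxy_def)
  qed
  have "?h i ` bndf (boundary M) i m = bndf Q i (\<psi> i m)" if m: "m \<in> kery (Kxy M) i" for i m
  proof -
    have k: "m \<in> carrier (vsp (Kxy M) i)" using m by (simp add: kery_def)
    show ?thesis unfolding f[OF m] boundary_def bnd.simps
        rep_bij_coset[OF C B subrepD(4)[OF subrep_im_x[OF C]] mc(2)[OF k]] rep_bij_images[OF C B] h[OF mc(1)[OF k]] ..
  qed
  moreover have "?h i ` bndg (boundary M) i m = bndg Q i (\<psi> i m)" if m: "m \<in> kerx (Kxy M) i" for i m
  proof -
    have k: "m \<in> carrier (vsp (Kxy M) i)" using m by (simp add: kerx_def)
    show ?thesis unfolding g[OF m] boundary_def bnd.simps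
        rep_bij_coset[OF C B subrepD(4)[OF subrep_im_y[OF C]] mc(2)[OF k]] rep_bij_images[OF C B] h[OF mc(1)[OF k]] ..
  qed
  ultimately show ?thesis unfolding bnd_bij_def using B D by (simp add: boundary_def)
qed

lemma convex_square:
  assumes "convex_set I" "(a, b) \<in> I" "(a + 1, b + 1) \<in> I"
  shows "(a + 1, b) \<in> I" "(a, b + 1) \<in> I"
  using assms convex_setD[OF assms, of "(a + 1, b)"] convex_setD[OF assms, of "(a, b + 1)"] by auto

text \<open>Were \<open>i - (1,1)\<close> in \<open>I\<close>, the other two corners of the unit
  square spanned by it and \<open>i\<close> would be too, and one of them is the diagonal
  predecessor of the successor of \<open>i\<close>. So \<open>low I\<close> is a down-set of
  \<open>I\<close>, as befits the support of a quotient; dually \<open>upp I\<close> is an up-set,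
  the support of a subrepresentation.\<close>

lemma low_succ:
  assumes I: "convex_set I"
  shows "i + (1,0) \<in> low I \<Longrightarrow> i \<in> I \<Longrightarrow> i \<in> low I" "i + (0,1) \<in> low I \<Longrightarrow> i \<in> I \<Longrightarrow> i \<in> low I"
  using convex_square[OF I, of "fst i - 1" "snd i - 1"] by (cases i; auto simp: low_def)+

lemma upp_succ:
  assumes I: "convex_set I"
  shows "i \<in> upp I \<Longrightarrow> i + (1,0) \<in> I \<Longrightarrow> i + (1,0) \<in> upp I" "i \<in> upp I \<Longrightarrow> i + (0,1) \<in> I \<Longrightarrow> i + (0,1) \<in> upp I"
proof -
  show "i \<in> upp I \<Longrightarrow> i + (1,0) \<in> I \<Longrightarrow> i + (1,0) \<in> upp I"
    using convex_square[OF I, of "fst i + 1" "snd i"] by (cases i) (auto simp: upp_def)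
  show "i \<in> upp I \<Longrightarrow> i + (0,1) \<in> I \<Longrightarrow> i + (0,1) \<in> upp I"
    using convex_square[OF I, of "fst i" "snd i + 1"] by (cases i) (auto simp: upp_def)
qed

lemma spread_sum_simps:
  fixes F :: "'j \<Rightarrow> (int \<times> int) set"
  shows "\<zero>\<^bsub>vsp (rep_sum J (\<lambda>j. spread_rep (F j))) i\<^esub> = (\<lambda>j\<in>J. 0)"
  "h \<oplus>\<^bsub>vsp (rep_sum J (\<lambda>j. spread_rep (F j))) i\<^esub> h' = (\<lambda>j\<in>J. h j + h' j)"
  "c \<odot>\<^bsub>vsp (rep_sum J (\<lambda>j. spread_rep (F j))) i\<^esub> h = (\<lambda>j\<in>J. c * h j)"
  "xact (rep_sum J (\<lambda>j. spread_rep (F j))) i h = (\<lambda>j\<in>J. if i \<in> F j \<and> i + (1,0) \<in> F j then h j else 0)"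
  "yact (rep_sum J (\<lambda>j. spread_rep (F j))) i h = (\<lambda>j\<in>J. if i \<in> F j \<and> i + (0,1) \<in> F j then h j else 0)"
  by (simp_all add: rep_sum_simps(2-) spread_rep_simps)

lemma spread_sum_carrier:
  assumes "finite J"
  shows "h \<in> carrier (vsp (rep_sum J (\<lambda>j. spread_rep (F j))) i) \<longleftrightarrow>
    h \<in> extensional J \<and> (\<forall>j\<in>J. i \<notin> F j \<longrightarrow> h j = 0)"
  by (auto simp: rep_sum_simps(1)[OF assms] spread_rep_simps PiE_iff)

text \<open>All summands are treated at once, in coordinates, which spares a comparison of quotients
  of a sum with sums of quotients.\<close>

lemma boundary_spread_sum:
  fixes I :: "'j \<Rightarrow> (int \<times> int) set" and J :: "'j set" and S :: "('k::field, 'j \<Rightarrow> 'k) rep"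
  defines "S \<equiv> rep_sum J (\<lambda>j. spread_rep (I j))"
  assumes J: "finite J" and S: "is_rep S" and I: "\<And>j. j \<in> J \<Longrightarrow> convex_set (I j)"
  shows "\<exists>\<phi> \<psi>. bnd_bij (boundary S) (bnd_sum J (\<lambda>j. spread_bnd (I j))) \<phi> \<psi>"
proof -
  define q where "q = (\<lambda>i (h :: 'j \<Rightarrow> 'k). \<lambda>j\<in>J. if i \<in> low (I j) then h j else 0)"
  let ?B = "rep_sum J (\<lambda>j. spread_rep (low (I j))) :: ('k, 'j \<Rightarrow> 'k) rep"
  let ?D = "rep_sum J (\<lambda>j. spread_rep (upp (I j))) :: ('k, 'j \<Rightarrow> 'k) rep"
  note c = spread_sum_carrier[OF J] and ss = spread_sum_simps
  have lowI: "\<And>i j. i \<in> low (I j) \<Longrightarrow> i \<in> I j" and uppI: "\<And>i j. i \<in> upp (I j) \<Longrightarrow> i \<in> I j"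
    by (auto simp: low_def upp_def)
  have qs: "lin_surj (vsp S i) (vsp ?B i) (q i)" for i
  proof -
    have "q i ` carrier (vsp S i) = carrier (vsp ?B i)"
    proof
      show "q i ` carrier (vsp S i) \<subseteq> carrier (vsp ?B i)" by (auto simp: S_def c q_def)
      show "carrier (vsp ?B i) \<subseteq> q i ` carrier (vsp S i)"
      proof
        fix h assume h: "h \<in> carrier (vsp ?B i)"
        then have "h \<in> carrier (vsp S i)" by (auto simp: S_def c low_def)
        moreover have "q i h = h" using h by (auto simp: c q_def fun_eq_iff extensional_def)
        ultimately show "h \<in> q i ` carrier (vsp S i)" by (metis imageI)
      qed
    qed
    then show ?thesis unfolding lin_surj_def by (auto simp: S_def ss q_def fun_eq_iff)
  qed
  have ker: "q i m = \<zero>\<^bsub>vsp ?B i\<^esub> \<longleftrightarrow> m \<in> im_xy S i" if m: "m \<in> carrier (vsp S i)" for i m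
  proof -
    obtain k where k: "i = k + (1,1)" by (rule shift_cases)
    \<comment> \<open>Convexity supplies the intermediate point \<open>k + (0,1)\<close>, so
      \<open>xy\<close> is the identity on each summand whose spread contains both \<open>k\<close>
      and \<open>i\<close>.\<close>
    have sq: "k \<in> I j \<Longrightarrow> i \<in> I j \<Longrightarrow> k + (0,1) \<in> I j" if "j \<in> J" for j
      using convex_square(2)[OF I[OF that], of "fst k" "snd k"] by (cases k) (simp add: k)
    have lo: "i \<in> low (I j) \<longleftrightarrow> i \<in> I j \<and> k \<notin> I j" for j by (simp add: low_def k)
    have act: "xact S (k + (0,1)) (yact S k n) = (\<lambda>j\<in>J. if k \<in> I j \<and> i \<in> I j then n j else 0)" for n
      using sq by (auto simp: S_def ss shift k fun_eq_iff)
    have im: "im_xy S i = (\<lambda>n. \<lambda>j\<in>J. if k \<in> I j \<and> i \<in> I j then n j else 0) ` carrier (vsp S k)"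
      using im_shift(3)[of S k] by (simp add: act k[symmetric])
    show ?thesis
    proof
      assume z: "q i m = \<zero>\<^bsub>vsp ?B i\<^esub>"
      have mz: "m j = 0" if "j \<in> J" "\<not> (k \<in> I j \<and> i \<in> I j)" for j
        using fun_cong[OF z, of j] that m by (auto simp: q_def ss lo S_def c)
      define n where "n = (\<lambda>j\<in>J. if k \<in> I j then m j else 0)"
      have "n \<in> carrier (vsp S k)" by (simp add: S_def c n_def)
      moreover have "m = (\<lambda>j\<in>J. if k \<in> I j \<and> i \<in> I j then n j else 0)"
        using m mz by (auto simp: fun_eq_iff n_def S_def c extensional_def)
      ultimately show "m \<in> im_xy S i" unfolding im by blast
    next
      assume "m \<in> im_xy S i"
      then show "q i m = \<zero>\<^bsub>vsp ?B i\<^esub>" unfolding im by (auto simp: q_def ss lo fun_eq_iff)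
    qed
  qed
  have qx: "q (i + (1,0)) (xact S i m) = xact ?B i (q i m)" for i m
    by (auto simp: S_def ss q_def fun_eq_iff dest: lowI intro: low_succ(1)[OF I])
  have qy: "q (i + (0,1)) (yact S i m) = yact ?B i (q i m)" for i m
    by (auto simp: S_def ss q_def fun_eq_iff dest: lowI intro: low_succ(2)[OF I])
  have kc: "m \<in> carrier (vsp (Kxy S) i) \<longleftrightarrow> m \<in> carrier (vsp ?D i)" for i m
  proof -
    have sq: "i \<in> I j \<Longrightarrow> i + (1,1) \<in> I j \<Longrightarrow> i + (0,1) \<in> I j" if "j \<in> J" for j
      using convex_square(2)[OF I[OF that], of "fst i" "snd i"] by (cases i) simp
    have act: "xact S (i + (0,1)) (yact S i m) = (\<lambda>j\<in>J. if i \<in> I j \<and> i + (1,1) \<in> I j then m j else 0)"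
      using sq by (auto simp: S_def ss shift fun_eq_iff)
    have "(\<forall>j\<in>J. i \<in> I j \<and> i + (1,1) \<in> I j \<longrightarrow> m j = 0) \<longleftrightarrow>
        xact S (i + (0,1)) (yact S i m) = \<zero>\<^bsub>vsp S (i + (1,1))\<^esub>"
      unfolding act by (auto simp: S_def ss fun_eq_iff)
    then show ?thesis by (auto simp: Kxy_def sub_rep_def S_def c upp_def)
  qed
  have D: "rep_bij (Kxy S) ?D (\<lambda>i m. m)"
  proof -
    have "lin_iso (vsp (Kxy S) i) (vsp ?D i) (\<lambda>m. m)" for i
      using kc by (auto simp: lin_iso_def lin_surj_def Kxy_def sub_rep_def S_def ss)
    moreover have "xact (Kxy S) i m = xact ?D i m" "yact (Kxy S) i m = yact ?D i m"
      if "m \<in> carrier (vsp (Kxy S) i)" for i m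
      using that unfolding kc
      by (auto simp: c Kxy_def sub_rep_def S_def ss fun_eq_iff dest: uppI intro: upp_succ[OF I])
    ultimately show ?thesis unfolding rep_bij_def by blast
  qed
  \<comment> \<open>Serves both structure maps, with \<open>k\<close> the neighbour
    \<open>i - (1,0)\<close> or \<open>i - (0,1)\<close>: where \<open>low (I j)\<close> contains
    \<open>k\<close> as well as \<open>i\<close>, the image fills the line and imposes no condition
    on the coordinate \<open>j\<close>.\<close>
  have coset: "{b \<in> carrier (vsp ?B i). \<forall>j\<in>J. b j \<in> {c \<in> carrier (vsp (spread_rep (low (I j))) i).
        i \<in> low (I j) \<and> k \<notin> low (I j) \<longrightarrow> c = m j}} =
      ((\<lambda>n. \<lambda>j\<in>J. if k \<in> low (I j) \<and> i \<in> low (I j) then n j else 0) ` carrier (vsp ?B k)) +>\<^bsub>vsp ?B i\<^esub> q i m"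
    (is "?S = ?im +>\<^bsub>vsp ?B i\<^esub> q i m") for i k m
  proof (rule Set.set_eqI, rule iffI)
    fix b assume "b \<in> ?S"
    then have b: "b \<in> extensional J" "\<And>j. j \<in> J \<Longrightarrow> i \<notin> low (I j) \<Longrightarrow> b j = 0"
      "\<And>j. j \<in> J \<Longrightarrow> i \<in> low (I j) \<Longrightarrow> k \<notin> low (I j) \<Longrightarrow> b j = m j"
      by (auto simp: c)
    \<comment> \<open>The discrepancy between \<open>b\<close> and \<open>m\<close>, kept where the
      image can absorb it.\<close>
    define n where "n = (\<lambda>j\<in>J. if k \<in> low (I j) then b j - m j else 0)"
    have "n \<in> carrier (vsp ?B k)" by (simp add: c n_def)
    moreover have "b = (\<lambda>j\<in>J. if k \<in> low (I j) \<and> i \<in> low (I j) then n j else 0) \<oplus>\<^bsub>vsp ?B i\<^esub> q i m"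
      using b by (auto simp: ss n_def q_def fun_eq_iff extensional_def)
    ultimately show "b \<in> ?im +>\<^bsub>vsp ?B i\<^esub> q i m" unfolding mem_coset by blast
  next
    fix b assume "b \<in> ?im +>\<^bsub>vsp ?B i\<^esub> q i m"
    then show "b \<in> ?S" unfolding mem_coset by (auto simp: c ss q_def spread_rep_simps)
  qed
  have f: "bndf (bnd_sum J (\<lambda>j. spread_bnd (I j))) i m = im_x ?B i +>\<^bsub>vsp ?B i\<^esub> q i m" for i m
  proof -
    obtain k where k: "i = k + (1,0)" by (rule shift_cases)
    have "im_x ?B i = (\<lambda>n. \<lambda>j\<in>J. if k \<in> low (I j) \<and> i \<in> low (I j) then n j else 0) ` carrier (vsp ?B k)"
      "i - (1,0) = k"
      using im_shift(1)[of ?B k] by (simp_all add: ss k[symmetric]) (simp add: k)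
    then show ?thesis using coset[of i k m] by (simp only: bnd_sum_simps spread_bnd_simps)
  qed
  have g: "bndg (bnd_sum J (\<lambda>j. spread_bnd (I j))) i m = im_y ?B i +>\<^bsub>vsp ?B i\<^esub> q i m" for i m
  proof -
    obtain k where k: "i = k + (0,1)" by (rule shift_cases)
    have "im_y ?B i = (\<lambda>n. \<lambda>j\<in>J. if k \<in> low (I j) \<and> i \<in> low (I j) then n j else 0) ` carrier (vsp ?B k)"
      "i - (0,1) = k"
      using im_shift(2)[of ?B k] by (simp_all add: ss k[symmetric]) (simp add: k)
    then show ?thesis using coset[of i k m] by (simp only: bnd_sum_simps spread_bnd_simps)
  qed
  let ?Q = "bnd_sum J (\<lambda>j. spread_bnd (I j)) :: ('k, 'j \<Rightarrow> 'k, 'j \<Rightarrow> 'k) bnd"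
  have Q: "bndB ?Q = ?B" "bndD ?Q = ?D" by (simp_all add: bnd_sum_simps spread_bnd_simps)
  have "bnd_bij (boundary S) ?Q (\<lambda>i X. q i (SOME m. m \<in> X)) (\<lambda>i m. m)"
    using qs ker qx qy D f g by (intro boundary_bij_criterion[OF S]) (simp_all add: Q)
  then show ?thesis by blast
qed

section \<open>Finite spreads as pairs of lattice paths\<close>

definition diag :: "int \<times> int \<Rightarrow> int" where "diag i = fst i - snd i"

lemma diag_simps: "diag (a, b) = a - b" "diag (i + (1,0)) = diag i + 1" "diag (i - (1,0)) = diag i - 1"
  "diag (i + (0,1)) = diag i - 1" "diag (i - (0,1)) = diag i + 1" "diag (i + (1,1)) = diag i"
  "diag (i - (1,1)) = diag i"
  by (simp_all add: diag_def)

text \<open>The steps (1,0) and -(0,1) both raise \<open>diag\<close> by one, so time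
  \<open>t\<close> means the diagonal \<open>c + t\<close> on either path, and the two paths bound
  each diagonal of \<open>I\<close> from below and from above.\<close>

definition spread_path ::
  "(int \<times> int) set \<Rightarrow> nat \<Rightarrow> int \<Rightarrow> (nat \<Rightarrow> int \<times> int) \<Rightarrow> (nat \<Rightarrow> int \<times> int) \<Rightarrow> bool" where
  "spread_path I n c b d \<longleftrightarrow> convex_set I \<and> (\<forall>i\<in>I. c \<le> diag i \<and> diag i \<le> c + int n) \<and>
    low I = b ` {..n} \<and> upp I = d ` {..n} \<and>
    (\<forall>t\<le>n. diag (b t) = c + int t) \<and> (\<forall>t\<le>n. diag (d t) = c + int t) \<and>
    (\<forall>t<n. b (Suc t) = b t + (1,0) \<or> b (Suc t) = b t - (0,1)) \<and>
    (\<forall>t<n. d (Suc t) = d t + (1,0) \<or> d (Suc t) = d t - (0,1)) \<and>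
    b 0 = d 0 \<and> b n = d n"

text \<open>A discrete intermediate value theorem along a chain of comparable points: between two of
  them the required diagonal is met on a side of their bounding box, which convexity places in
  \<open>I\<close>.\<close>

lemma spread_diag_interval:
  assumes I: "spread I" and p: "p \<in> I" and q: "q \<in> I" and c: "min (diag p) (diag q) \<le> c" "c \<le> max (diag p) (diag q)"
  shows "\<exists>r\<in>I. diag r = c"
proof -
  let ?R = "{(a, b). a \<in> I \<and> b \<in> I \<and> (a \<le> b \<or> b \<le> a)}"
  have conv: "\<And>p q r. p \<in> I \<Longrightarrow> q \<in> I \<Longrightarrow> p \<le> r \<Longrightarrow> r \<le> q \<Longrightarrow> r \<in> I"
    using I unfolding spread_def by blast
  have comparable: "\<exists>r\<in>I. diag r = c"
    if pq: "p \<in> I" "q \<in> I" "p \<le> q" and c: "min (diag p) (diag q) \<le> c" "c \<le> max (diag p) (diag q)" for p q c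
  proof -
    obtain p1 p2 where p: "p = (p1, p2)" by (cases p)
    obtain q1 q2 where q: "q = (q1, q2)" by (cases q)
    have le: "p1 \<le> q1" "p2 \<le> q2" using pq(3) by (simp_all add: p q)
    show ?thesis
    \<comment> \<open>Moving right from \<open>p\<close> raises the diagonal index, moving up lowers
      it.\<close>
    proof (cases "p1 - p2 \<le> c")
      case True
      then have "(p1 + (c - (p1 - p2)), p2) \<in> I"
        using le c by (intro conv[OF pq(1,2)]) (auto simp: p q diag_def)
      then show ?thesis by (rule bexI[rotated]) (simp add: diag_def)
    next
      case False
      then have "(p1, p2 + (p1 - p2 - c)) \<in> I"
        using le c by (intro conv[OF pq(1,2)]) (auto simp: p q diag_def)
      then show ?thesis by (rule bexI[rotated]) (simp add: diag_def)
    qed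
  qed
  have "(p, q) \<in> ?R\<^sup>*" using I p q unfolding spread_def by blast
  then show ?thesis using c
  proof (induction arbitrary: c)
    case base
    then show ?case using p by (intro bexI[of _ p]) auto
  next
    case (step y z)
    show ?case
    \<comment> \<open>If the diagonal \<open>c\<close> does not lie between those of
      \<open>p\<close> and \<open>y\<close>, the last comparability crosses it.\<close>
    proof (cases "min (diag p) (diag y) \<le> c \<and> c \<le> max (diag p) (diag y)")
      case True
      then show ?thesis using step.IH by blast
    next
      case False
      have yz: "y \<in> I" "z \<in> I" "y \<le> z \<or> z \<le> y" using step.hyps(2) by auto
      have c: "min (diag y) (diag z) \<le> c" "c \<le> max (diag y) (diag z)" using step.prems False by linarith+
      show ?thesis using yz(3)
      proof
        assume "y \<le> z" then show ?thesis using comparable[OF yz(1,2)] c by blast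
      next
        assume "z \<le> y" then show ?thesis using comparable[OF yz(2,1)] c by (simp add: min.commute max.commute)
      qed
    qed
  qed
qed

text \<open>Finiteness gives a least and a greatest point on each diagonal, connectedness leaves no
  diagonal between the extreme ones empty, and convexity restricts the steps.\<close>

lemma spread_path_exists:
  assumes I: "spread I" and fin: "finite I"
  shows "\<exists>n c b d. spread_path I n c b d"
proof -
  have conv: "convex_set I" using I unfolding spread_def convex_set_def by blast
  have cI: "r \<in> I" if "p \<in> I" "q \<in> I" "p \<le> r" "r \<le> q" for p q r using convex_setD[OF conv that] .
  have ne: "I \<noteq> {}" using I unfolding spread_def by blast
  define c where "c = Min (diag ` I)"
  define n where "n = nat (Max (diag ` I) - c)"
  have fd: "finite (diag ` I)" "diag ` I \<noteq> {}" using fin ne by auto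
  have "c \<in> diag ` I" "Max (diag ` I) \<in> diag ` I" unfolding c_def using fd by (auto intro: Min_in Max_in)
  then obtain p q where pq: "p \<in> I" "diag p = c" "q \<in> I" "diag q = Max (diag ` I)" by auto
  have cle: "c \<le> diag i" "diag i \<le> Max (diag ` I)" if "i \<in> I" for i
    using that fd(1) by (auto simp: c_def)
  have n: "Max (diag ` I) = c + int n" using cle(1)[OF pq(3)] pq(4) by (simp add: n_def)
  have range: "c \<le> diag i \<and> diag i \<le> c + int n" if "i \<in> I" for i using cle[OF that] n by simp
  \<comment> \<open>The slice of \<open>I\<close> on the diagonal \<open>c + k\<close>, parametrised
    by the second coordinate.\<close>
  define T where "T k = {t. (c + int k + t, t) \<in> I}" for k :: nat
  have finT: "finite (T k)" for k
  proof (rule finite_subset)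
    show "T k \<subseteq> snd ` I" unfolding T_def by force
  qed (use fin in simp)
  have neT: "T k \<noteq> {}" if k: "k \<le> n" for k
  proof -
    obtain r where r: "r \<in> I" "diag r = c + int k"
      using spread_diag_interval[OF I pq(1,3), of "c + int k"] k pq(2,4) n by auto
    obtain x y where xy: "r = (x, y)" by (cases r)
    then have "x = c + int k + y" using r(2) by (simp add: diag_def)
    then show ?thesis using r(1) xy unfolding T_def by auto
  qed
  define l where "l k = Min (T k)" for k
  define u where "u k = Max (T k)" for k
  have lT: "(c + int k + l k, l k) \<in> I" and uT: "(c + int k + u k, u k) \<in> I" if "k \<le> n" for k
    using Min_in[OF finT neT[OF that]] Max_in[OF finT neT[OF that]] unfolding l_def u_def T_def by auto
  have lmin: "l k \<le> t" and umax: "t \<le> u k" if "(c + int k + t, t) \<in> I" for k t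
    using finT that unfolding l_def u_def T_def by (auto intro: Min_le Max_ge)
  define b where "b k = (c + int k + l k, l k)" for k
  define d where "d k = (c + int k + u k, u k)" for k
  have onI: "\<exists>k\<le>n. i = (c + int k + snd i, snd i)" if i: "i \<in> I" for i
  proof (intro exI conjI)
    show "nat (diag i - c) \<le> n" using range[OF i] by (simp add: nat_le_iff)
    show "i = (c + int (nat (diag i - c)) + snd i, snd i)" using range[OF i] by (cases i) (simp add: diag_def)
  qed
  have low: "low I = b ` {..n}"
  proof (rule Set.set_eqI, rule iffI)
    fix i assume i: "i \<in> low I"
    then obtain k where k: "k \<le> n" "i = (c + int k + snd i, snd i)" using onI unfolding low_def by blast
    have iI: "(c + int k + snd i, snd i) \<in> I" using i k(2) unfolding low_def by simp
    have "l k = snd i"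
    proof (rule ccontr)
      assume "l k \<noteq> snd i"
      then have "l k < snd i" using lmin[OF iI] by simp
      then have "(c + int k + (snd i - 1), snd i - 1) \<in> I" by (intro cI[OF lT[OF k(1)] iI]) auto
      moreover have "i - (1,1) = (c + int k + (snd i - 1), snd i - 1)" by (subst k(2)) simp
      ultimately show False using i unfolding low_def by simp
    qed
    then have "i = b k" using k(2) by (simp add: b_def)
    then show "i \<in> b ` {..n}" using k(1) by blast
  next
    fix i assume "i \<in> b ` {..n}"
    then obtain k where k: "k \<le> n" "i = (c + int k + l k, l k)" unfolding b_def by auto
    have "i - (1,1) \<notin> I"
    proof
      assume "i - (1,1) \<in> I"
      then have "(c + int k + (l k - 1), l k - 1) \<in> I" by (simp add: k(2) algebra_simps)
      then show False using lmin[of k "l k - 1"] by simp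
    qed
    then show "i \<in> low I" using lT[OF k(1)] unfolding low_def k(2) by blast
  qed
  have upp: "upp I = d ` {..n}"
  proof (rule Set.set_eqI, rule iffI)
    fix i assume i: "i \<in> upp I"
    then obtain k where k: "k \<le> n" "i = (c + int k + snd i, snd i)" using onI unfolding upp_def by blast
    have iI: "(c + int k + snd i, snd i) \<in> I" using i k(2) unfolding upp_def by simp
    have "u k = snd i"
    proof (rule ccontr)
      assume "u k \<noteq> snd i"
      then have "snd i < u k" using umax[OF iI] by simp
      then have "(c + int k + (snd i + 1), snd i + 1) \<in> I" by (intro cI[OF iI uT[OF k(1)]]) auto
      moreover have "i + (1,1) = (c + int k + (snd i + 1), snd i + 1)" by (subst k(2)) simp
      ultimately show False using i unfolding upp_def by simp
    qed
    then have "i = d k" using k(2) by (simp add: d_def)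
    then show "i \<in> d ` {..n}" using k(1) by blast
  next
    fix i assume "i \<in> d ` {..n}"
    then obtain k where k: "k \<le> n" "i = (c + int k + u k, u k)" unfolding d_def by auto
    have "i + (1,1) \<notin> I"
    proof
      assume "i + (1,1) \<in> I"
      then have "(c + int k + (u k + 1), u k + 1) \<in> I" by (simp add: k(2) algebra_simps)
      then show False using umax[of k "u k + 1"] by simp
    qed
    then show "i \<in> upp I" using uT[OF k(1)] unfolding upp_def k(2) by blast
  qed
  have bstep: "b (Suc k) = b k + (1,0) \<or> b (Suc k) = b k - (0,1)" if k: "k < n" for k
  proof -
    note p = lT[of k] lT[of "Suc k"]
    \<comment> \<open>Otherwise the right neighbour of \<open>b k\<close> lies between
      \<open>b k\<close> and \<open>b (Suc k)\<close>, and it is below the latter on the same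
      diagonal.\<close>
    have 1: "l (Suc k) \<le> l k"
    proof (rule ccontr)
      assume neg: "\<not> ?thesis"
      then have "(c + int (Suc k) + l k, l k) \<in> I" using k by (intro cI[OF p]) auto
      then show False using lmin[of "Suc k" "l k"] neg by simp
    qed
    \<comment> \<open>Otherwise the diagonal predecessor of \<open>b k\<close> lies between
      \<open>b (Suc k)\<close> and \<open>b k\<close>, against the minimality of
      \<open>l k\<close>.\<close>
    have 2: "l k - 1 \<le> l (Suc k)"
    proof (rule ccontr)
      assume "\<not> ?thesis"
      then have "(c + int k + (l k - 1), l k - 1) \<in> I" using k by (intro cI[OF p(2) p(1)]) auto
      then show False using lmin[of k "l k - 1"] by simp
    qed
    show ?thesis using 1 2 unfolding b_def by auto
  qed
  have dstep: "d (Suc k) = d k + (1,0) \<or> d (Suc k) = d k - (0,1)" if k: "k < n" for k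
  proof -
    note p = uT[of k] uT[of "Suc k"]
    have 1: "u (Suc k) \<le> u k"
    proof (rule ccontr)
      assume "\<not> ?thesis"
      then have "(c + int k + (u k + 1), u k + 1) \<in> I" using k by (intro cI[OF p]) auto
      then show False using umax[of k "u k + 1"] by simp
    qed
    have 2: "u k - 1 \<le> u (Suc k)"
    proof (rule ccontr)
      assume "\<not> ?thesis"
      then have "(c + int (Suc k) + (u (Suc k) + 1), u (Suc k) + 1) \<in> I" using k by (intro cI[OF p(2) p(1)]) auto
      then show False using umax[of "Suc k" "u (Suc k) + 1"] by simp
    qed
    show ?thesis using 1 2 unfolding d_def by auto
  qed
  \<comment> \<open>Two points on the first diagonal would enclose a point of the diagonal
    \<open>c - 1\<close>; on the last one they would enclose a point of the diagonal
    \<open>c + n + 1\<close>.\<close>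
  have "l 0 = u 0"
  proof (rule ccontr)
    assume "l 0 \<noteq> u 0"
    then have "l 0 < u 0" using umax[OF lT[of 0]] by simp
    then have "(c + int 0 + l 0, l 0 + 1) \<in> I" by (intro cI[OF lT[of 0] uT[of 0]]) auto
    from range[OF this] show False by (simp add: diag_def)
  qed
  moreover have "l n = u n"
  proof (rule ccontr)
    assume "l n \<noteq> u n"
    then have "l n < u n" using umax[OF lT[of n]] by simp
    then have "(c + int n + l n + 1, l n) \<in> I" by (intro cI[OF lT[of n] uT[of n]]) auto
    from range[OF this] show False by (simp add: diag_def)
  qed
  ultimately have "b 0 = d 0" "b n = d n" by (auto simp: b_def d_def)
  then have "spread_path I n c b d"
    unfolding spread_path_def using conv range low upp bstep dstep by (auto simp: b_def d_def diag_def)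
  then show ?thesis by blast
qed

lemma spread_pathD:
  assumes "spread_path I n c b d"
  shows "convex_set I" "i \<in> I \<Longrightarrow> c \<le> diag i" "i \<in> I \<Longrightarrow> diag i \<le> c + int n"
    "low I = b ` {..n}" "upp I = d ` {..n}" "t \<le> n \<Longrightarrow> diag (b t) = c + int t"
    "t \<le> n \<Longrightarrow> diag (d t) = c + int t" "t < n \<Longrightarrow> b (Suc t) = b t + (1,0) \<or> b (Suc t) = b t - (0,1)"
    "t < n \<Longrightarrow> d (Suc t) = d t + (1,0) \<or> d (Suc t) = d t - (0,1)" "d 0 = b 0" "d n = b n"
    "t \<le> n \<Longrightarrow> b t \<in> I" "t \<le> n \<Longrightarrow> d t \<in> I" "t \<le> n \<Longrightarrow> b t - (1,1) \<notin> I" "t \<le> n \<Longrightarrow> d t + (1,1) \<notin> I"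
proof -
  show "convex_set I" "i \<in> I \<Longrightarrow> c \<le> diag i" "i \<in> I \<Longrightarrow> diag i \<le> c + int n"
    and l: "low I = b ` {..n}" and u: "upp I = d ` {..n}" and "t \<le> n \<Longrightarrow> diag (b t) = c + int t"
    "t \<le> n \<Longrightarrow> diag (d t) = c + int t" "t < n \<Longrightarrow> b (Suc t) = b t + (1,0) \<or> b (Suc t) = b t - (0,1)"
    "t < n \<Longrightarrow> d (Suc t) = d t + (1,0) \<or> d (Suc t) = d t - (0,1)" "d 0 = b 0" "d n = b n"
    using assms unfolding spread_path_def by simp_all
  have "b t \<in> low I" if "t \<le> n" unfolding l using that by simp
  then show "t \<le> n \<Longrightarrow> b t \<in> I" "t \<le> n \<Longrightarrow> b t - (1,1) \<notin> I" unfolding low_def by blast+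
  have "d t \<in> upp I" if "t \<le> n" unfolding u using that by simp
  then show "t \<le> n \<Longrightarrow> d t \<in> I" "t \<le> n \<Longrightarrow> d t + (1,1) \<notin> I" unfolding upp_def by blast+
qed

text \<open>A step down along the path is a step of \<open>y\<close> read backwards.\<close>

lemma constant_along_path:
  fixes f :: "int \<times> int \<Rightarrow> 'c"
  assumes step: "\<And>t. t < n \<Longrightarrow> b (Suc t) = b t + (1,0) \<or> b (Suc t) = b t - (0,1)"
    and x: "\<And>i. i \<in> b ` {..n} \<Longrightarrow> i + (1,0) \<in> b ` {..n} \<Longrightarrow> f (i + (1,0)) = f i"
    and y: "\<And>i. i \<in> b ` {..n} \<Longrightarrow> i + (0,1) \<in> b ` {..n} \<Longrightarrow> f (i + (0,1)) = f i"
    and i: "i \<in> b ` {..n}"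
  shows "f i = f (b 0)"
proof -
  have "f (b t) = f (b 0)" if "t \<le> n" for t
    using that
  proof (induction t)
    case (Suc t)
    have in_path: "b t \<in> b ` {..n}" "b (Suc t) \<in> b ` {..n}" using Suc.prems by auto
    have "f (b (Suc t)) = f (b t)" using step[of t]
    proof
      assume e: "b (Suc t) = b t + (1,0)"
      then show ?thesis using x[OF in_path(1)] in_path(2) by simp
    next
      assume "b (Suc t) = b t - (0,1)"
      then have "b t = b (Suc t) + (0,1)" by simp
      then show ?thesis using y[OF in_path(2)] in_path(1) by simp
    qed (use Suc.prems in simp)
    then show ?case using Suc by simp
  qed simp
  then show ?thesis using i by blast
qed

section \<open>Oriented cycles\<close>

text \<open>A path is the list of its vertices without the final one, hence the separate end point
  \<open>w\<close>; a cycle is closed up by taking \<open>w\<close> to be its head.\<close>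

fun path_edges :: "'v list \<Rightarrow> 'v \<Rightarrow> ('v \<times> 'v) set" where
  "path_edges [] w = {}"
| "path_edges [v] w = {(v, w)}"
| "path_edges (v # v' # vs) w = insert (v, v') (path_edges (v' # vs) w)"

lemma path_edges_append:
  "ys \<noteq> [] \<Longrightarrow> path_edges (xs @ ys) w = path_edges xs (hd ys) \<union> path_edges ys w"
proof (induction xs)
  case (Cons x xs)
  then show ?case by (cases xs; cases ys) auto
qed simp

lemma path_edges_nth: "j < length vs \<Longrightarrow> (vs ! j, (vs @ [w]) ! Suc j) \<in> path_edges vs w"
proof (induction vs w arbitrary: j rule: path_edges.induct)
  case (3 v v' vs w)
  then show ?case by (cases j) auto
qed auto

lemma path_edges_cycle:
  assumes "j < length vs"
  shows "(vs ! j, vs ! (Suc j mod length vs)) \<in> path_edges vs (hd vs)"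
proof -
  have "(vs @ [hd vs]) ! Suc j = vs ! (Suc j mod length vs)"
  proof (cases "Suc j < length vs")
    case True
    then show ?thesis by (simp add: nth_append)
  next
    case False
    then have "Suc j = length vs" using assms by simp
    then show ?thesis using assms by (cases vs) (auto simp: nth_append)
  qed
  then show ?thesis using path_edges_nth[OF assms, of "hd vs"] by simp
qed

text \<open>\<open>st m\<close> is the vertex where block \<open>m\<close> starts, and therefore the
  omitted end of the block before it.\<close>

lemma path_edges_concat:
  assumes "\<And>m. m < K \<Longrightarrow> blk m \<noteq> [] \<and> hd (blk m) = st m \<and> path_edges (blk m) (st (Suc m)) \<subseteq> E"
  shows "path_edges (concat (map blk [0..<K])) (st K) \<subseteq> E"
  using assms
proof (induction K)
  case (Suc K)
  then show ?case using Suc.prems[of K] by (simp add: path_edges_append)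
qed simp

section \<open>Oriented cycles of curves without pauses\<close>

lemma runs_distinct_adj:
  "(\<And>m. Suc m < length ps \<Longrightarrow> ps ! m \<noteq> ps ! Suc m) \<Longrightarrow> runs ps = map (\<lambda>p. (p, 0)) ps"
proof (induction ps)
  case (Cons p ps)
  have IH: "runs ps = map (\<lambda>p. (p, 0)) ps"
    using Cons.prems[of "Suc m" for m] by (intro Cons.IH) simp
  show ?case
  proof (cases ps)
    case (Cons q qs)
    then have "p \<noteq> q" using Cons.prems[of 0] by simp
    then show ?thesis using IH Cons by simp
  qed simp
qed simp

text \<open>The contribution to \<open>oriented_cycle\<close> of a point at which the curve does not
  pause: no full turns occur.\<close>

definition turn_block :: "curve \<Rightarrow> nat \<Rightarrow> vertex list" where
  "turn_block \<gamma> m = (let K = length \<gamma>; i = \<gamma> ! (m mod K); i' = \<gamma> ! ((m + 1) mod K);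
      \<sigma> = side (\<gamma> ! ((m + K - 1) mod K)) i
    in (if side i i' \<noteq> \<sigma> then half_turn \<sigma> i else []) @ step_path i i')"

lemma oriented_cycle_no_stops:
  assumes len: "2 \<le> length \<gamma>"
    and dist: "\<And>m. m < length \<gamma> \<Longrightarrow> \<gamma> ! m \<noteq> \<gamma> ! (Suc m mod length \<gamma>)"
  shows "oriented_cycle \<gamma> = concat (map (turn_block \<gamma>) [0..<length \<gamma>])"
proof -
  have ne: "\<gamma> \<noteq> []" using len by auto
  have "\<gamma> ! 1 \<in> set \<gamma>" "\<gamma> ! 1 \<noteq> hd \<gamma>" using len dist[of 0] ne by (simp_all add: hd_conv_nth)
  then have nc: "\<not> set \<gamma> \<subseteq> {hd \<gamma>}" by blast
  \<comment> \<open>The list already starts at the beginning of a run, so the normalising rotation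
    is trivial.\<close>
  have "hd \<gamma> \<noteq> last \<gamma>"
    using dist[of "length \<gamma> - 1"] len ne by (simp add: hd_conv_nth last_conv_nth)
  then have least: "(LEAST m. hd (rotate m \<gamma>) \<noteq> last (rotate m \<gamma>)) = 0"
    by (intro Least_eq_0) simp
  have runs: "runs \<gamma> = map (\<lambda>p. (p, 0)) \<gamma>"
  proof (rule runs_distinct_adj)
    fix m assume "Suc m < length \<gamma>"
    then show "\<gamma> ! m \<noteq> \<gamma> ! Suc m" using dist[of m] by simp
  qed
  have pt: "fst (map (\<lambda>p. (p, 0 :: nat)) \<gamma> ! (m mod length \<gamma>)) = \<gamma> ! (m mod length \<gamma>)" for m
    using ne by simp
  show ?thesis unfolding oriented_cycle_def Let_def least runs rotate0 id_apply length_map pt turn_block_def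
    using nc by (auto intro!: arg_cong[of _ _ concat])
qed

text \<open>A vertex of \<open>S\<close> has at most two outgoing edges; if there are two, exactly
  one leads to a neighbouring point. Taking that one whenever the neighbour lies in \<open>I\<close>
  traces the boundary of \<open>I\<close>.\<close>

definition nxt :: "(int \<times> int) set \<Rightarrow> vertex \<Rightarrow> vertex" where
  "nxt I v = (case v of (k, i) \<Rightarrow> (case k of
      vDL \<Rightarrow> if i - (0,1) \<in> I then (vL, i - (0,1)) else (vD, i)
    | vD \<Rightarrow> if i + (1,0) \<in> I then (vDL, i + (1,0)) else (vR, i)
    | vL \<Rightarrow> (vDL, i)
    | vR \<Rightarrow> (vUR, i)
    | vUR \<Rightarrow> if i + (0,1) \<in> I then (vR, i + (0,1)) else (vU, i)
    | vU \<Rightarrow> if i - (1,0) \<in> I then (vUR, i - (1,0)) else (vL, i)))"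

lemma nxt_simps:
  "nxt I (vDL, i) = (if i - (0,1) \<in> I then (vL, i - (0,1)) else (vD, i))"
  "nxt I (vD, i) = (if i + (1,0) \<in> I then (vDL, i + (1,0)) else (vR, i))"
  "nxt I (vL, i) = (vDL, i)" "nxt I (vR, i) = (vUR, i)"
  "nxt I (vUR, i) = (if i + (0,1) \<in> I then (vR, i + (0,1)) else (vU, i))"
  "nxt I (vU, i) = (if i - (1,0) \<in> I then (vUR, i - (1,0)) else (vL, i))"
  by (simp_all add: nxt_def)

text \<open>The vertices that the cycle of \<open>I\<close> has to pass: besides the supports of the
  cokernel and the kernel of \<open>xy\<close>, those of the kernels of \<open>y\<close>
  (\<open>vU\<close>) and \<open>x\<close> (\<open>vR\<close>) and of the cokernels of
  \<open>x\<close> (\<open>vL\<close>) and \<open>y\<close> (\<open>vD\<close>) on the spread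
  representation.\<close>

definition bverts :: "(int \<times> int) set \<Rightarrow> vertex set" where
  "bverts I = {(k, i). case k of vDL \<Rightarrow> i \<in> low I | vUR \<Rightarrow> i \<in> upp I
    | vU \<Rightarrow> i \<in> I \<and> i + (0,1) \<notin> I | vR \<Rightarrow> i \<in> I \<and> i + (1,0) \<notin> I
    | vL \<Rightarrow> i \<in> I \<and> i - (1,0) \<notin> I | vD \<Rightarrow> i \<in> I \<and> i - (0,1) \<notin> I}"

lemma bverts_simps:
  "(vDL, i) \<in> bverts I \<longleftrightarrow> i \<in> low I" "(vUR, i) \<in> bverts I \<longleftrightarrow> i \<in> upp I"
  "(vU, i) \<in> bverts I \<longleftrightarrow> i \<in> I \<and> i + (0,1) \<notin> I" "(vR, i) \<in> bverts I \<longleftrightarrow> i \<in> I \<and> i + (1,0) \<notin> I"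
  "(vL, i) \<in> bverts I \<longleftrightarrow> i \<in> I \<and> i - (1,0) \<notin> I" "(vD, i) \<in> bverts I \<longleftrightarrow> i \<in> I \<and> i - (0,1) \<notin> I"
  by (simp_all add: bverts_def)

text \<open>The position of a vertex in the cycle, up to multiples of the length \<open>4 * n + 6\<close>.\<close>

definition position :: "nat \<Rightarrow> int \<Rightarrow> vertex \<Rightarrow> int" where
  "position n c v = (case v of (k, i) \<Rightarrow> (case k of
      vDL \<Rightarrow> 2 * (diag i - c) + 3
    | vD \<Rightarrow> 2 * (diag i - c) + 4
    | vL \<Rightarrow> 2 * (diag i - c) + 2
    | vR \<Rightarrow> 4 * int n + 5 - 2 * (diag i - c)
    | vUR \<Rightarrow> 4 * int n + 6 - 2 * (diag i - c)
    | vU \<Rightarrow> 4 * int n + 7 - 2 * (diag i - c)))"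

lemma shift_minus:
  "(i :: int \<times> int) + (1,0) - (1,1) = i - (0,1)" "(i :: int \<times> int) + (0,1) - (1,1) = i - (1,0)"
  "(i :: int \<times> int) - (1,0) + (1,1) = i + (0,1)" "(i :: int \<times> int) - (0,1) + (1,1) = i + (1,0)"
  "(i :: int \<times> int) - (0,1) - (1,0) = i - (1,1)" "(i :: int \<times> int) - (1,0) - (0,1) = i - (1,1)"
  "(i :: int \<times> int) - (0,1) + (1,0) - (0,1) - (1,0) = i - (0,1) - (0,1)"
  by (cases i; simp)+

text \<open>A diagonal neighbour of \<open>i\<close> in \<open>I\<close> would complete the unit
  square, contrary to the missing corner.\<close>

lemma convex_low:
  assumes I: "convex_set I" and i: "i \<in> I"
  shows "i - (1,0) \<notin> I \<Longrightarrow> i \<in> low I" "i - (0,1) \<notin> I \<Longrightarrow> i \<in> low I"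
    "i + (1,0) \<notin> I \<Longrightarrow> i \<in> upp I" "i + (0,1) \<notin> I \<Longrightarrow> i \<in> upp I"
proof -
  obtain x y where xy: "i = (x, y)" by (cases i)
  show "i - (1,0) \<notin> I \<Longrightarrow> i \<in> low I" "i - (0,1) \<notin> I \<Longrightarrow> i \<in> low I"
    using convex_square[OF I, of "x - 1" "y - 1"] i by (auto simp: xy low_def)
  show "i + (1,0) \<notin> I \<Longrightarrow> i \<in> upp I" "i + (0,1) \<notin> I \<Longrightarrow> i \<in> upp I"
    using convex_square[OF I, of x y] i by (auto simp: xy upp_def)
qed

definition curve_point :: "nat \<Rightarrow> (nat \<Rightarrow> int \<times> int) \<Rightarrow> (nat \<Rightarrow> int \<times> int) \<Rightarrow> nat \<Rightarrow> int \<times> int" where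
  "curve_point n b d m = (if m \<le> n then b m else d (2 * n - m))"

text \<open>The common end points are listed once, which leaves \<open>2 * n\<close> points; for
  \<open>n = 0\<close> both paths are the same single point, and the curve is constant of length
  one.\<close>

definition spread_curve :: "nat \<Rightarrow> (nat \<Rightarrow> int \<times> int) \<Rightarrow> (nat \<Rightarrow> int \<times> int) \<Rightarrow> curve" where
  "spread_curve n b d = map (curve_point n b d) [0..<max 1 (2 * n)]"

section \<open>The oriented cycle of a finite spread\<close>

context
  fixes I n c b d
  assumes P: "spread_path I n c b d"
begin

lemma nxt_bverts: "v \<in> bverts I \<Longrightarrow> nxt I v \<in> bverts I"
proof -
  assume v: "v \<in> bverts I"
  note p = spread_pathD[OF P] and cl = convex_low[OF p(1)]
  obtain k i where [simp]: "v = (k, i)" by (cases v)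
  show ?thesis
    using v by (cases k) (auto simp: nxt_simps bverts_simps low_def upp_def shift_minus shift
      dest: cl[unfolded low_def upp_def])
qed

text \<open>Makes \<open>position\<close> a clock: following \<open>nxt\<close>, no vertex recurs
  before \<open>4 * n + 6\<close> steps.\<close>

lemma position_nxt:
  assumes v: "v \<in> bverts I"
  shows "position n c (nxt I v) mod (4 * int n + 6) = (position n c v + 1) mod (4 * int n + 6)"
proof -
  note p = spread_pathD[OF P] and cl = convex_low[OF p(1)]
  \<comment> \<open>Only two transitions pass between the formulas for the lower and the upper path.
    From \<open>vD\<close> to \<open>vR\<close> they fit together on the diagonal
    \<open>c + n\<close>, and from \<open>vU\<close> to \<open>vL\<close> on the diagonal
    \<open>c\<close>, modulo \<open>4 * n + 6\<close>. The missing neighbours force these diagonals,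
    because the path could not continue otherwise.\<close>
  have corner: "diag i = c + int n" if "i \<in> I" "i - (0,1) \<notin> I" "i + (1,0) \<notin> I" for i
  proof -
    have "i \<in> b ` {..n}" using cl(2)[OF that(1,2)] p(4) by simp
    then obtain t where t: "t \<le> n" "i = b t" by auto
    have "t = n"
    proof (rule ccontr)
      assume "t \<noteq> n"
      then have "t < n" using t by simp
      then show False using p(8)[of t] p(12)[of "Suc t"] that t by auto
    qed
    then show ?thesis using p(6) t by simp
  qed
  have corner': "diag i = c" if "i \<in> I" "i - (1,0) \<notin> I" "i + (0,1) \<notin> I" for i
  proof -
    have "i \<in> d ` {..n}" using cl(4)[OF that(1,3)] p(5) by simp
    then obtain t where t: "t \<le> n" "i = d t" by auto
    have "t = 0"
    proof (rule ccontr)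
      assume "t \<noteq> 0"
      then obtain s where s: "t = Suc s" by (cases t) auto
      have "d s = i - (1,0) \<or> d s = i + (0,1)" using p(9)[of s] t s by auto
      then show False using p(13)[of s] that t s by auto
    qed
    then show ?thesis using p(7)[of 0] t by simp
  qed
  obtain k i where [simp]: "v = (k, i)" by (cases v)
  show ?thesis
  proof (cases k)
    case vU
    have "8 + 4 * int n = 2 + (4 * int n + 6)" by simp
    also have "\<dots> mod (4 * int n + 6) = 2" by (simp only: mod_add_self2) simp
    finally have "(8 + 4 * int n) mod (4 * int n + 6) = 2" .
    then show ?thesis using v vU corner'[of i]
      by (auto simp: nxt_simps bverts_simps position_def diag_simps algebra_simps)
  qed (use v corner[of i] in \<open>auto simp: nxt_simps bverts_simps position_def diag_simps algebra_simps\<close>)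
qed

abbreviation "nxt_graph \<equiv> {(v, nxt I v) | v. True}"

text \<open>The cycle of the curve follows \<open>nxt\<close> along the lower path: if the step goes
  right, the point below \<open>b t\<close> is the diagonal predecessor of \<open>b (Suc t)\<close>
  and so not in \<open>I\<close>; if it goes down, that point is \<open>b (Suc t)\<close>
  itself.\<close>

lemma lower_step:
  assumes t: "t < n"
  shows "hd (step_path (b t) (b (Suc t))) = (vDL, b t)" "length (step_path (b t) (b (Suc t))) = 2"
    "path_edges (step_path (b t) (b (Suc t))) (vDL, b (Suc t)) \<subseteq> nxt_graph"
    "side (b t) (b (Suc t)) = vDL" "b (Suc t) \<noteq> b t"
proof -
  note p = spread_pathD[OF P]
  consider "b (Suc t) = b t + (1,0)" | "b (Suc t) = b t - (0,1)" using p(8)[OF t] by blast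
  then have "hd (step_path (b t) (b (Suc t))) = (vDL, b t) \<and> length (step_path (b t) (b (Suc t))) = 2 \<and>
    path_edges (step_path (b t) (b (Suc t))) (vDL, b (Suc t)) \<subseteq> nxt_graph \<and>
    side (b t) (b (Suc t)) = vDL \<and> b (Suc t) \<noteq> b t"
  proof cases
    case 1
    have "b t - (0,1) \<notin> I" "b t + (1,0) \<in> I" using p(14)[of "Suc t"] p(12)[of "Suc t"] t 1 by (simp_all add: shift_minus)
    moreover have "b (Suc t) \<noteq> b t" using 1 by (simp add: prod_eq_iff)
    ultimately show ?thesis using 1 by (simp add: step_path_def side_def nxt_simps)
  next
    case 2
    have e: "b (Suc t) - b t = (0,-1)" using 2 by (simp add: prod_eq_iff)
    have "b t - (0,1) \<in> I" using p(12)[of "Suc t"] t unfolding 2 by simp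
    note e = e this
    have "b (Suc t) \<noteq> b t" using 2 by (simp add: prod_eq_iff)
    then show ?thesis using 2 e by (simp add: step_path_def side_def nxt_simps)
  qed
  then show "hd (step_path (b t) (b (Suc t))) = (vDL, b t)" "length (step_path (b t) (b (Suc t))) = 2"
    "path_edges (step_path (b t) (b (Suc t))) (vDL, b (Suc t)) \<subseteq> nxt_graph"
    "side (b t) (b (Suc t)) = vDL" "b (Suc t) \<noteq> b t" by blast+
qed

lemma upper_step:
  assumes t: "t < n"
  shows "hd (step_path (d (Suc t)) (d t)) = (vUR, d (Suc t))" "length (step_path (d (Suc t)) (d t)) = 2"
    "path_edges (step_path (d (Suc t)) (d t)) (vUR, d t) \<subseteq> nxt_graph"
    "side (d (Suc t)) (d t) = vUR" "d (Suc t) \<noteq> d t"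
proof -
  note p = spread_pathD[OF P]
  consider "d (Suc t) = d t + (1,0)" | "d (Suc t) = d t - (0,1)" using p(9)[OF t] by blast
  then have "hd (step_path (d (Suc t)) (d t)) = (vUR, d (Suc t)) \<and> length (step_path (d (Suc t)) (d t)) = 2 \<and>
    path_edges (step_path (d (Suc t)) (d t)) (vUR, d t) \<subseteq> nxt_graph \<and>
    side (d (Suc t)) (d t) = vUR \<and> d (Suc t) \<noteq> d t"
  proof cases
    case 1
    have e: "d t - d (Suc t) = (-1,0)" "d t = d (Suc t) - (1,0)" using 1 by (simp_all add: prod_eq_iff)
    \<comment> \<open>The point above \<open>d (Suc t)\<close> is \<open>d t + (1,1)\<close>, which
      is outside \<open>I\<close> because \<open>d t\<close> is the top of its diagonal.\<close>
    have "d (Suc t) + (0,1) \<notin> I" "d (Suc t) - (1,0) \<in> I"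
      using p(15)[of t] p(13)[of t] t 1 by (simp_all add: shift)
    moreover have "d (Suc t) \<noteq> d t" using 1 by (simp add: prod_eq_iff)
    ultimately show ?thesis using e by (simp add: step_path_def side_def nxt_simps)
  next
    case 2
    have e: "d t - d (Suc t) = (0,1)" "d t = d (Suc t) + (0,1)" using 2 by (simp_all add: prod_eq_iff)
    have "d (Suc t) + (0,1) \<in> I" using p(13)[of t] t 2 by simp
    moreover have "d (Suc t) \<noteq> d t" using 2 by (simp add: prod_eq_iff)
    ultimately show ?thesis using e by (simp add: step_path_def side_def nxt_simps)
  qed
  then show "hd (step_path (d (Suc t)) (d t)) = (vUR, d (Suc t))" "length (step_path (d (Suc t)) (d t)) = 2"
    "path_edges (step_path (d (Suc t)) (d t)) (vUR, d t) \<subseteq> nxt_graph"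
    "side (d (Suc t)) (d t) = vUR" "d (Suc t) \<noteq> d t" by blast+
qed

text \<open>The neighbours that would divert \<open>nxt\<close> from a half turn lie on the
  diagonals \<open>c - 1\<close> and \<open>c + n + 1\<close>, outside \<open>I\<close>.\<close>

lemma half_turns:
  "path_edges (half_turn vUR (b 0)) (vDL, b 0) \<subseteq> nxt_graph"
  "path_edges (half_turn vDL (b n)) (vUR, b n) \<subseteq> nxt_graph"
proof -
  note p = spread_pathD[OF P]
  have "b 0 + (0,1) \<notin> I" "b 0 - (1,0) \<notin> I" 
    using p(2)[of "b 0 + (0,1)"] p(2)[of "b 0 - (1,0)"] p(6)[of 0] by (auto simp: diag_simps)
  then show "path_edges (half_turn vUR (b 0)) (vDL, b 0) \<subseteq> nxt_graph"
    by (simp add: half_turn_def nxt_simps)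
  have "b n - (0,1) \<notin> I" "b n + (1,0) \<notin> I" 
    using p(3)[of "b n - (0,1)"] p(3)[of "b n + (1,0)"] p(6)[of n] by (auto simp: diag_simps)
  then show "path_edges (half_turn vDL (b n)) (vUR, b n) \<subseteq> nxt_graph"
    by (simp add: half_turn_def nxt_simps)
qed

lemma curve_point_simps:
  "m \<le> n \<Longrightarrow> curve_point n b d m = b m" "n \<le> m \<Longrightarrow> curve_point n b d m = d (2 * n - m)" "curve_point n b d (2 * n) = curve_point n b d 0"
  using spread_pathD(10,11)[OF P] by (auto simp: curve_point_def)

lemma spread_curve_nth: "0 < n \<Longrightarrow> m \<le> 2 * n \<Longrightarrow> (spread_curve n b d) ! (m mod length (spread_curve n b d)) = curve_point n b d m"
  using curve_point_simps(3) by (cases "m = 2 * n") (auto simp: spread_curve_def max_def)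

text \<open>A half turn marks a change of path. On the lower path this happens only at
  \<open>m = 0\<close>, whose cyclic predecessor lies on the upper path.\<close>

lemma turn_block_low:
  assumes m: "m < n"
  shows "turn_block (spread_curve n b d) m = (if m = 0 then half_turn vUR (b 0) else []) @ step_path (b m) (b (Suc m))"
proof -
  have K: "length (spread_curve n b d) = 2 * n" using m by (simp add: spread_curve_def)
  note nth = spread_curve_nth[unfolded K]
  have i: "(spread_curve n b d) ! (m mod (2 * n)) = b m" "(spread_curve n b d) ! ((m + 1) mod (2 * n)) = b (Suc m)"
    using nth[of m] nth[of "m + 1"] m by (simp_all add: curve_point_simps)
  have s: "side ((spread_curve n b d) ! ((m + 2 * n - 1) mod (2 * n))) (b m) = (if m = 0 then vUR else vDL)"
  proof (cases m)
    case 0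
    have "(spread_curve n b d) ! ((m + 2 * n - 1) mod (2 * n)) = d 1"
      using nth[of "2 * n - 1"] 0 m by (simp add: curve_point_simps(2))
    then show ?thesis using upper_step(4)[of 0] 0 m spread_pathD(10)[OF P] by simp
  next
    case (Suc l)
    have "(m + 2 * n - 1) mod (2 * n) = l mod (2 * n)" using Suc by simp
    then have "(spread_curve n b d) ! ((m + 2 * n - 1) mod (2 * n)) = b l"
      using nth[of l] Suc m by (simp add: curve_point_simps(1))
    then show ?thesis using lower_step(4)[of l] Suc m by simp
  qed
  show ?thesis unfolding turn_block_def Let_def K i s using lower_step(4)[OF m] by auto
qed

text \<open>The upper path is traversed backwards, so \<open>t\<close> is the time on it at which
  the step ends; the change of path is at the common end \<open>m = n\<close>.\<close>

lemma turn_block_upp: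
  assumes m: "n \<le> m" "m < 2 * n" and t: "t = 2 * n - Suc m"
  shows "turn_block (spread_curve n b d) m = (if m = n then half_turn vDL (b n) else []) @ step_path (d (Suc t)) (d t)"
proof -
  have K: "length (spread_curve n b d) = 2 * n" using m by (simp add: spread_curve_def)
  have tn: "t < n" "Suc t = 2 * n - m" using m t by auto
  note nth = spread_curve_nth[unfolded K]
  have i: "(spread_curve n b d) ! (m mod (2 * n)) = d (Suc t)" "(spread_curve n b d) ! ((m + 1) mod (2 * n)) = d t"
    using nth[of m] nth[of "m + 1"] m t tn by (simp_all add: curve_point_simps(2))
  have s: "side ((spread_curve n b d) ! ((m + 2 * n - 1) mod (2 * n))) (d (Suc t)) = (if m = n then vDL else vUR)"
  proof -
    obtain l where l: "m = Suc l" using m by (cases m) auto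
    have "(m + 2 * n - 1) mod (2 * n) = l mod (2 * n)" using l by simp
    then have e: "(spread_curve n b d) ! ((m + 2 * n - 1) mod (2 * n)) = curve_point n b d l"
      using nth[of l] l m by simp
    show ?thesis
    proof (cases "m = n")
      case True
      then have "d (Suc t) = b (Suc l)" "curve_point n b d l = b l"
        using l tn spread_pathD(11)[OF P] by (simp_all add: curve_point_simps(1))
      then show ?thesis using e lower_step(4)[of l] True l by simp
    next
      case False
      then have "2 * n - l = Suc (Suc t)" "n \<le> l" using l m tn by linarith+
      then have "curve_point n b d l = d (Suc (Suc t))" by (simp add: curve_point_simps(2))
      then show ?thesis using e upper_step(4)[of "Suc t"] False m tn by simp
    qed
  qed
  have "m = n \<Longrightarrow> d (Suc t) = b n" using tn spread_pathD(11)[OF P] by simp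
  then show ?thesis unfolding turn_block_def Let_def K i s using upper_step(4)[OF tn(1)] by auto
qed

text \<open>The length counts two edges for each of the \<open>2 * n\<close> steps and three for
  each of the two half turns; for \<open>n = 0\<close> the half turns alone form one full
  turn.\<close>

lemma spread_cycle:
  defines "vs \<equiv> oriented_cycle (spread_curve n b d)"
  shows "vs \<noteq> []" "hd vs = (vUR, b 0)" "path_edges vs (hd vs) \<subseteq> nxt_graph" "length vs = 4 * n + 6"
    "t \<le> n \<Longrightarrow> (vDL, b t) \<in> set vs" "t \<le> n \<Longrightarrow> (vUR, d t) \<in> set vs"
proof -
  note p = spread_pathD[OF P]
  have "vs \<noteq> [] \<and> hd vs = (vUR, b 0) \<and> path_edges vs (vUR, b 0) \<subseteq> nxt_graph \<and> length vs = 4 * n + 6 \<and>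
    (\<forall>t\<le>n. (vDL, b t) \<in> set vs) \<and> (\<forall>t\<le>n. (vUR, d t) \<in> set vs)"
  proof (cases "n = 0")
    case True
    have vs: "vs = half_turn vUR (b 0) @ half_turn vDL (b 0)"
      using True by (simp add: vs_def spread_curve_def oriented_cycle_def curve_point_def full_turn_def)
    have "path_edges vs (vUR, b 0) \<subseteq> nxt_graph"
    proof -
      have h: "half_turn vDL (b 0) \<noteq> []" "hd (half_turn vDL (b 0)) = (vDL, b 0)"
        by (simp_all add: half_turn_def)
      show ?thesis unfolding vs path_edges_append[OF h(1)] h(2)
        using half_turns(1) half_turns(2)[unfolded True] by (rule Un_least)
    qed
    moreover have "vs \<noteq> []" "hd vs = (vUR, b 0)" "length vs = 6" "(vDL, b 0) \<in> set vs" "(vUR, d 0) \<in> set vs"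
      using p(10) by (simp_all add: vs half_turn_def)
    ultimately show ?thesis using True by simp
  next
    case False
    have K: "length (spread_curve n b d) = 2 * n" using False by (simp add: spread_curve_def)
    have ne: "(spread_curve n b d) ! m \<noteq> (spread_curve n b d) ! (Suc m mod length (spread_curve n b d))" if "m < length (spread_curve n b d)" for m
    proof -
      have "(spread_curve n b d) ! m = curve_point n b d m" "(spread_curve n b d) ! (Suc m mod length (spread_curve n b d)) = curve_point n b d (Suc m)"
        using that K False spread_curve_nth[of m] spread_curve_nth[of "Suc m"] by simp_all
      moreover have "curve_point n b d m \<noteq> curve_point n b d (Suc m)"
      proof (cases "m < n")
        case True
        then show ?thesis using lower_step(5)[of m] by (simp add: curve_point_simps(1))
      next
        case False
        then have "curve_point n b d m = d (Suc (2 * n - Suc m))" "curve_point n b d (Suc m) = d (2 * n - Suc m)"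
          using that K by (simp_all add: curve_point_simps(2) Suc_diff_Suc)
        then show ?thesis using upper_step(5)[of "2 * n - Suc m"] that K False by simp
      qed
      ultimately show ?thesis by simp
    qed
    have vs: "vs = concat (map (turn_block (spread_curve n b d)) [0..<2 * n])"
      unfolding vs_def using oriented_cycle_no_stops[OF _ ne] K False by simp
    \<comment> \<open>The start of block \<open>m\<close>. At \<open>m = 0\<close> and
      \<open>m = n\<close> the half turn comes first, so these blocks still start on the side of the
      path just left.\<close>
    define st where "st m = (if m = 0 \<or> n < m then vUR else vDL, curve_point n b d m)" for m
    have blk: "turn_block (spread_curve n b d) m \<noteq> [] \<and> hd (turn_block (spread_curve n b d) m) = st m \<and>
      path_edges (turn_block (spread_curve n b d) m) (st (Suc m)) \<subseteq> nxt_graph" if m: "m < 2 * n" for m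
    proof (cases "m < n")
      case True
      note l = lower_step[OF True]
      have ne: "step_path (b m) (b (Suc m)) \<noteq> []" using l(2) by auto
      have st: "st (Suc m) = (vDL, b (Suc m))" "st m = (if m = 0 then vUR else vDL, b m)"
        using True by (auto simp: st_def curve_point_simps(1))
      show ?thesis
      proof (cases "m = 0")
        case True
        have h: "hd (half_turn vUR (b 0) @ xs) = (vUR, b 0)" "half_turn vUR (b 0) @ xs \<noteq> []" for xs
          by (simp_all add: half_turn_def)
        have e: "path_edges (half_turn vUR (b 0) @ step_path (b m) (b (Suc m))) (vDL, b (Suc m)) \<subseteq> nxt_graph"
          unfolding path_edges_append[OF ne] l(1) using half_turns(1) l(3) unfolding True by (rule Un_least)
        show ?thesis unfolding turn_block_low[OF \<open>m < n\<close>] st using e h True by simp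
      next
        case False
        then show ?thesis unfolding turn_block_low[OF \<open>m < n\<close>] st using l(1,3) ne by simp
      qed
    next
      case False
      define t where "t = 2 * n - Suc m"
      have t: "t < n" "Suc t = 2 * n - m" using False m by (auto simp: t_def)
      note l = upper_step[OF t(1)]
      have ne: "step_path (d (Suc t)) (d t) \<noteq> []" using l(2) by auto
      have st: "st (Suc m) = (vUR, d t)" "st m = (if m = n then vDL else vUR, d (Suc t))"
        using False m t by (auto simp: st_def curve_point_simps(2) t_def)
      note blk = turn_block_upp[OF leI[OF False] m t_def]
      show ?thesis
      proof (cases "m = n")
        case True
        then have dn: "d (Suc t) = b n" using t p(11) by simp
        have h: "hd (half_turn vDL (b n) @ xs) = (vDL, b n)" "half_turn vDL (b n) @ xs \<noteq> []" for xs
          by (simp_all add: half_turn_def)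
        have e: "path_edges (half_turn vDL (b n) @ step_path (d (Suc t)) (d t)) (vUR, d t) \<subseteq> nxt_graph"
          unfolding path_edges_append[OF ne] l(1) using half_turns(2) l(3) unfolding dn by (rule Un_least)
        show ?thesis unfolding blk st using e h True dn by simp
      next
        case False
        then show ?thesis unfolding blk st using l(1,3) ne by simp
      qed
    qed
    have "st (2 * n) = (vUR, b 0)" using False by (simp add: st_def curve_point_simps)
    then have 1: "path_edges vs (vUR, b 0) \<subseteq> nxt_graph" unfolding vs 
      using path_edges_concat[of "2 * n" "turn_block (spread_curve n b d)" st nxt_graph, OF blk] by simp
    have "[0..<2 * n] = 0 # [1..<2 * n]" using False by (simp add: upt_conv_Cons)
    then have 2: "vs \<noteq> []" "hd vs = (vUR, b 0)" using blk[of 0] False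
      unfolding vs by (simp_all add: st_def curve_point_simps(1))
    have len: "length (turn_block (spread_curve n b d) m) = 2 + (if m = 0 then 3 else 0) + (if m = n then 3 else 0)"
      if m: "m < 2 * n" for m
    proof (cases "m < n")
      case True
      then show ?thesis using lower_step(2)[OF True] by (simp add: turn_block_low half_turn_def)
    next
      case False
      then have "2 * n - Suc m < n" using m by simp
      then show ?thesis using upper_step(2)[of "2 * n - Suc m"] False m \<open>n \<noteq> 0\<close>
        by (simp add: turn_block_upp[OF _ m refl] half_turn_def)
    qed
    have "length vs = (\<Sum>m<2 * n. length (turn_block (spread_curve n b d) m))"
      by (simp add: vs length_concat comp_def interv_sum_list_conv_sum_set_nat atLeast0LessThan)
    also have "\<dots> = (\<Sum>m<2 * n. 2 + (if m = 0 then 3 else 0) + (if m = n then 3 else 0))"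
      by (intro sum.cong refl) (simp add: len)
    also have "\<dots> = 4 * n + 6" unfolding sum.distrib using False by simp
    finally have 3: "length vs = 4 * n + 6" .
    have mem: "w \<in> set vs" if "m < 2 * n" "w \<in> set (turn_block (spread_curve n b d) m)" for m w
      using that unfolding vs by auto
    have 4: "(vDL, b t) \<in> set vs" if t: "t \<le> n" for t
    proof (cases "t < n")
      case True
      then have "(vDL, b t) \<in> set (step_path (b t) (b (Suc t)))"
        using lower_step(1,2)[OF True] by (metis hd_in_set list.size(3) zero_neq_numeral)
      then show ?thesis using mem[of t] True by (simp add: turn_block_low)
    next
      case False
      then have "t = n" using t by simp
      then show ?thesis using mem[of n] \<open>n \<noteq> 0\<close> by (simp add: turn_block_upp half_turn_def)
    qed
    have 5: "(vUR, d t) \<in> set vs" if t: "t \<le> n" for t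
    proof (cases t)
      case 0
      then show ?thesis using 2 p(10) by (metis hd_in_set)
    next
      case (Suc s)
      then have s: "s < n" using t by simp
      have "(vUR, d t) \<in> set (step_path (d (Suc s)) (d s))"
        using upper_step(1,2)[OF s] Suc by (metis hd_in_set list.size(3) zero_neq_numeral)
      moreover have "turn_block (spread_curve n b d) (2 * n - t) =
          (if 2 * n - t = n then half_turn vDL (b n) else []) @ step_path (d (Suc s)) (d s)"
        using Suc s by (intro turn_block_upp) auto
      ultimately show ?thesis using mem[of "2 * n - t"] Suc s by simp
    qed
    show ?thesis using 1 2 3 4 5 by blast
  qed
  then show "vs \<noteq> []" "hd vs = (vUR, b 0)" "path_edges vs (hd vs) \<subseteq> nxt_graph" "length vs = 4 * n + 6"
    "t \<le> n \<Longrightarrow> (vDL, b t) \<in> set vs" "t \<le> n \<Longrightarrow> (vUR, d t) \<in> set vs" by auto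
qed

text \<open>Entry \<open>j\<close> has \<open>position\<close> congruent to \<open>j\<close> modulo
  the length, so entries are distinct. The set of entries is closed under \<open>nxt\<close> and
  contains all vertices \<open>vDL\<close> and \<open>vUR\<close> of the two paths, from which the
  other kinds are reached.\<close>

lemma spread_cycle_properties:
  defines "vs \<equiv> oriented_cycle (spread_curve n b d)"
  shows "distinct vs" "set vs = bverts I" "3 \<le> length vs"
    "j < length vs \<Longrightarrow> vs ! (Suc j mod length vs) = nxt I (vs ! j)"
proof -
  note p = spread_pathD[OF P] and cl = convex_low[OF p(1)] and s = spread_cycle[folded vs_def]
  let ?N = "length vs"
  have next_nth: "vs ! (Suc j mod ?N) = nxt I (vs ! j)" if "j < ?N" for j
    using path_edges_cycle[OF that] s(3) by auto
  then show "j < length vs \<Longrightarrow> vs ! (Suc j mod length vs) = nxt I (vs ! j)" .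
  show "3 \<le> ?N" using s(4) by simp
  have h: "vs ! 0 = (vUR, b 0)" using s(1,2) by (simp add: hd_conv_nth)
  have "(vUR, b 0) \<in> bverts I" using p(5,10) imageI[of 0 "{..n}" d] by (simp add: bverts_simps)
  have V: "vs ! j \<in> bverts I \<and> position n c (vs ! j) mod int ?N = int j" if "j < ?N" for j
    using that
  proof (induction j)
    case 0
    have "position n c (vs ! 0) = int ?N" using p(6)[of 0] by (simp add: h position_def s(4))
    then show ?case using h \<open>(vUR, b 0) \<in> bverts I\<close> by simp
  next
    case (Suc j)
    then have j: "vs ! j \<in> bverts I" "position n c (vs ! j) mod int ?N = int j" "vs ! Suc j = nxt I (vs ! j)"
      using next_nth[of j] by auto
    have N: "4 * int n + 6 = int ?N" by (simp add: s(4))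
    have "position n c (vs ! Suc j) mod int ?N = (position n c (vs ! j) + 1) mod int ?N"
      unfolding j(3) using position_nxt[OF j(1)] unfolding N .
    also have "\<dots> = (int j + 1) mod int ?N" using j(2) by (metis mod_add_left_eq)
    also have "\<dots> = int (Suc j)" using Suc.prems by simp
    finally show ?case using nxt_bverts[OF j(1)] j(3) by simp
  qed
  show "distinct vs" unfolding distinct_conv_nth
  proof (intro allI impI)
    fix i j assume ij: "i < ?N" "j < ?N" "i \<noteq> j"
    show "vs ! i \<noteq> vs ! j" using V[OF ij(1)] V[OF ij(2)] ij(3) by (metis of_nat_eq_iff)
  qed
  have closed: "nxt I v \<in> set vs" if v: "v \<in> set vs" for v
  proof -
    obtain j where j: "j < ?N" "v = vs ! j" using v by (metis in_set_conv_nth)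
    have "Suc j mod ?N < ?N" using s(1) by (intro mod_less_divisor) simp
    then show ?thesis using next_nth[OF j(1)] j(2) by (metis nth_mem)
  qed
  have DL: "(vDL, i) \<in> set vs" if "i \<in> low I" for i using that s(5) unfolding p(4) by auto
  have UR: "(vUR, i) \<in> set vs" if "i \<in> upp I" for i using that s(6) unfolding p(5) by auto
  have U: "(vU, i) \<in> set vs" if "i \<in> I" "i + (0,1) \<notin> I" for i
    using closed[OF UR[OF cl(4)[OF that]]] that by (simp add: nxt_simps)
  have D: "(vD, i) \<in> set vs" if "i \<in> I" "i - (0,1) \<notin> I" for i
    using closed[OF DL[OF cl(2)[OF that]]] that by (simp add: nxt_simps)
  \<comment> \<open>A \<open>vL\<close> vertex is entered from the point above it if that lies in
    \<open>I\<close>, and by the turn from \<open>vU\<close> otherwise.\<close>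
  have L: "(vL, i) \<in> set vs" if i: "i \<in> I" "i - (1,0) \<notin> I" for i
  proof (cases "i + (0,1) \<in> I")
    case True
    then have "i + (0,1) \<in> low I" using i by (simp add: low_def shift_minus)
    then show ?thesis using closed[OF DL[of "i + (0,1)"]] i(1) by (simp add: nxt_simps)
  next
    case False
    then show ?thesis using closed[OF U[OF i(1) False]] i(2) by (simp add: nxt_simps)
  qed
  have R: "(vR, i) \<in> set vs" if i: "i \<in> I" "i + (1,0) \<notin> I" for i
  proof (cases "i - (0,1) \<in> I")
    case True
    then have "i - (0,1) \<in> upp I" using i by (simp add: upp_def shift_minus)
    then show ?thesis using closed[OF UR[of "i - (0,1)"]] i(1) by (simp add: nxt_simps)
  next
    case False
    then show ?thesis using closed[OF D[OF i(1) False]] i(2) by (simp add: nxt_simps)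
  qed
  show "set vs = bverts I"
  proof
    show "set vs \<subseteq> bverts I" using V by (metis in_set_conv_nth subsetI)
    show "bverts I \<subseteq> set vs"
    proof
      fix v assume v: "v \<in> bverts I"
      obtain k i where "v = (k, i)" by (cases v)
      then show "v \<in> set vs" using v DL UR U D L R by (cases k) (simp_all add: bverts_simps)
    qed
  qed
qed

end

lemma mat_inverse_invertible:
  fixes T :: "'k::field mat"
  assumes T: "invertible_mat T" and n: "dim_row T = n"
  shows "the (mat_inverse T) \<in> carrier_mat n n" "T * the (mat_inverse T) = 1\<^sub>m n"
    "the (mat_inverse T) * T = 1\<^sub>m n" "T \<in> carrier_mat n n"
proof -
  show Tc: "T \<in> carrier_mat n n" using T n unfolding invertible_mat_def by auto
  obtain B where B: "T * B = 1\<^sub>m (dim_row T)" "B * T = 1\<^sub>m (dim_row B)"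
    using T unfolding invertible_mat_def inverts_mat_def by blast
  have "dim_col (T * B) = n" "dim_col (B * T) = dim_row B" using B n by simp_all
  then have Bc: "B \<in> carrier_mat n n" using Tc by auto
  have "T \<in> Units (ring_mat TYPE('k) n n)"
    unfolding Units_def using Tc Bc B by (auto simp: ring_mat_def intro!: bexI[of _ B])
  then obtain C where C: "mat_inverse T = Some C" using mat_inverse(1)[OF Tc, of n] by (cases "mat_inverse T") auto
  show "the (mat_inverse T) \<in> carrier_mat n n" "T * the (mat_inverse T) = 1\<^sub>m n"
    "the (mat_inverse T) * T = 1\<^sub>m n"
    using mat_inverse(2)[OF Tc C] C by simp_all
qed

section \<open>Equivalent boundary components have isomorphic representations\<close>

lemma runs_Cons:
  assumes "ps \<noteq> []"
  shows "\<exists>t rs. runs ps = (hd ps, t) # rs"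
proof (cases ps)
  case (Cons q qs)
  then show ?thesis by (cases "runs qs") (auto split: prod.split)
qed (use assms in simp)

lemma runs_append:
  assumes "xs \<noteq> []" "ys \<noteq> []" "last xs \<noteq> hd ys"
  shows "runs (xs @ ys) = runs xs @ runs ys"
  using assms
proof (induction xs)
  case (Cons x xs)
  obtain t rs where r: "runs ys = (hd ys, t) # rs" using runs_Cons[OF Cons.prems(2)] by blast
  show ?case
  proof (cases "xs = []")
    case True
    then show ?thesis using Cons.prems r by simp
  next
    case False
    then have IH: "runs (xs @ ys) = runs xs @ runs ys" using Cons by simp
    obtain t' rs' where r': "runs xs = (hd xs, t') # rs'" using runs_Cons[OF False] by blast
    show ?thesis using IH r' by simp
  qed
qed simp

definition run_block :: "((int \<times> int) \<times> nat) list \<Rightarrow> nat \<Rightarrow> vertex list" where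
  "run_block rs m = (let n = length rs; pt = (\<lambda>m. fst (rs ! (m mod n)));
      i = pt m; \<sigma> = side (pt (m + n - 1)) i; \<sigma>' = side i (pt (m + 1))
    in concat (replicate (snd (rs ! m)) (full_turn \<sigma> i)) @
      (if \<sigma>' \<noteq> \<sigma> then half_turn \<sigma> i else []) @ step_path i (pt (m + 1)))"

lemma oriented_cycle_eq:
  "oriented_cycle \<gamma> = (if set \<gamma> \<subseteq> {hd \<gamma>} then concat (replicate (length \<gamma>) (full_turn vUR (hd \<gamma>)))
    else let rs = runs (rotate (LEAST m. hd (rotate m \<gamma>) \<noteq> last (rotate m \<gamma>)) \<gamma>)
      in concat (map (run_block rs) [0..<length rs]))"
  unfolding oriented_cycle_def run_block_def Let_def ..

text \<open>A block depends only on its own run and on the two cyclically adjacent points.\<close>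

lemma run_block_rotate:
  assumes m: "m < length rs"
  shows "run_block (rotate k rs) m = run_block rs ((k + m) mod length rs)"
proof -
  let ?n = "length rs"
  have n: "0 < ?n" using m by linarith
  have nth: "rotate k rs ! (x mod ?n) = rs ! ((k + x) mod ?n)" for x
    using nth_rotate[of "x mod ?n" rs k] n by (simp add: mod_add_right_eq)
  have "(k + m) mod ?n + ?n - 1 = (k + m) mod ?n + (?n - 1)" using n by linarith
  then have "((k + m) mod ?n + ?n - 1) mod ?n = (k + m + (?n - 1)) mod ?n" by (simp only: mod_add_left_eq)
  moreover have "k + m + (?n - 1) = k + (m + ?n - 1)" using n by linarith
  ultimately have 1: "((k + m) mod ?n + ?n - 1) mod ?n = (k + (m + ?n - 1)) mod ?n" by (simp only:)
  have 2: "((k + m) mod ?n + 1) mod ?n = (k + (m + 1)) mod ?n" by (simp add: mod_simps)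
  have 3: "(k + m) mod ?n mod ?n = (k + m) mod ?n" by simp
  have 4: "rotate k rs ! m = rs ! ((k + m) mod ?n)" using nth_rotate[OF m] by simp
  show ?thesis unfolding run_block_def Let_def length_rotate nth 1 2 3 4 ..
qed

lemma concat_rotate: "\<exists>r. concat (rotate k L) = rotate r (concat L)"
proof -
  let ?k = "k mod length L"
  have "concat (rotate k L) = concat (drop ?k L) @ concat (take ?k L)"
    by (simp add: rotate_drop_take)
  also have "\<dots> = rotate (length (concat (take ?k L))) (concat (take ?k L) @ concat (drop ?k L))"
    by (simp add: rotate_append)
  also have "concat (take ?k L) @ concat (drop ?k L) = concat L"
    by (simp add: concat_append[symmetric] del: concat_append)
  finally show ?thesis by blast
qed

lemma run_blocks_rotate:
  "\<exists>r. concat (map (run_block (rotate k rs)) [0..<length (rotate k rs)]) =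
    rotate r (concat (map (run_block rs) [0..<length rs]))"
proof -
  have "map (run_block (rotate k rs)) [0..<length (rotate k rs)] = rotate k (map (run_block rs) [0..<length rs])"
  proof (rule nth_equalityI)
    fix m assume m: "m < length (map (run_block (rotate k rs)) [0..<length (rotate k rs)])"
    then have m: "m < length rs" by simp
    moreover have "(k + m) mod length rs < length rs" using m by (intro mod_less_divisor) linarith
    ultimately show "map (run_block (rotate k rs)) [0..<length (rotate k rs)] ! m =
        rotate k (map (run_block rs) [0..<length rs]) ! m"
      by (simp add: nth_rotate run_block_rotate)
  qed simp
  then show ?thesis using concat_rotate by metis
qed

text \<open>Both assumptions say that the cyclic word is cut between two runs, so the rotation moves
  whole runs.\<close>

lemma runs_rotate:
  assumes a: "hd \<alpha> \<noteq> last \<alpha>" and b: "hd (rotate r \<alpha>) \<noteq> last (rotate r \<alpha>)"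
  shows "\<exists>k. runs (rotate r \<alpha>) = rotate k (runs \<alpha>)"
proof -
  define \<rho> where "\<rho> = r mod length \<alpha>"
  have rot: "rotate r \<alpha> = drop \<rho> \<alpha> @ take \<rho> \<alpha>" by (simp add: rotate_drop_take \<rho>_def)
  show ?thesis
  proof (cases "\<rho> = 0 \<or> \<alpha> = []")
    case True
    then have "rotate r \<alpha> = \<alpha>" using rot by auto
    then show ?thesis by (intro exI[of _ 0]) simp
  next
    case False
    then have lt: "\<rho> < length \<alpha>" by (simp add: \<rho>_def)
    have ne: "take \<rho> \<alpha> \<noteq> []" "drop \<rho> \<alpha> \<noteq> []" using False lt by auto
    have 1: "last (take \<rho> \<alpha>) \<noteq> hd (drop \<rho> \<alpha>)"
      using b ne by (simp add: rot)
    have 2: "last (drop \<rho> \<alpha>) \<noteq> hd (take \<rho> \<alpha>)"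
      using a ne lt False by (simp add: hd_take)
    have "runs \<alpha> = runs (take \<rho> \<alpha>) @ runs (drop \<rho> \<alpha>)"
      using runs_append[OF ne 1] by simp
    moreover have "runs (rotate r \<alpha>) = runs (drop \<rho> \<alpha>) @ runs (take \<rho> \<alpha>)"
      unfolding rot by (rule runs_append[OF ne(2,1) 2])
    ultimately have "runs (rotate r \<alpha>) = rotate (length (runs (take \<rho> \<alpha>))) (runs \<alpha>)"
      by (simp add: rotate_append)
    then show ?thesis by blast
  qed
qed

text \<open>If every rotation began and ended with the same point, consecutive points would coincide
  and the curve would be constant.\<close>

lemma break_exists:
  assumes "\<not> set \<gamma> \<subseteq> {hd \<gamma>}"
  shows "\<exists>m. hd (rotate m \<gamma>) \<noteq> last (rotate m \<gamma>)"
proof (rule ccontr)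
  assume no: "\<nexists>m. hd (rotate m \<gamma>) \<noteq> last (rotate m \<gamma>)"
  have ne: "\<gamma> \<noteq> []" using assms by auto
  have "\<gamma> ! j = hd \<gamma>" if "j < length \<gamma>" for j
    using that
  proof (induction j)
    case 0
    then show ?case using ne by (simp add: hd_conv_nth)
  next
    case (Suc j)
    let ?r = "rotate (Suc j) \<gamma>"
    have "hd ?r = \<gamma> ! Suc j" using Suc.prems ne nth_rotate[of 0 \<gamma> "Suc j"] by (simp add: hd_conv_nth)
    moreover have "last ?r = \<gamma> ! j"
    proof -
      have "last ?r = ?r ! (length \<gamma> - 1)" using ne by (simp add: last_conv_nth)
      also have "\<dots> = \<gamma> ! ((Suc j + (length \<gamma> - 1)) mod length \<gamma>)" using ne by (intro nth_rotate) simp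
      also have "Suc j + (length \<gamma> - 1) = j + length \<gamma>" using ne by (cases \<gamma>) auto
      finally show ?thesis using Suc.prems by simp
    qed
    ultimately have "\<gamma> ! Suc j = \<gamma> ! j" using no by metis
    then show ?case using Suc by simp
  qed
  then have "set \<gamma> \<subseteq> {hd \<gamma>}" by (auto simp: in_set_conv_nth)
  then show False using assms by blast
qed

text \<open>Both cycles are built after rotating to the first cut between runs. The two normalised
  curves differ by a rotation from one such cut to another, which permutes the blocks cyclically; a
  constant curve is fixed by rotation.\<close>

lemma oriented_cycle_rotate: "\<exists>r. oriented_cycle (rotate m \<gamma>) = rotate r (oriented_cycle \<gamma>)"
proof (cases "set \<gamma> \<subseteq> {hd \<gamma>}")
  case True
  have "rotate m \<gamma> = \<gamma>"
  proof (rule nth_equalityI)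
    fix j assume j: "j < length (rotate m \<gamma>)"
    then have j: "j < length \<gamma>" by simp
    have "(m + j) mod length \<gamma> < length \<gamma>" by (intro mod_less_divisor) (use j in linarith)
    then have "\<gamma> ! ((m + j) mod length \<gamma>) \<in> set \<gamma>" "\<gamma> ! j \<in> set \<gamma>" using j by (auto intro: nth_mem)
    then have "\<gamma> ! ((m + j) mod length \<gamma>) = hd \<gamma>" "\<gamma> ! j = hd \<gamma>" using True by blast+
    then have "\<gamma> ! ((m + j) mod length \<gamma>) = \<gamma> ! j" by metis
    then show "rotate m \<gamma> ! j = \<gamma> ! j" using j by (simp add: nth_rotate)
  qed simp
  then show ?thesis by (intro exI[of _ 0]) simp
next
  case False
  have ne: "\<gamma> \<noteq> []" using False by auto
  define a where "a = (LEAST k. hd (rotate k \<gamma>) \<noteq> last (rotate k \<gamma>))"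
  define a' where "a' = (LEAST k. hd (rotate k (rotate m \<gamma>)) \<noteq> last (rotate k (rotate m \<gamma>)))"
  have hd_m: "hd (rotate m \<gamma>) \<in> set \<gamma>" using ne by (metis hd_in_set rotate_is_Nil_conv set_rotate)
  have False': "\<not> set (rotate m \<gamma>) \<subseteq> {hd (rotate m \<gamma>)}"
  proof
    assume "set (rotate m \<gamma>) \<subseteq> {hd (rotate m \<gamma>)}"
    then have "set \<gamma> \<subseteq> {hd (rotate m \<gamma>)}" by simp
    moreover have "hd \<gamma> \<in> set \<gamma>" using ne by simp
    ultimately have "hd \<gamma> = hd (rotate m \<gamma>)" by blast
    then show False using False \<open>set \<gamma> \<subseteq> {hd (rotate m \<gamma>)}\<close> by simp
  qed
  have a: "hd (rotate a \<gamma>) \<noteq> last (rotate a \<gamma>)" unfolding a_def using break_exists[OF False] by (rule LeastI_ex)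
  have a': "hd (rotate a' (rotate m \<gamma>)) \<noteq> last (rotate a' (rotate m \<gamma>))"
    unfolding a'_def using break_exists[OF False'] by (rule LeastI_ex)
  \<comment> \<open>The rotation by \<open>a' + m - a\<close>, made a natural number by adding a
    multiple of the length.\<close>
  define r where "r = a' + m + (length \<gamma> * a - a)"
  have "a \<le> length \<gamma> * a" using ne by (cases \<gamma>) auto
  then have "r + a = a' + m + length \<gamma> * a" unfolding r_def by linarith
  then have "rotate r (rotate a \<gamma>) = rotate (a' + m) \<gamma>"
    by (simp add: rotate_rotate rotate_conv_mod[of "a' + m + length \<gamma> * a"] rotate_conv_mod[of "a' + m"])
  then have eq: "rotate a' (rotate m \<gamma>) = rotate r (rotate a \<gamma>)" by (simp add: rotate_rotate)
  then obtain k where k: "runs (rotate a' (rotate m \<gamma>)) = rotate k (runs (rotate a \<gamma>))"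
    using runs_rotate[OF a, of r] a' by auto
  show ?thesis
    unfolding oriented_cycle_eq[of "rotate m \<gamma>"] oriented_cycle_eq[of \<gamma>] Let_def a_def[symmetric] a'_def[symmetric] k
    using run_blocks_rotate[of k "runs (rotate a \<gamma>)"] False False' by simp
qed

section \<open>Change of basis along a cycle\<close>

lemma bc_rep_simps:
  fixes \<gamma> and T :: "'k::field mat"
  defines "X \<equiv> X_space (oriented_cycle \<gamma>) T" and "A \<equiv> X_map (oriented_cycle \<gamma>) T"
  shows "vsp (bndB (bc_rep (\<gamma>, T))) i = X (vDL, i)" "vsp (bndD (bc_rep (\<gamma>, T))) i = X (vUR, i)"
    "xact (bndB (bc_rep (\<gamma>, T))) i x = A (vD, i) (vDL, i + (1,0)) (A (vDL, i) (vD, i) x)"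
    "yact (bndB (bc_rep (\<gamma>, T))) i x = A (vL, i) (vDL, i + (0,1)) (A (vDL, i) (vL, i) x)"
    "xact (bndD (bc_rep (\<gamma>, T))) i x = A (vU, i + (1,0)) (vUR, i + (1,0)) (A (vUR, i) (vU, i + (1,0)) x)"
    "yact (bndD (bc_rep (\<gamma>, T))) i x = A (vR, i + (0,1)) (vUR, i + (0,1)) (A (vUR, i) (vR, i + (0,1)) x)"
    "bndf (bc_rep (\<gamma>, T)) i x = {y \<in> carrier (X (vDL, i)). \<exists>u\<in>carrier (X (vU, i)).
        A (vU, i) (vUR, i) u = x \<and> A (vDL, i) (vL, i) y = A (vU, i) (vL, i) u}"
    "bndg (bc_rep (\<gamma>, T)) i x = {y \<in> carrier (X (vDL, i)). \<exists>u\<in>carrier (X (vR, i)).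
        A (vR, i) (vUR, i) u = x \<and> A (vDL, i) (vD, i) y = A (vR, i) (vD, i) u}"
  by (simp_all add: bc_rep_def Let_def X_def A_def)

text \<open>A change of basis \<open>G j\<close> on each \<open>V\<^sub>j\<close>, combined with a rotation \<open>\<sigma>\<close> of the cycle, carries the
  edge maps of one representation to those of another.\<close>

locale gauge =
  fixes vs vs' :: "vertex list" and T T' :: "'k::field mat" and m N :: nat
    and \<sigma> :: "nat \<Rightarrow> nat" and G H :: "nat \<Rightarrow> 'k mat"
  assumes len: "length vs = N" "length vs' = N" and dim: "dim_row T = m" "dim_row T' = m"
    and edge: "\<And>j. j < N \<Longrightarrow> edge_mat N T j \<in> carrier_mat m m" "\<And>j. j < N \<Longrightarrow> edge_mat_inv N T j \<in> carrier_mat m m"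
      "\<And>j. j < N \<Longrightarrow> edge_mat N T' j \<in> carrier_mat m m" "\<And>j. j < N \<Longrightarrow> edge_mat_inv N T' j \<in> carrier_mat m m"
    and G: "\<And>j. j < N \<Longrightarrow> G j \<in> carrier_mat m m" "\<And>j. j < N \<Longrightarrow> H j \<in> carrier_mat m m"
      "\<And>j. j < N \<Longrightarrow> G j * H j = 1\<^sub>m m" "\<And>j. j < N \<Longrightarrow> H j * G j = 1\<^sub>m m"
    and \<sigma>: "bij_betw \<sigma> {..<N} {..<N}" "\<And>j. j < N \<Longrightarrow> \<sigma> (Suc j mod N) = Suc (\<sigma> j) mod N"
    and vs': "\<And>j. j < N \<Longrightarrow> vs' ! j = vs ! \<sigma> j"
    and fwd: "\<And>j. j < N \<Longrightarrow> edge_mat N T' j * G j = G (Suc j mod N) * edge_mat N T (\<sigma> j)"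
    and bwd: "\<And>j. j < N \<Longrightarrow> edge_mat_inv N T' j * G (Suc j mod N) = G j * edge_mat_inv N T (\<sigma> j)"
begin

definition \<theta> :: "(nat \<Rightarrow> 'k vec) \<Rightarrow> nat \<Rightarrow> 'k vec" where
  "\<theta> x = (\<lambda>j. if j < N then G j *\<^sub>v x (\<sigma> j) else 0\<^sub>v m)"

lemma \<sigma>_less: "j < N \<Longrightarrow> \<sigma> j < N"
  using bij_betwE[OF \<sigma>(1)] by simp

lemma carrier_X: "x \<in> carrier (X_space vs T v) \<longleftrightarrow> (\<forall>j. x j \<in> carrier_vec m) \<and> (\<forall>j. \<not> (j < N \<and> vs ! j = v) \<longrightarrow> x j = 0\<^sub>v m)"
  "x \<in> carrier (X_space vs' T' v) \<longleftrightarrow> (\<forall>j. x j \<in> carrier_vec m) \<and> (\<forall>j. \<not> (j < N \<and> vs' ! j = v) \<longrightarrow> x j = 0\<^sub>v m)"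
  by (auto simp: X_space_def len dim)

lemma mat_zero: "A \<in> carrier_mat m m \<Longrightarrow> A *\<^sub>v 0\<^sub>v m = 0\<^sub>v m"
  by (rule eq_vecI) (auto simp: scalar_prod_def)

lemma \<theta>_lin_iso: "lin_iso (X_space vs T v) (X_space vs' T' v) \<theta>"
proof -
  define \<tau> where "\<tau> = the_inv_into {..<N} \<sigma>"
  have \<tau>: "\<tau> (\<sigma> j) = j" if "j < N" for j
    using that \<sigma>(1) by (simp add: \<tau>_def bij_betw_def the_inv_into_f_f)
  have \<tau>': "\<tau> k < N" "\<sigma> (\<tau> k) = k" if k: "k < N" for k
  proof -
    have "k \<in> \<sigma> ` {..<N}" using k \<sigma>(1) by (simp add: bij_betw_def)
    then obtain j where "j < N" "k = \<sigma> j" by blast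
    then show "\<tau> k < N" "\<sigma> (\<tau> k) = k" using \<tau> by simp_all
  qed
  have into: "\<theta> x \<in> carrier (X_space vs' T' v)" if x: "x \<in> carrier (X_space vs T v)" for x
    unfolding carrier_X
  proof (intro conjI allI impI)
    note xc = x[unfolded carrier_X]
    fix j
    show "\<theta> x j \<in> carrier_vec m" using G(1) xc by (auto simp: \<theta>_def intro!: mult_mat_vec_carrier)
    assume "\<not> (j < N \<and> vs' ! j = v)"
    then show "\<theta> x j = 0\<^sub>v m" using xc vs'[of j] mat_zero[OF G(1)] by (auto simp: \<theta>_def)
  qed
  have "\<theta> ` carrier (X_space vs T v) = carrier (X_space vs' T' v)"
  proof
    show "\<theta> ` carrier (X_space vs T v) \<subseteq> carrier (X_space vs' T' v)" using into by blast
    show "carrier (X_space vs' T' v) \<subseteq> \<theta> ` carrier (X_space vs T v)"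
    proof
      fix y assume y: "y \<in> carrier (X_space vs' T' v)"
      note yc = y[unfolded carrier_X]
      define x where "x = (\<lambda>k. if k < N then H (\<tau> k) *\<^sub>v y (\<tau> k) else 0\<^sub>v m)"
      have "x \<in> carrier (X_space vs T v)" unfolding carrier_X
      proof (intro conjI allI impI)
        fix k
        show "x k \<in> carrier_vec m" using G(2) \<tau>' yc by (auto simp: x_def intro!: mult_mat_vec_carrier)
        assume "\<not> (k < N \<and> vs ! k = v)"
        then show "x k = 0\<^sub>v m" using yc vs'[of "\<tau> k"] \<tau>' mat_zero[OF G(2)] by (auto simp: x_def)
      qed
      moreover have "\<theta> x = y"
      proof
        fix j
        show "\<theta> x j = y j"
        proof (cases "j < N")
          case True
          have yj: "y j \<in> carrier_vec m" using yc by blast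
          have "\<theta> x j = G j *\<^sub>v (H j *\<^sub>v y j)" using True \<sigma>_less[OF True] \<tau>[OF True] by (simp add: \<theta>_def x_def)
          also have "\<dots> = (G j * H j) *\<^sub>v y j" using G(1,2)[OF True] yj by (simp add: assoc_mult_mat_vec)
          finally show ?thesis using G(3)[OF True] yj by simp
        next
          case False
          then show ?thesis using yc by (simp add: \<theta>_def)
        qed
      qed
      ultimately show "y \<in> \<theta> ` carrier (X_space vs T v)" by blast
    qed
  qed
  moreover have "inj_on \<theta> (carrier (X_space vs T v))"
  proof (rule inj_onI)
    fix x y assume x: "x \<in> carrier (X_space vs T v)" and y: "y \<in> carrier (X_space vs T v)" and eq: "\<theta> x = \<theta> y"
    note xc = x[unfolded carrier_X] and yc = y[unfolded carrier_X]
    show "x = y"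
    proof
      fix k show "x k = y k"
      proof (cases "k < N")
        case True
        define j where "j = \<tau> k"
        have j: "j < N" "\<sigma> j = k" using \<tau>'[OF True] by (simp_all add: j_def)
        have c: "x k \<in> carrier_vec m" "y k \<in> carrier_vec m" using xc yc by blast+
        have "G j *\<^sub>v x k = G j *\<^sub>v y k" using fun_cong[OF eq, of j] j by (simp add: \<theta>_def)
        then have "H j *\<^sub>v (G j *\<^sub>v x k) = H j *\<^sub>v (G j *\<^sub>v y k)" by simp
        then have "(H j * G j) *\<^sub>v x k = (H j * G j) *\<^sub>v y k"
          using G(1,2)[OF j(1)] c by (simp add: assoc_mult_mat_vec)
        then show ?thesis using G(4)[OF j(1)] c by simp
      next
        case False
        then show ?thesis using xc yc by simp
      qed
    qed
  qed
  moreover have "\<theta> (\<lambda>j. x j + y j) = (\<lambda>j. \<theta> x j + \<theta> y j)"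
    if "x \<in> carrier (X_space vs T v)" "y \<in> carrier (X_space vs T v)" for x y
    using that[unfolded carrier_X] G(1) by (auto simp: \<theta>_def fun_eq_iff intro!: mult_add_distrib_mat_vec[OF G(1)])
  moreover have "\<theta> (\<lambda>j. c \<cdot>\<^sub>v x j) = (\<lambda>j. c \<cdot>\<^sub>v \<theta> x j)" if "x \<in> carrier (X_space vs T v)" for x c
    using that[unfolded carrier_X] G(1) by (auto simp: \<theta>_def fun_eq_iff intro!: mult_mat_vec[OF G(1)])
  moreover have "\<theta> (\<lambda>j. 0\<^sub>v m) = (\<lambda>j. 0\<^sub>v m)" using mat_zero[OF G(1)] by (auto simp: \<theta>_def fun_eq_iff)
  ultimately show ?thesis unfolding lin_iso_def lin_surj_def by (simp add: X_space_def dim)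
qed

lemma X_map_carrier:
  assumes "\<And>j. x j \<in> carrier_vec m"
  shows "X_map vs T s t x \<in> carrier (X_space vs T t)"
  unfolding carrier_X X_map_def Let_def len dim
proof (intro conjI allI impI)
  fix j
  show "(if j < N \<and> vs ! j = t
      then (if vs ! ((j + N - 1) mod N) = s then edge_mat N T ((j + N - 1) mod N) *\<^sub>v x ((j + N - 1) mod N) else 0\<^sub>v m) +
        (if vs ! ((j + 1) mod N) = s then edge_mat_inv N T j *\<^sub>v x ((j + 1) mod N) else 0\<^sub>v m)
      else 0\<^sub>v m) \<in> carrier_vec m"
    using assms edge(1,2) by (auto intro!: add_carrier_vec mult_mat_vec_carrier)
qed auto

text \<open>The contribution of the incoming edge transforms by \<open>fwd\<close>, that of the
  outgoing edge, traversed backwards, by \<open>bwd\<close>.\<close>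

lemma \<theta>_X_map:
  assumes x: "\<And>j. x j \<in> carrier_vec m"
  shows "\<theta> (X_map vs T s t x) = X_map vs' T' s t (\<theta> x)"
proof
  fix j
  show "\<theta> (X_map vs T s t x) j = X_map vs' T' s t (\<theta> x) j"
  proof (cases "j < N")
    case False
    then show ?thesis by (simp add: \<theta>_def X_map_def Let_def len dim)
  next
    case True
    let ?p = "(j + N - 1) mod N" and ?q = "(j + 1) mod N" and ?k = "\<sigma> j"
    have pq: "?p < N" "?q < N" using True by simp_all
    have sp: "Suc ?p mod N = j"
    proof -
      have "Suc ?p mod N = (j + N - 1 + 1) mod N" using mod_add_left_eq[of "j + N - 1" N 1] by simp
      then show ?thesis using True by simp
    qed
    have k: "?k < N" by (rule \<sigma>_less[OF True])
    have k1: "Suc (\<sigma> ?p) mod N = ?k" using \<sigma>(2)[OF pq(1)] sp by simp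
    \<comment> \<open>As \<open>\<sigma>\<close> commutes with the cyclic successor, it commutes
      with the predecessor.\<close>
    have "(?k + N - 1) mod N = \<sigma> ?p"
    proof -
      have l: "\<sigma> ?p < N" by (rule \<sigma>_less[OF pq(1)])
      show ?thesis
      proof (cases "Suc (\<sigma> ?p) = N")
        case True
        then show ?thesis using k1[symmetric] l by simp
      next
        case False
        then have "?k = Suc (\<sigma> ?p)" using k1[symmetric] l by simp
        then show ?thesis using l by simp
      qed
    qed
    moreover have "(?k + 1) mod N = \<sigma> ?q" using \<sigma>(2)[OF True] by simp
    ultimately have lhs: "\<theta> (X_map vs T s t x) j = G j *\<^sub>v (if vs ! ?k = t then
        (if vs ! \<sigma> ?p = s then edge_mat N T (\<sigma> ?p) *\<^sub>v x (\<sigma> ?p) else 0\<^sub>v m) +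
        (if vs ! \<sigma> ?q = s then edge_mat_inv N T ?k *\<^sub>v x (\<sigma> ?q) else 0\<^sub>v m) else 0\<^sub>v m)"
      using True k unfolding \<theta>_def X_map_def Let_def len dim by simp
    have rhs: "X_map vs' T' s t (\<theta> x) j = (if vs ! ?k = t then
        (if vs ! \<sigma> ?p = s then edge_mat N T' ?p *\<^sub>v (G ?p *\<^sub>v x (\<sigma> ?p)) else 0\<^sub>v m) +
        (if vs ! \<sigma> ?q = s then edge_mat_inv N T' j *\<^sub>v (G ?q *\<^sub>v x (\<sigma> ?q)) else 0\<^sub>v m) else 0\<^sub>v m)"
      using True pq unfolding \<theta>_def X_map_def Let_def len dim by (simp add: vs')
    note ec = edge(1)[OF \<sigma>_less[OF pq(1)]] edge(2)[OF k] edge(3)[OF pq(1)] edge(4)[OF True]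
      G(1)[OF True] G(1)[OF pq(1)] G(1)[OF pq(2)]
    have 1: "edge_mat N T' ?p *\<^sub>v (G ?p *\<^sub>v x (\<sigma> ?p)) = G j *\<^sub>v (edge_mat N T (\<sigma> ?p) *\<^sub>v x (\<sigma> ?p))"
    proof -
      have "edge_mat N T' ?p *\<^sub>v (G ?p *\<^sub>v x (\<sigma> ?p)) = (edge_mat N T' ?p * G ?p) *\<^sub>v x (\<sigma> ?p)"
        using assoc_mult_mat_vec[OF ec(3,6) x] by simp
      also have "\<dots> = (G j * edge_mat N T (\<sigma> ?p)) *\<^sub>v x (\<sigma> ?p)" using fwd[OF pq(1)] unfolding sp by simp
      also have "\<dots> = G j *\<^sub>v (edge_mat N T (\<sigma> ?p) *\<^sub>v x (\<sigma> ?p))" by (rule assoc_mult_mat_vec[OF ec(5,1) x])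
      finally show ?thesis .
    qed
    have 2: "edge_mat_inv N T' j *\<^sub>v (G ?q *\<^sub>v x (\<sigma> ?q)) = G j *\<^sub>v (edge_mat_inv N T ?k *\<^sub>v x (\<sigma> ?q))"
    proof -
      have "edge_mat_inv N T' j *\<^sub>v (G ?q *\<^sub>v x (\<sigma> ?q)) = (edge_mat_inv N T' j * G ?q) *\<^sub>v x (\<sigma> ?q)"
        using assoc_mult_mat_vec[OF ec(4,7) x] by simp
      also have "\<dots> = (G j * edge_mat_inv N T ?k) *\<^sub>v x (\<sigma> ?q)" using bwd[OF True] by simp
      also have "\<dots> = G j *\<^sub>v (edge_mat_inv N T ?k *\<^sub>v x (\<sigma> ?q))" by (rule assoc_mult_mat_vec[OF ec(5,2) x])
      finally show ?thesis .
    qed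
    have c: "edge_mat N T (\<sigma> ?p) *\<^sub>v x (\<sigma> ?p) \<in> carrier_vec m" "edge_mat_inv N T ?k *\<^sub>v x (\<sigma> ?q) \<in> carrier_vec m"
      using ec(1,2) x by (auto intro: mult_mat_vec_carrier)
    have z: "G j *\<^sub>v 0\<^sub>v m = 0\<^sub>v m" by (rule mat_zero[OF ec(5)])
    show ?thesis unfolding lhs rhs 1 2
      using c z mult_add_distrib_mat_vec[OF ec(5)] by auto
  qed
qed

text \<open>The structure maps are given through lifts \<open>u\<close> to \<open>vU\<close> or
  \<open>vR\<close>, and \<open>\<theta>\<close> matches the lifts on the two sides
  bijectively.\<close>

lemma bc_rep_bij:
  assumes "vs = oriented_cycle \<gamma>" "vs' = oriented_cycle \<gamma>'"
  shows "bnd_bij (bc_rep (\<gamma>, T)) (bc_rep (\<gamma>', T')) (\<lambda>i. \<theta>) (\<lambda>i. \<theta>)"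
proof -
  let ?X = "X_space vs T" and ?X' = "X_space vs' T'" and ?A = "X_map vs T" and ?A' = "X_map vs' T'"
  let ?P = "bc_rep (\<gamma>, T)" and ?Q = "bc_rep (\<gamma>', T')"
  note P = bc_rep_simps[of \<gamma> T, folded assms(1)] and Q = bc_rep_simps[of \<gamma>' T', folded assms(2)]
  have cv: "x j \<in> carrier_vec m" if "x \<in> carrier (?X v)" for x v j using that unfolding carrier_X by blast
  have th: "\<theta> (?A s t x) = ?A' s t (\<theta> x)" if "x \<in> carrier (?X v)" for s t x v by (rule \<theta>_X_map[OF cv[OF that]])
  have A: "?A s t x \<in> carrier (?X t)" if "x \<in> carrier (?X v)" for s t x v by (rule X_map_carrier[OF cv[OF that]])
  have th2: "\<theta> (?A s' t' (?A s t x)) = ?A' s' t' (?A' s t (\<theta> x))" if "x \<in> carrier (?X v)" for s t s' t' x v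
    using th[OF A[OF that]] th[OF that] by simp
  have im: "\<theta> ` carrier (?X v) = carrier (?X' v)" for v by (rule lin_surjD(1)[OF lin_isoD(1)[OF \<theta>_lin_iso]])
  have inj: "\<theta> x = \<theta> y \<longleftrightarrow> x = y" if "x \<in> carrier (?X v)" "y \<in> carrier (?X v)" for x y v
    using inj_onD[OF lin_isoD(2)[OF \<theta>_lin_iso]] that by blast
  have vals: "{y \<in> carrier (?X' (vDL, i)). \<exists>u\<in>carrier (?X' s). ?A' s (vUR, i) u = \<theta> x \<and> ?A' (vDL, i) t y = ?A' s t u} =
      \<theta> ` {y \<in> carrier (?X (vDL, i)). \<exists>u\<in>carrier (?X s). ?A s (vUR, i) u = x \<and> ?A (vDL, i) t y = ?A s t u}"
    (is "?S' = \<theta> ` ?S")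
    if x: "x \<in> carrier (?X (vUR, i))" for i s t x
  proof (rule Set.set_eqI, rule iffI)
    fix y' assume "y' \<in> ?S'"
    then have y'c: "y' \<in> \<theta> ` carrier (?X (vDL, i))"
      and "\<exists>u\<in>\<theta> ` carrier (?X s). ?A' s (vUR, i) u = \<theta> x \<and> ?A' (vDL, i) t y' = ?A' s t u"
      unfolding im by blast+
    then obtain u where u: "u \<in> carrier (?X s)" "?A' s (vUR, i) (\<theta> u) = \<theta> x" "?A' (vDL, i) t y' = ?A' s t (\<theta> u)" by blast
    obtain y where y: "y \<in> carrier (?X (vDL, i))" "y' = \<theta> y" using y'c by blast
    have "?A s (vUR, i) u = x" using u(2) inj[OF A[OF u(1)] x] th[OF u(1)] by simp
    moreover have "?A (vDL, i) t y = ?A s t u"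
      using u(3) inj[OF A[OF y(1)] A[OF u(1)]] th[OF u(1)] th[OF y(1)] y(2) by simp
    ultimately show "y' \<in> \<theta> ` ?S" using y u(1) by blast
  next
    fix y' assume "y' \<in> \<theta> ` ?S"
    then obtain y u where y: "y \<in> carrier (?X (vDL, i))" "y' = \<theta> y"
      and u: "u \<in> carrier (?X s)" "?A s (vUR, i) u = x" "?A (vDL, i) t y = ?A s t u" by blast
    have "\<theta> u \<in> carrier (?X' s)" "y' \<in> carrier (?X' (vDL, i))" using y u(1) im by blast+
    moreover have "?A' s (vUR, i) (\<theta> u) = \<theta> x" using th[OF u(1)] u(2) by metis
    moreover have "?A' (vDL, i) t y' = ?A' s t (\<theta> u)" using th[OF u(1)] th[OF y(1)] u(3) y(2) by metis
    ultimately show "y' \<in> ?S'" by blast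
  qed
  have B: "rep_bij (bndB ?P) (bndB ?Q) (\<lambda>i. \<theta>)"
    unfolding rep_bij_def P Q by (intro conjI allI ballI \<theta>_lin_iso) (erule th2)+
  have D: "rep_bij (bndD ?P) (bndD ?Q) (\<lambda>i. \<theta>)"
    unfolding rep_bij_def P Q by (intro conjI allI ballI \<theta>_lin_iso) (erule th2)+
  have "kery (bndD ?P) i \<subseteq> carrier (?X (vUR, i))" "kerx (bndD ?P) i \<subseteq> carrier (?X (vUR, i))" for i
    unfolding kery_def kerx_def P by blast+
  then show ?thesis unfolding bnd_bij_def using B D vals unfolding P(7,8) Q(7,8) by (simp add: subset_iff)
qed

end

lemma bc_equiv_bij:
  fixes c c' :: "curve \<times> 'k::field mat"
  assumes T: "invertible_mat (snd c)" and T': "invertible_mat (snd c')" and eq: "bc_equiv c c'"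
  shows "\<exists>\<phi> \<psi>. bnd_bij (bc_rep c) (bc_rep c') \<phi> \<psi>"
proof -
  obtain \<gamma> T where c: "c = (\<gamma>, T)" by (cases c)
  obtain \<gamma>' T' where c': "c' = (\<gamma>', T')" by (cases c')
  define vs where "vs = oriented_cycle \<gamma>"
  define vs' where "vs' = oriented_cycle \<gamma>'"
  obtain r0 where r0: "vs' = rotate r0 vs"
    using eq oriented_cycle_rotate unfolding bc_equiv_def rotationally_equivalent_def c c' vs_def vs'_def by auto
  define N where "N = length vs"
  define r where "r = r0 mod N"
  have vs': "vs' = rotate r vs" by (simp add: r0 r_def N_def rotate_conv_mod[of r0])
  define m where "m = dim_row T"
  obtain P Q where sim: "similar_mat_wit T T' P Q" using eq unfolding bc_equiv_def similar_mat_def c c' by auto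
  note w = similar_mat_witD[OF m_def sim]
  define Ti where "Ti = the (mat_inverse T)"
  define Ti' where "Ti' = the (mat_inverse T')"
  have dT': "dim_row T' = m" using w(5) by auto
  note t = mat_inverse_invertible[OF assms(1)[unfolded c snd_conv] m_def[symmetric], folded Ti_def]
  note t' = mat_inverse_invertible[OF assms(2)[unfolded c' snd_conv] dT', folded Ti'_def]
  have PQ: "P \<in> carrier_mat m m" "Q \<in> carrier_mat m m" "P * Q = 1\<^sub>m m" "Q * P = 1\<^sub>m m" "T = P * T' * Q"
    using w by auto
  have T'Q: "T' * Q = Q * T"
  proof -
    have "Q * T = Q * (P * (T' * Q))"
      unfolding PQ(5) using PQ(1,2) t'(4) by (simp add: assoc_mult_mat[of _ m m _ m _ m])
    also have "\<dots> = (Q * P) * (T' * Q)" using PQ(1,2) t'(4) by (simp add: assoc_mult_mat[of _ m m _ m _ m])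
    also have "\<dots> = T' * Q" unfolding PQ(4) using PQ(2) t'(4) by simp
    finally show ?thesis by simp
  qed
  \<comment> \<open>After the rotation \<open>T\<close> sits on edge \<open>N - r - 1\<close>, while
    \<open>T'\<close> sits on the last edge. \<open>Q\<close> conjugates one into the other, and the
    factor \<open>Ti\<close> at the vertices beyond edge \<open>N - r - 1\<close> cancels
    \<open>T\<close> there and moves it to the end.\<close>
  define G where "G j = (if j < N - r then Q else Q * Ti)" for j
  define H where "H j = (if j < N - r then P else T * P)" for j
  define \<sigma> where "\<sigma> j = (r + j) mod N" for j
  have E: "edge_mat N T j = (if j = N - 1 then T else 1\<^sub>m m)" "edge_mat N T' j = (if j = N - 1 then T' else 1\<^sub>m m)"
    "edge_mat_inv N T j = (if j = N - 1 then Ti else 1\<^sub>m m)" "edge_mat_inv N T' j = (if j = N - 1 then Ti' else 1\<^sub>m m)" for j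
    by (simp_all add: edge_mat_def edge_mat_inv_def m_def[symmetric] dT' Ti_def Ti'_def)
  note ca = assoc_mult_mat[of _ m m _ m _ m]
  have Ec: "edge_mat N T j \<in> carrier_mat m m" "edge_mat_inv N T j \<in> carrier_mat m m"
    "edge_mat N T' j \<in> carrier_mat m m" "edge_mat_inv N T' j \<in> carrier_mat m m"
    "edge_mat N T j * edge_mat_inv N T j = 1\<^sub>m m" "edge_mat_inv N T' j * edge_mat N T' j = 1\<^sub>m m" for j
    unfolding E using t t' by auto
  have Gc: "G j \<in> carrier_mat m m" "H j \<in> carrier_mat m m" for j unfolding G_def H_def using PQ t by auto
  have QTiTP: "Q * Ti * (T * P) = 1\<^sub>m m"
  proof -
    have "Q * Ti * (T * P) = Q * ((Ti * T) * P)" using PQ(1,2) t(1,4) by (simp add: ca)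
    also have "\<dots> = Q * P" unfolding t(3) using PQ(1) by simp
    finally show ?thesis using PQ(4) by simp
  qed
  have TPQTi: "T * P * (Q * Ti) = 1\<^sub>m m"
  proof -
    have "T * P * (Q * Ti) = T * ((P * Q) * Ti)" using PQ(1,2) t(1,4) by (simp add: ca)
    also have "\<dots> = T * Ti" unfolding PQ(3) using t(1) by simp
    finally show ?thesis using t(2) by simp
  qed
  have GH: "G j * H j = 1\<^sub>m m" "H j * G j = 1\<^sub>m m" for j unfolding G_def H_def using PQ QTiTP TPQTi by auto
  have T'QTi: "T' * (Q * Ti) = Q"
  proof -
    have "T' * (Q * Ti) = (T' * Q) * Ti" using PQ(2) t(1) t'(4) by (simp add: ca)
    also have "\<dots> = Q * (T * Ti)" unfolding T'Q using PQ(2) t(1,4) by (simp add: ca)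
    also have "\<dots> = Q" unfolding t(2) using PQ(2) by simp
    finally show ?thesis .
  qed
  have QTiT: "Q * Ti * T = Q"
  proof -
    have "Q * Ti * T = Q * (Ti * T)" using PQ(2) t(1,4) by (simp add: ca)
    then show ?thesis unfolding t(3) using PQ(2) by simp
  qed
  have fwd: "edge_mat N T' j * G j = G (Suc j mod N) * edge_mat N T (\<sigma> j)" if j: "j < N" for j
  proof -
    have r: "r < N" using j by (simp add: r_def)
    show ?thesis
    proof (cases "j = N - 1")
      case True
      have s: "Suc j mod N = 0" using True j by simp
      show ?thesis
      proof (cases "r = 0")
        case True
        then have "\<sigma> j = N - 1" using \<open>j = N - 1\<close> j by (simp add: \<sigma>_def)
        then show ?thesis using T'Q True \<open>j = N - 1\<close> j s by (simp add: E G_def)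
      next
        case False
        then have "r + j = (r - 1) + N" using \<open>j = N - 1\<close> j by simp
        then have "\<sigma> j = (r - 1 + N) mod N" unfolding \<sigma>_def by (rule arg_cong)
        then have "\<sigma> j = r - 1" unfolding mod_add_self2 using r by simp
        then have "\<sigma> j \<noteq> N - 1" using r False by simp
        moreover have "\<not> j < N - r" using \<open>j = N - 1\<close> j False by simp
        ultimately show ?thesis using T'QTi PQ(1-4) \<open>j = N - 1\<close> s r by (simp add: E G_def)
      qed
    next
      case False
      then have s: "Suc j mod N = Suc j" using j by simp
      consider "Suc j < N - r" | "Suc j = N - r" | "N - r \<le> j" by linarith
      then show ?thesis
      proof cases
        case 1
        then have "\<sigma> j = r + j" "r + j \<noteq> N - 1" by (simp_all add: \<sigma>_def)
        then show ?thesis using 1 False PQ(1-4) by (simp add: E G_def s)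
      next
        case 2
        then have "\<sigma> j = N - 1" using r by (simp add: \<sigma>_def)
        moreover have "\<not> Suc j < N - r" "j < N - r" using 2 by simp_all
        ultimately show ?thesis using False PQ(1-4) QTiT by (simp add: E G_def s)
      next
        case 3
        then have "r + j = (r + j - N) + N" by simp
        then have "\<sigma> j = (r + j - N) mod N" unfolding \<sigma>_def by (metis mod_add_self2)
        moreover have "r + j - N < N - 1" using r j False 3 by linarith
        ultimately have "\<sigma> j \<noteq> N - 1" by simp
        moreover have "\<not> Suc j < N - r" "\<not> j < N - r" using 3 by simp_all
        ultimately show ?thesis using False PQ(1-4) t by (simp add: E G_def s)
      qed
    qed
  qed
  have bwd: "edge_mat_inv N T' j * G (Suc j mod N) = G j * edge_mat_inv N T (\<sigma> j)" if j: "j < N" for j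
  proof -
    let ?G = "G (Suc j mod N)" and ?E = "edge_mat N T (\<sigma> j)" and ?Ei = "edge_mat_inv N T (\<sigma> j)"
      and ?E' = "edge_mat N T' j" and ?Ei' = "edge_mat_inv N T' j"
    \<comment> \<open>Obtained from \<open>fwd\<close> by multiplying with the inverse edge matrices
      on either side.\<close>
    have "?Ei' * ?G = ?Ei' * (?G * (?E * ?Ei))"
      unfolding Ec(5) right_mult_one_mat[OF Gc(1)] ..
    also have "\<dots> = ?Ei' * ((?G * ?E) * ?Ei)" using Ec(1,2) Gc(1) by (simp add: ca)
    also have "\<dots> = ?Ei' * ((?E' * G j) * ?Ei)" using fwd[OF j] by simp
    also have "\<dots> = (?Ei' * ?E') * (G j * ?Ei)" 
      unfolding ca[OF Ec(3) Gc(1) Ec(2)] ca[OF Ec(4) Ec(3) mult_carrier_mat[OF Gc(1) Ec(2)]] ..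
    also have "\<dots> = G j * ?Ei"
      unfolding Ec(6) by (rule left_mult_one_mat[OF mult_carrier_mat[OF Gc(1) Ec(2)]])
    finally show ?thesis .
  qed
  have \<sigma>1: "\<sigma> (Suc j mod N) = Suc (\<sigma> j) mod N" for j
  proof -
    have "(r + Suc j mod N) mod N = (r + Suc j) mod N" by (rule mod_add_right_eq)
    moreover have "Suc ((r + j) mod N) mod N = Suc (r + j) mod N" by (rule mod_Suc_eq)
    ultimately show ?thesis unfolding \<sigma>_def by simp
  qed
  have \<sigma>2: "bij_betw \<sigma> {..<N} {..<N}"
  proof -
    have "inj_on \<sigma> {..<N}"
    proof (rule inj_onI)
      fix x y assume x: "x \<in> {..<N}" and y: "y \<in> {..<N}" and "\<sigma> x = \<sigma> y"
      then have eq: "(r + x) mod N = (r + y) mod N" by (simp add: \<sigma>_def)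
      have r: "r < N" using x by (simp add: r_def)
      have "(r + z) mod N = (if r + z < N then r + z else r + z - N)" if "z < N" for z
        using that r by (auto simp: mod_if[of "r + z"])
      then show "x = y" using eq x y by (auto split: if_splits)
    qed
    moreover have "\<sigma> ` {..<N} \<subseteq> {..<N}" by (auto simp: \<sigma>_def)
    ultimately show ?thesis unfolding bij_betw_def using endo_inj_surj by blast
  qed
  have "gauge vs vs' T T' m N \<sigma> G H"
    by unfold_locales
      (use Ec Gc GH fwd bwd \<sigma>1 \<sigma>2 dT' in \<open>auto simp: N_def vs' m_def nth_rotate \<sigma>_def\<close>)
  then show ?thesis unfolding c c' using gauge.bc_rep_bij vs_def vs'_def by blast
qed

section \<open>The boundary of a finite spread is a boundary component representation\<close>

lemma invertible_one_mat: "invertible_mat (1\<^sub>m n)"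
  unfolding invertible_mat_def inverts_mat_def by (auto intro!: exI[of _ "1\<^sub>m n"])

lemma mat_inverse_one: "the (mat_inverse (1\<^sub>m n :: 'k::field mat)) = 1\<^sub>m n"
proof -
  have d: "dim_row (1\<^sub>m n :: 'k mat) = n" by simp
  note m = mat_inverse_invertible[OF invertible_one_mat d]
  show ?thesis using m(2) unfolding left_mult_one_mat[OF m(1)] .
qed

text \<open>On a cycle without repeated vertices the space at a vertex of the cycle is a line, and
  this is its element with scalar \<open>a\<close>; off the cycle it is zero whatever
  \<open>a\<close> is.\<close>

definition vertex_elem :: "vertex list \<Rightarrow> vertex \<Rightarrow> 'k::field \<Rightarrow> nat \<Rightarrow> 'k vec" where
  "vertex_elem vs v a = (\<lambda>j. if j < length vs \<and> vs ! j = v then vec 1 (\<lambda>_. a) else 0\<^sub>v 1)"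

lemma vertex_elem_notin: "v \<notin> set vs \<Longrightarrow> vertex_elem vs v a = vertex_elem vs v b"
  by (auto simp: vertex_elem_def fun_eq_iff)

lemma vertex_elem_eq_iff: "v \<in> set vs \<Longrightarrow> vertex_elem vs v a = vertex_elem vs v b \<longleftrightarrow> a = b"
proof
  assume "v \<in> set vs" and eq: "vertex_elem vs v a = vertex_elem vs v b"
  then obtain j where "j < length vs" "vs ! j = v" unfolding in_set_conv_nth by blast
  then have "vec 1 (\<lambda>_. a) = vec 1 (\<lambda>_. b)" using fun_cong[OF eq, of j] by (simp add: vertex_elem_def)
  then have "vec 1 (\<lambda>_. a) $ 0 = vec 1 (\<lambda>_. b) $ 0" by (rule arg_cong)
  then show "a = b" by simp
qed simp

lemma X_space_carrier:
  assumes "distinct vs"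
  shows "carrier (X_space vs (1\<^sub>m 1 :: 'k::field mat) v) = range (vertex_elem vs v)"
proof
  show "range (vertex_elem vs v) \<subseteq> carrier (X_space vs (1\<^sub>m 1 :: 'k mat) v)"
    by (auto simp: X_space_def vertex_elem_def)
  show "carrier (X_space vs (1\<^sub>m 1 :: 'k mat) v) \<subseteq> range (vertex_elem vs v)"
  proof
    fix x assume "x \<in> carrier (X_space vs (1\<^sub>m 1 :: 'k mat) v)"
    then have x: "\<And>j. x j \<in> carrier_vec 1" "\<And>j. \<not> (j < length vs \<and> vs ! j = v) \<Longrightarrow> x j = 0\<^sub>v 1"
      by (simp_all add: X_space_def)
    show "x \<in> range (vertex_elem vs v)"
    proof (cases "v \<in> set vs")
      case True
      then obtain j where j: "j < length vs" "vs ! j = v" unfolding in_set_conv_nth by blast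
      have "x = vertex_elem vs v (x j $ 0)"
      proof
        fix i show "x i = vertex_elem vs v (x j $ 0) i"
        proof (cases "i < length vs \<and> vs ! i = v")
          case True
          then have "i = j" using j assms nth_eq_iff_index_eq by blast
          then show ?thesis using j x(1)[of j] by (auto simp: vertex_elem_def)
        qed (auto simp: vertex_elem_def x(2))
      qed
      then show ?thesis by blast
    next
      case False
      then have "x j = vertex_elem vs v 0 j" for j using x(2)[of j] by (auto simp: vertex_elem_def)
      then have "x = vertex_elem vs v 0" by blast
      then show ?thesis by blast
    qed
  qed
qed

lemma lin_iso_vertex_elem:
  fixes vs :: "vertex list"
  assumes d: "distinct vs" and B: "i \<in> B \<longleftrightarrow> v \<in> set vs"
  shows "lin_iso (vsp (spread_rep B :: ('k::field, 'k) rep) i) (X_space vs (1\<^sub>m 1) v) (vertex_elem vs v)"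
proof -
  have "vertex_elem vs v ` carrier (vsp (spread_rep B :: ('k, 'k) rep) i) = range (vertex_elem vs v)"
    using vertex_elem_notin[of v vs _ 0] B by (auto simp: spread_rep_simps)
  moreover have "vertex_elem vs v (a + b) = (\<lambda>j. vertex_elem vs v a j + vertex_elem vs v b j)" for a b :: 'k
    by (auto simp: vertex_elem_def fun_eq_iff)
  moreover have "vertex_elem vs v (c * a) = (\<lambda>j. c \<cdot>\<^sub>v vertex_elem vs v a j)" for c a :: 'k
    by (auto simp: vertex_elem_def fun_eq_iff)
  moreover have "vertex_elem vs v 0 = (\<lambda>j. 0\<^sub>v 1 :: 'k vec)"
    by (auto simp: vertex_elem_def fun_eq_iff)
  moreover have "inj_on (vertex_elem vs v) (carrier (vsp (spread_rep B :: ('k, 'k) rep) i))"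
    using B by (auto simp: inj_on_def spread_rep_simps vertex_elem_eq_iff)
  ultimately show ?thesis unfolding lin_iso_def lin_surj_def X_space_carrier[OF d]
    by (simp add: spread_rep_simps(2-4) X_space_def)
qed

lemma cyclic_index:
  fixes n j :: nat
  assumes "3 \<le> n" "j < n"
  shows "(j + n - 1) mod n < n" "(j + 1) mod n < n" "(j + n - 1) mod n \<noteq> (j + 1) mod n"
    "Suc ((j + n - 1) mod n) mod n = j" "k < n \<Longrightarrow> Suc k mod n = j \<Longrightarrow> k = (j + n - 1) mod n"
proof -
  have p: "(j + n - 1) mod n = (if j = 0 then n - 1 else j - 1)"
  proof (cases j)
    case (Suc l)
    then have "j + n - 1 = l + n" by simp
    then show ?thesis using Suc assms by simp
  qed (use assms in simp)
  have q: "(j + 1) mod n = (if Suc j = n then 0 else j + 1)" using assms by auto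
  show "(j + n - 1) mod n < n" "(j + 1) mod n < n" "(j + n - 1) mod n \<noteq> (j + 1) mod n"
    "Suc ((j + n - 1) mod n) mod n = j"
    using assms unfolding p q by auto
  show "k < n \<Longrightarrow> Suc k mod n = j \<Longrightarrow> k = (j + n - 1) mod n"
    using assms unfolding p by (cases "Suc k = n") auto
qed

text \<open>Length at least three keeps the predecessor and the successor of a vertex apart, so
  exactly one of the two contributions survives; in a cycle of length two both would, and the scalar
  would be doubled.\<close>

lemma X_map_vertex_elem:
  fixes vs :: "vertex list"
  assumes d: "distinct vs" and n: "3 \<le> length vs"
    and adj: "s \<in> set vs \<Longrightarrow> t \<in> set vs \<Longrightarrow> \<exists>j<length vs. (vs ! j = s \<and> vs ! (Suc j mod length vs) = t) \<or>
      (vs ! j = t \<and> vs ! (Suc j mod length vs) = s)"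
  shows "X_map vs (1\<^sub>m 1 :: 'k::field mat) s t (vertex_elem vs s a) = vertex_elem vs t (if s \<in> set vs then a else 0)"
proof
  fix j
  let ?n = "length vs" and ?p = "(j + length vs - 1) mod length vs" and ?q = "(j + 1) mod length vs"
  show "X_map vs (1\<^sub>m 1 :: 'k mat) s t (vertex_elem vs s a) j = vertex_elem vs t (if s \<in> set vs then a else 0) j"
  proof (cases "j < ?n \<and> vs ! j = t")
    case False
    then show ?thesis by (auto simp: X_map_def Let_def vertex_elem_def)
  next
    case True
    note c = cyclic_index[OF n, of j]
    have pq: "?p < ?n" "?q < ?n" "vs ! ?p \<noteq> vs ! ?q"
      using c(1,2,3) True d nth_eq_iff_index_eq by blast+
    have "X_map vs (1\<^sub>m 1 :: 'k mat) s t (vertex_elem vs s a) j =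
        (if vs ! ?p = s then vec 1 (\<lambda>_. a) else 0\<^sub>v 1) + (if vs ! ?q = s then vec 1 (\<lambda>_. a) else 0\<^sub>v 1)"
      using True pq(1,2) by (auto simp: X_map_def Let_def vertex_elem_def edge_mat_def edge_mat_inv_def mat_inverse_one)
    also have "\<dots> = vertex_elem vs t (if s \<in> set vs then a else 0) j"
    proof (cases "s \<in> set vs")
      case False
      then have "vs ! ?p \<noteq> s" "vs ! ?q \<noteq> s" using pq(1,2) nth_mem by blast+
      then have "(if vs ! ?p = s then vec 1 (\<lambda>_. a) else 0\<^sub>v 1) + (if vs ! ?q = s then vec 1 (\<lambda>_. a) else 0\<^sub>v 1) =
          (0\<^sub>v 1 :: 'k vec) + 0\<^sub>v 1" by (simp only: if_False)
      also have "\<dots> = vec 1 (\<lambda>_. 0)" by (rule eq_vecI) simp_all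
      also have "\<dots> = vertex_elem vs t (if s \<in> set vs then a else 0) j" using False True by (simp add: vertex_elem_def)
      finally show ?thesis .
    next
      case s: True
      have "t \<in> set vs" using True nth_mem by blast
      then obtain k where k: "k < ?n" "(vs ! k = s \<and> vs ! (Suc k mod ?n) = t) \<or> (vs ! k = t \<and> vs ! (Suc k mod ?n) = s)"
        using adj s by blast
      have N: "Suc k mod ?n < ?n" using k(1) by (intro mod_less_divisor) linarith
      have "vs ! ?p = s \<or> vs ! ?q = s"
        using k(2)
      proof
        assume "vs ! k = s \<and> vs ! (Suc k mod ?n) = t"
        then have "Suc k mod ?n = j" using True N d nth_eq_iff_index_eq by metis
        then show ?thesis using c(5)[of k] True k(1) \<open>vs ! k = s \<and> _\<close> by simp
      next
        assume "vs ! k = t \<and> vs ! (Suc k mod ?n) = s"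
        then have "k = j" using True k(1) d nth_eq_iff_index_eq by metis
        then show ?thesis using \<open>vs ! k = t \<and> _\<close> by simp
      qed
      then show ?thesis using pq(3) s True by (auto simp: vertex_elem_def)
    qed
    finally show ?thesis .
  qed
qed

text \<open>The cycle passes each vertex of \<open>bverts I\<close> once and the matrix is 1, so all
  spaces are lines or zero and the arrows between lines are identities. Scalars on
  \<open>low I\<close> and \<open>upp I\<close> thus become scalars at \<open>vDL\<close> and
  \<open>vUR\<close>.\<close>

lemma spread_bnd_bc_rep:
  assumes P: "spread_path I n c b d"
  shows "\<exists>\<phi> \<psi>. bnd_bij (spread_bnd I) (bc_rep (spread_curve n b d, 1\<^sub>m 1 :: 'k::field mat)) \<phi> \<psi>"
proof -
  define vs where "vs = oriented_cycle (spread_curve n b d)"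
  define T where "T = (1\<^sub>m 1 :: 'k mat)"
  note vs = spread_cycle_properties[OF P, folded vs_def] and pp = spread_pathD[OF P]
  note cl = convex_low[OF pp(1)]
  note V = vs(2) bverts_simps
  have XC: "carrier (X_space vs T v) = range (vertex_elem vs v)" for v
    unfolding T_def by (rule X_space_carrier[OF vs(1)])
  have A: "X_map vs T s t (vertex_elem vs s a) = vertex_elem vs t (if s \<in> bverts I then a else 0)"
    if adj: "s \<in> bverts I \<Longrightarrow> t \<in> bverts I \<Longrightarrow> t = nxt I s \<or> s = nxt I t" for s t a
  proof -
    have ex: "\<exists>j<length vs. (vs ! j = s \<and> vs ! (Suc j mod length vs) = t) \<or>
      (vs ! j = t \<and> vs ! (Suc j mod length vs) = s)" if st: "s \<in> set vs" "t \<in> set vs"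
      using adj[OF st[unfolded vs(2)]]
    proof
      assume t: "t = nxt I s"
      obtain j where j: "j < length vs" "vs ! j = s" using st(1) unfolding in_set_conv_nth by blast
      then show ?thesis using vs(4)[OF j(1)] t by auto
    next
      assume s: "s = nxt I t"
      obtain j where j: "j < length vs" "vs ! j = t" using st(2) unfolding in_set_conv_nth by blast
      then show ?thesis using vs(4)[OF j(1)] s by auto
    qed
    have "X_map vs T s t (vertex_elem vs s a) = vertex_elem vs t (if s \<in> set vs then a else 0)"
      unfolding T_def by (rule X_map_vertex_elem[OF vs(1,3)]) (rule ex)
    then show ?thesis unfolding vs(2) .
  qed
  note VN = bverts_simps nxt_simps
  \<comment> \<open>If both ends of one of these arrows are on the cycle, they are consecutive
    there, in one order or the other.\<close>
  have arrows:
    "X_map vs T (vDL, i) (vD, i) (vertex_elem vs (vDL, i) a) = vertex_elem vs (vD, i) (if i \<in> low I then a else 0)"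
    "X_map vs T (vD, i) (vDL, i + (1,0)) (vertex_elem vs (vD, i) a) = vertex_elem vs (vDL, i + (1,0)) (if i \<in> I \<and> i - (0,1) \<notin> I then a else 0)"
    "X_map vs T (vDL, i) (vL, i) (vertex_elem vs (vDL, i) a) = vertex_elem vs (vL, i) (if i \<in> low I then a else 0)"
    "X_map vs T (vL, i) (vDL, i + (0,1)) (vertex_elem vs (vL, i) a) = vertex_elem vs (vDL, i + (0,1)) (if i \<in> I \<and> i - (1,0) \<notin> I then a else 0)"
    "X_map vs T (vUR, i) (vU, i + (1,0)) (vertex_elem vs (vUR, i) a) = vertex_elem vs (vU, i + (1,0)) (if i \<in> upp I then a else 0)"
    "X_map vs T (vU, i) (vUR, i) (vertex_elem vs (vU, i) a) = vertex_elem vs (vUR, i) (if i \<in> I \<and> i + (0,1) \<notin> I then a else 0)"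
    "X_map vs T (vUR, i) (vR, i + (0,1)) (vertex_elem vs (vUR, i) a) = vertex_elem vs (vR, i + (0,1)) (if i \<in> upp I then a else 0)"
    "X_map vs T (vR, i) (vUR, i) (vertex_elem vs (vR, i) a) = vertex_elem vs (vUR, i) (if i \<in> I \<and> i + (1,0) \<notin> I then a else 0)"
    "X_map vs T (vU, i) (vL, i) (vertex_elem vs (vU, i) a) = vertex_elem vs (vL, i) (if i \<in> I \<and> i + (0,1) \<notin> I then a else 0)"
    "X_map vs T (vR, i) (vD, i) (vertex_elem vs (vR, i) a) = vertex_elem vs (vD, i) (if i \<in> I \<and> i + (1,0) \<notin> I then a else 0)"
    for i a
    by (subst A; auto simp: VN low_def upp_def)+
  let ?Q = "bc_rep (spread_curve n b d, T)"
  let ?p = "\<lambda>i. vertex_elem vs (vDL, i)" and ?s = "\<lambda>i. vertex_elem vs (vUR, i)"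
  note Q = bc_rep_simps[of "spread_curve n b d" T, folded vs_def]
  have N: "v \<notin> bverts I \<Longrightarrow> vertex_elem vs v a = vertex_elem vs v b'" for v and a b' :: 'k using vertex_elem_notin[of v vs] vs(2) by simp
  have E: "v \<in> bverts I \<Longrightarrow> vertex_elem vs v a = vertex_elem vs v b' \<longleftrightarrow> a = b'" for v and a b' :: 'k
    using vertex_elem_eq_iff[of v vs] vs(2) by simp
  have lowI: "\<And>i. i \<in> low I \<Longrightarrow> i \<in> I" and uppI: "\<And>i. i \<in> upp I \<Longrightarrow> i \<in> I"
    by (auto simp: low_def upp_def)
  have B: "rep_bij (bndB (spread_bnd I)) (bndB ?Q) ?p"
  proof -
    have "?p (i + (1,0)) (xact (spread_rep (low I)) i a) = xact (bndB ?Q) i (?p i a)" for i and a :: 'k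
    proof (cases "i + (1,0) \<in> low I")
      case True
      then have "i \<in> low I \<Longrightarrow> i - (0,1) \<notin> I" by (simp add: low_def shift_minus)
      then show ?thesis using True lowI[of i] by (simp add: Q arrows spread_rep_simps)
    next
      case False
      then show ?thesis unfolding Q arrows by (intro N) (simp add: bverts_simps)
    qed
    moreover have "?p (i + (0,1)) (yact (spread_rep (low I)) i a) = yact (bndB ?Q) i (?p i a)" for i and a :: 'k
    proof (cases "i + (0,1) \<in> low I")
      case True
      then have "i \<in> low I \<Longrightarrow> i - (1,0) \<notin> I" by (simp add: low_def shift_minus)
      then show ?thesis using True lowI[of i] by (simp add: Q arrows spread_rep_simps)
    next
      case False
      then show ?thesis unfolding Q arrows by (intro N) (simp add: bverts_simps)
    qed
    moreover have "lin_iso (vsp (spread_rep (low I)) i) (vsp (bndB ?Q) i) (?p i)" for i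
    proof -
      have "lin_iso (vsp (spread_rep (low I)) i) (X_space vs T (vDL, i)) (?p i)"
        unfolding T_def by (rule lin_iso_vertex_elem[OF vs(1)]) (simp add: V)
      then show ?thesis unfolding Q .
    qed
    ultimately show ?thesis unfolding rep_bij_def spread_bnd_simps by blast
  qed
  have D: "rep_bij (bndD (spread_bnd I)) (bndD ?Q) ?s"
  proof -
    have "?s (i + (1,0)) (xact (spread_rep (upp I)) i a) = xact (bndD ?Q) i (?s i a)" for i and a :: 'k
    proof (cases "i + (1,0) \<in> upp I")
      case True
      have "i \<in> upp I \<Longrightarrow> i + (1,0) + (0,1) \<notin> I" by (simp add: upp_def shift)
      then show ?thesis using True uppI[of "i + (1,0)"] by (simp add: Q arrows spread_rep_simps)
    next
      case False
      then show ?thesis unfolding Q arrows by (intro N) (simp add: bverts_simps)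
    qed
    moreover have "?s (i + (0,1)) (yact (spread_rep (upp I)) i a) = yact (bndD ?Q) i (?s i a)" for i and a :: 'k
    proof (cases "i + (0,1) \<in> upp I")
      case True
      have "i \<in> upp I \<Longrightarrow> i + (0,1) + (1,0) \<notin> I" by (simp add: upp_def shift)
      then show ?thesis using True uppI[of "i + (0,1)"] by (simp add: Q arrows spread_rep_simps)
    next
      case False
      then show ?thesis unfolding Q arrows by (intro N) (simp add: bverts_simps)
    qed
    moreover have "lin_iso (vsp (spread_rep (upp I)) i) (vsp (bndD ?Q) i) (?s i)" for i
    proof -
      have "lin_iso (vsp (spread_rep (upp I)) i) (X_space vs T (vUR, i)) (?s i)"
        unfolding T_def by (rule lin_iso_vertex_elem[OF vs(1)]) (simp add: V)
      then show ?thesis unfolding Q .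
    qed
    ultimately show ?thesis unfolding rep_bij_def spread_bnd_simps by blast
  qed
  \<comment> \<open>Common to both structure maps: \<open>k\<close> is the vertex of the kernel and
    \<open>k'\<close> that of the cokernel at \<open>i\<close>, while \<open>R\<close> and
    \<open>C\<close> say whether these are on the cycle.\<close>
  have vals: "{y \<in> carrier (X_space vs T (vDL, i)). \<exists>u\<in>carrier (X_space vs T (k, i)).
        X_map vs T (k, i) (vUR, i) u = ?s i a \<and> X_map vs T (vDL, i) (k', i) y = X_map vs T (k, i) (k', i) u} =
      ?p i ` {b \<in> carrier (vsp (spread_rep (low I)) i). C \<longrightarrow> b = a}" (is "?S = ?p i ` ?S'")
    if k: "\<And>a. X_map vs T (k, i) (vUR, i) (vertex_elem vs (k, i) a) = vertex_elem vs (vUR, i) (if R then a else 0)"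
      "\<And>a. X_map vs T (k, i) (k', i) (vertex_elem vs (k, i) a) = vertex_elem vs (k', i) (if R then a else 0)"
      "\<And>a. X_map vs T (vDL, i) (k', i) (vertex_elem vs (vDL, i) a) = vertex_elem vs (k', i) (if i \<in> low I then a else 0)"
      and R: "i \<notin> upp I \<Longrightarrow> \<not> R" "\<not> R \<Longrightarrow> a = 0" and C: "(k', i) \<in> bverts I \<longleftrightarrow> C" "C \<Longrightarrow> i \<in> low I"
    for i k k' R C and a :: 'k
  proof (rule Set.set_eqI, rule iffI)
    fix y assume "y \<in> ?S"
    then obtain b' a' where y: "y = ?p i b'" and 1: "?s i (if R then a' else 0) = ?s i a"
      and 2: "vertex_elem vs (k', i) (if i \<in> low I then b' else 0) = vertex_elem vs (k', i) (if R then a' else 0)"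
      unfolding XC by (auto simp: k)
    have w: "(if R then a' else 0) = a"
    proof (cases "i \<in> upp I")
      case True
      then show ?thesis using 1 E[of "(vUR, i)"] by (simp add: bverts_simps)
    next
      case False
      then show ?thesis using R by simp
    qed
    have "C \<Longrightarrow> b' = a" using 2 C E[of "(k', i)"] unfolding w by simp
    moreover have "i \<notin> low I \<Longrightarrow> ?p i b' = ?p i 0" by (intro N) (simp add: bverts_simps)
    ultimately show "y \<in> ?p i ` ?S'"
      unfolding y using C(2) by (cases "i \<in> low I") (auto simp: spread_rep_simps)
  next
    fix y assume "y \<in> ?p i ` ?S'"
    then obtain b' where y: "y = ?p i b'" and b': "C \<longrightarrow> b' = a" by blast
    have w: "(if R then a else 0) = a" using R(2) by simp
    have "vertex_elem vs (k', i) (if i \<in> low I then b' else 0) = vertex_elem vs (k', i) a"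
    proof (cases "(k', i) \<in> bverts I")
      case True
      then show ?thesis using C b' by simp
    qed (rule N)
    then show "y \<in> ?S" unfolding XC y using w by (auto simp: k intro!: exI[of _ a])
  qed
  have f: "bndf ?Q i (?s i a) = ?p i ` bndf (spread_bnd I) i a" if a: "a \<in> kery (spread_rep (upp I)) i" for i and a :: 'k
    unfolding Q spread_bnd_simps
  proof (rule vals[OF arrows(6)[of i] arrows(9)[of i] arrows(3)[of i]])
    \<comment> \<open>A nonzero element of the kernel sits at a point from which \<open>y\<close>
      leaves \<open>I\<close>, since a step within \<open>I\<close> stays in \<open>upp I\<close>
      and acts as the identity.\<close>
    show "\<not> (i \<in> I \<and> i + (0,1) \<notin> I) \<Longrightarrow> a = 0"
      using a uppI[of i] upp_succ(2)[OF pp(1), of i] by (auto simp: kery_def spread_rep_simps split: if_splits)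
    show "(vL, i) \<in> bverts I \<longleftrightarrow> i \<in> low I \<and> i - (1,0) \<notin> low I"
      using cl(1)[of i] low_succ(1)[OF pp(1), of "i - (1,0)"] lowI[of i] lowI[of "i - (1,0)"]
      by (auto simp: bverts_simps)
  qed (use cl(4)[of i] in \<open>auto simp: arrows\<close>)
  have g: "bndg ?Q i (?s i a) = ?p i ` bndg (spread_bnd I) i a" if a: "a \<in> kerx (spread_rep (upp I)) i" for i and a :: 'k
    unfolding Q spread_bnd_simps
  proof (rule vals[OF arrows(8)[of i] arrows(10)[of i] arrows(1)[of i]])
    show "\<not> (i \<in> I \<and> i + (1,0) \<notin> I) \<Longrightarrow> a = 0"
      using a uppI[of i] upp_succ(1)[OF pp(1), of i] by (auto simp: kerx_def spread_rep_simps split: if_splits)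
    show "(vD, i) \<in> bverts I \<longleftrightarrow> i \<in> low I \<and> i - (0,1) \<notin> low I"
      using cl(2)[of i] low_succ(2)[OF pp(1), of "i - (0,1)"] lowI[of i] lowI[of "i - (0,1)"]
      by (auto simp: bverts_simps)
  qed (use cl(3)[of i] in \<open>auto simp: arrows\<close>)
  have "bnd_bij (spread_bnd I) ?Q ?p ?s"
    unfolding bnd_bij_def using B D f g by (simp add: spread_bnd_simps(2))
  then show ?thesis unfolding T_def by blast
qed

text \<open>The first point is the only one on the diagonal \<open>c\<close>, so the curve is not a
  repetition of a shorter one; and two blocks of positive size do not fit into a 1 by 1
  matrix.\<close>

lemma spread_curve_boundary_component:
  assumes P: "spread_path I n c b d"
  shows "boundary_component (spread_curve n b d, 1\<^sub>m 1 :: 'k::field mat)"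
proof -
  note p = spread_pathD[OF P]
  let ?\<gamma> = "spread_curve n b d"
  have len: "length ?\<gamma> = max 1 (2 * n)" by (simp add: spread_curve_def)
  have closed: "closed_curve ?\<gamma>" unfolding closed_curve_def
  proof (intro conjI allI impI)
    show "?\<gamma> \<noteq> []" using len by auto
    fix j assume j: "j < length ?\<gamma>"
    have u: "\<bar>fst (v - u)\<bar> + \<bar>snd (v - u)\<bar> \<le> 1"
      if "v = u + (1,0) \<or> v = u - (0,1) \<or> u = v + (1,0) \<or> u = v - (0,1) \<or> u = v" for u v :: "int \<times> int"
      using that by (cases u; cases v) auto
    have "let u = ?\<gamma> ! j; v = ?\<gamma> ! (Suc j mod length ?\<gamma>) in
      v = u + (1,0) \<or> v = u - (0,1) \<or> u = v + (1,0) \<or> u = v - (0,1) \<or> u = v"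
    proof (cases "n = 0")
      case True
      then show ?thesis using j len by simp
    next
      case False
      then have e: "?\<gamma> ! j = curve_point n b d j" "?\<gamma> ! (Suc j mod length ?\<gamma>) = curve_point n b d (Suc j)"
        using spread_curve_nth[OF P, of j] spread_curve_nth[OF P, of "Suc j"] j len by simp_all
      show ?thesis
      proof (cases "j < n")
        case True
        then show ?thesis unfolding e Let_def using p(8)[of j] by (auto simp: curve_point_simps(1)[OF P])
      next
        case f: False
        then have "curve_point n b d j = d (Suc (2 * n - Suc j))" "curve_point n b d (Suc j) = d (2 * n - Suc j)"
          using j len False by (simp_all add: curve_point_simps(2)[OF P] Suc_diff_Suc)
        then show ?thesis unfolding e Let_def using p(9)[of "2 * n - Suc j"] f j len False by auto
      qed
    qed
    then show "let \<delta> = ?\<gamma> ! (Suc j mod length ?\<gamma>) - ?\<gamma> ! j in \<bar>fst \<delta>\<bar> + \<bar>snd \<delta>\<bar> \<le> 1"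
      unfolding Let_def by (rule u)
  qed
  have irr: "irreducible_curve ?\<gamma>" unfolding irreducible_curve_def
  proof
    assume "\<exists>k\<ge>2. \<exists>\<delta>. closed_curve \<delta> \<and> ?\<gamma> = concat (replicate k \<delta>)"
    then obtain k \<delta> where k: "2 \<le> k" "\<delta> \<noteq> []" "?\<gamma> = concat (replicate k \<delta>)"
      unfolding closed_curve_def by blast
    then obtain l where l: "k = Suc (Suc l)" by (metis One_nat_def Suc_1 Suc_le_D le_Suc_eq Suc_le_mono)
    have g: "?\<gamma> = \<delta> @ \<delta> @ concat (replicate l \<delta>)" using k(3) l by simp
    have L: "0 < length \<delta>" "length \<delta> < length ?\<gamma>" using k(2) by (simp_all add: g)
    have "?\<gamma> ! length \<delta> = ?\<gamma> ! 0" using k(2) by (simp add: g nth_append)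
    moreover have "?\<gamma> ! m = curve_point n b d m" if "m < length ?\<gamma>" for m
      using that by (simp add: spread_curve_def)
    ultimately have eq: "curve_point n b d (length \<delta>) = curve_point n b d 0" using L by (metis gr_zeroI less_zeroE)
    have m: "length \<delta> < 2 * n" using L len by (simp add: max_def split: if_splits)
    have "diag (curve_point n b d 0) = c" using p(6)[of 0] by (simp add: curve_point_def)
    moreover have "diag (curve_point n b d (length \<delta>)) \<noteq> c"
      using p(6)[of "length \<delta>"] p(7)[of "2 * n - length \<delta>"] L(1) m by (auto simp: curve_point_def)
    ultimately show False using eq by simp
  qed
  have "\<not> (\<exists>Ts. length Ts > 1 \<and> (\<forall>A\<in>set Ts. square_mat A \<and> dim_row A > 0) \<and>
      similar_mat (1\<^sub>m 1 :: 'k mat) (diag_block_mat Ts))"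
  proof
    assume "\<exists>Ts. length Ts > 1 \<and> (\<forall>A\<in>set Ts. square_mat A \<and> dim_row A > 0) \<and>
      similar_mat (1\<^sub>m 1 :: 'k mat) (diag_block_mat Ts)"
    then obtain Ts where Ts: "length Ts > 1" "\<forall>A\<in>set Ts. dim_row A > 0" "similar_mat (1\<^sub>m 1 :: 'k mat) (diag_block_mat Ts)"
      by blast
    obtain A B Ts' where AB: "Ts = A # B # Ts'" using Ts(1) by (cases Ts; cases "tl Ts") auto
    obtain n where "{1\<^sub>m 1 :: 'k mat, diag_block_mat Ts} \<subseteq> carrier_mat n n"
      using similar_matD[OF Ts(3)] by blast
    then have "dim_row (diag_block_mat Ts) = 1" by auto
    then show False using Ts(2) by (simp add: AB dim_diag_block_mat)
  qed
  then show ?thesis unfolding boundary_component_def using closed irr invertible_one_mat by simp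
qed

section \<open>Multiplicities of spreads are determined by the boundary\<close>

text \<open>The scalars \<open>a\<close> on \<open>low\<close> and \<open>c\<close> on \<open>upp\<close> of a morphism between the boundaries of two spreads; the
  last clause is the compatibility with \<open>bndf\<close>, which ties \<open>c\<close> to \<open>a\<close> at the upper left corner of \<open>I\<close>.\<close>

definition spread_hom ::
  "(int \<times> int) set \<Rightarrow> (int \<times> int) set \<Rightarrow> (int \<times> int \<Rightarrow> 'k::field) \<Rightarrow> (int \<times> int \<Rightarrow> 'k) \<Rightarrow> bool" where
  "spread_hom I K a c \<longleftrightarrow>
    (\<forall>i. a i \<noteq> 0 \<longrightarrow> i \<in> low I \<and> i \<in> low K) \<and> (\<forall>i. c i \<noteq> 0 \<longrightarrow> i \<in> upp I \<and> i \<in> upp K) \<and>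
    (\<forall>i. i \<in> low I \<longrightarrow> i + (1,0) \<in> low K \<longrightarrow> a (i + (1,0)) = a i) \<and>
    (\<forall>i. i \<in> low I \<longrightarrow> i + (0,1) \<in> low K \<longrightarrow> a (i + (0,1)) = a i) \<and>
    (\<forall>i. i \<in> upp I \<longrightarrow> i + (1,0) \<in> upp K \<longrightarrow> c (i + (1,0)) = c i) \<and>
    (\<forall>i. i \<in> upp I \<longrightarrow> i + (0,1) \<in> upp K \<longrightarrow> c (i + (0,1)) = c i) \<and>
    (\<forall>i. i \<in> upp I \<longrightarrow> i + (0,1) \<notin> upp I \<longrightarrow> i \<in> low K \<longrightarrow> i - (1,0) \<notin> low K \<longrightarrow> a i = c i)"

lemma spread_homD:
  assumes "spread_hom I K a c"
  shows "i \<notin> low I \<Longrightarrow> a i = 0" "i \<notin> low K \<Longrightarrow> a i = 0" "i \<notin> upp I \<Longrightarrow> c i = 0" "i \<notin> upp K \<Longrightarrow> c i = 0"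
    "i \<in> low I \<Longrightarrow> i + (1,0) \<in> low K \<Longrightarrow> a (i + (1,0)) = a i"
    "i \<in> low I \<Longrightarrow> i + (0,1) \<in> low K \<Longrightarrow> a (i + (0,1)) = a i"
    "i \<in> upp I \<Longrightarrow> i + (1,0) \<in> upp K \<Longrightarrow> c (i + (1,0)) = c i"
    "i \<in> upp I \<Longrightarrow> i + (0,1) \<in> upp K \<Longrightarrow> c (i + (0,1)) = c i"
    "i \<in> upp I \<Longrightarrow> i + (0,1) \<notin> upp I \<Longrightarrow> i \<in> low K \<Longrightarrow> i - (1,0) \<notin> low K \<Longrightarrow> a i = c i"
  using assms unfolding spread_hom_def by blast+

text \<open>If the middle spread contains only one of two adjacent points, the constancy of one
  factor makes that factor vanish at both points, so both sides of the required equation are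
  zero.\<close>

lemma spread_hom_comp:
  assumes h: "spread_hom I J a c" and h': "spread_hom J K a' c'"
  shows "spread_hom I K (\<lambda>i. a' i * a i) (\<lambda>i. c' i * c i)"
proof -
  note p = spread_homD[OF h] and q = spread_homD[OF h']
  have step: "a' (i + v) * a (i + v) = a' i * a i"
    if "i \<in> low I" "i + v \<in> low K" "i + v \<in> low J \<Longrightarrow> a (i + v) = a i" "i \<in> low J \<Longrightarrow> a' (i + v) = a' i" for i v
    using that p(2)[of "i + v"] p(2)[of i] q(1)[of "i + v"] q(1)[of i]
    by (cases "i \<in> low J"; cases "i + v \<in> low J") auto
  have step': "c' (i + v) * c (i + v) = c' i * c i"
    if "i \<in> upp I" "i + v \<in> upp K" "i + v \<in> upp J \<Longrightarrow> c (i + v) = c i" "i \<in> upp J \<Longrightarrow> c' (i + v) = c' i" for i v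
    using that p(4)[of "i + v"] p(4)[of i] q(3)[of "i + v"] q(3)[of i]
    by (cases "i \<in> upp J"; cases "i + v \<in> upp J") auto
  have "a' i * a i = c' i * c i"
    if i: "i \<in> upp I" "i + (0,1) \<notin> upp I" "i \<in> low K" "i - (1,0) \<notin> low K" for i
  proof -
    \<comment> \<open>\<open>a'\<close> vanishes at \<open>i - (1,0)\<close>, which is outside
      \<open>low K\<close>, and constancy along the step to \<open>i\<close> carries the zero over;
      \<open>c0\<close> is dual.\<close>
    have a'0: "a' i = 0" if "i - (1,0) \<in> low J"
      using q(5)[of "i - (1,0)"] q(2)[of "i - (1,0)"] that i by simp
    have c0: "c i = 0" if "i + (0,1) \<in> upp J"
      using p(8)[of i] p(3)[of "i + (0,1)"] that i by simp
    have ac: "a i = c i" if "i \<in> low J" "i - (1,0) \<notin> low J" using p(9)[of i] that i by simp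
    have ac': "a' i = c' i" if "i \<in> upp J" "i + (0,1) \<notin> upp J" using q(9)[of i] that i by simp
    show ?thesis using a'0 c0 ac ac' p(2)[of i] p(4)[of i] q(1)[of i] q(3)[of i]
      by (cases "i \<in> low J"; cases "i \<in> upp J"; cases "i - (1,0) \<in> low J"; cases "i + (0,1) \<in> upp J") auto
  qed
  moreover have "i \<in> low I \<and> i \<in> low K" if "a' i * a i \<noteq> 0" for i using that p(1)[of i] q(2)[of i] by auto
  moreover have "i \<in> upp I \<and> i \<in> upp K" if "c' i * c i \<noteq> 0" for i using that p(3)[of i] q(4)[of i] by auto
  ultimately show ?thesis unfolding spread_hom_def using step step' p(5-8) q(5-8) by simp
qed

lemma spread_endo_scalar:
  assumes P: "spread_path I n c0 b d" and h: "spread_hom I I a c"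
  shows "\<exists>k. (\<forall>i\<in>low I. a i = k) \<and> (\<forall>i\<in>upp I. c i = k)"
proof -
  note p = spread_pathD[OF P] and q = spread_homD[OF h]
  have "a i = a (b 0)" if "i \<in> low I" for i
    using constant_along_path[of n b a i] p(8) q(5,6) that unfolding p(4) by blast
  moreover have "c i = c (d 0)" if "i \<in> upp I" for i
    using constant_along_path[of n d c i] p(9) q(7,8) that unfolding p(5) by blast
  moreover have "a (b 0) = c (b 0)"
  proof (rule q(9))
    show "b 0 \<in> low I" unfolding p(4) by simp
    have "d 0 \<in> upp I" unfolding p(5) by simp
    then show "b 0 \<in> upp I" by (simp add: p(10))
    have "b 0 + (0,1) \<notin> I" "b 0 - (1,0) \<notin> I"
      using p(2)[of "b 0 + (0,1)"] p(2)[of "b 0 - (1,0)"] p(6)[of 0] by (auto simp: diag_simps)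
    then show "b 0 + (0,1) \<notin> upp I" "b 0 - (1,0) \<notin> low I" by (simp_all add: low_def upp_def)
  qed
  ultimately show ?thesis using p(10) by (intro exI[of _ "a (b 0)"]) simp
qed

text \<open>Each diagonal of a convex set is an interval, so its end points determine it; this
  recovers a spread from the supports of its boundary.\<close>

lemma spread_from_boundary:
  assumes P: "spread_path I n c b d"
  shows "i \<in> I \<longleftrightarrow> (\<exists>p\<in>low I. \<exists>q\<in>upp I. p \<le> i \<and> i \<le> q \<and> diag p = diag i \<and> diag q = diag i)"
proof
  note p = spread_pathD[OF P]
  assume i: "i \<in> I"
  define t where "t = nat (diag i - c)"
  have t: "t \<le> n" "diag i = c + int t" using p(2,3)[OF i] by (auto simp: t_def)
  obtain x y where xy: "i = (x, y)" by (cases i)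
  obtain bx by' where bxy: "b t = (bx, by')" by (cases "b t")
  obtain dx dy where dxy: "d t = (dx, dy)" by (cases "d t")
  have e: "bx - by' = x - y" "dx - dy = x - y"
    using p(6,7)[OF t(1)] t(2) by (simp_all add: xy bxy dxy diag_def)
  have "bx \<le> x"
  proof (rule ccontr)
    assume "\<not> bx \<le> x"
    then have "b t - (1,1) \<in> I" using e by (intro convex_setD[OF p(1) i p(12)[OF t(1)]]) (auto simp: xy bxy)
    then show False using p(14)[OF t(1)] by blast
  qed
  moreover have "x \<le> dx"
  proof (rule ccontr)
    assume "\<not> x \<le> dx"
    then have "d t + (1,1) \<in> I" using e by (intro convex_setD[OF p(1) p(13)[OF t(1)] i]) (auto simp: xy dxy)
    then show False using p(15)[OF t(1)] by blast
  qed
  ultimately have "b t \<le> i" "i \<le> d t" using e by (auto simp: xy bxy dxy)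
  moreover have "b t \<in> low I" "d t \<in> upp I" unfolding p(4,5) using t(1) by auto
  ultimately show "\<exists>p\<in>low I. \<exists>q\<in>upp I. p \<le> i \<and> i \<le> q \<and> diag p = diag i \<and> diag q = diag i"
    using p(6,7)[OF t(1)] t(2) by auto
next
  assume "\<exists>p\<in>low I. \<exists>q\<in>upp I. p \<le> i \<and> i \<le> q \<and> diag p = diag i \<and> diag q = diag i"
  then obtain p q where pq: "p \<in> low I" "q \<in> upp I" "p \<le> i" "i \<le> q" by blast
  then have "p \<in> I" "q \<in> I" unfolding low_def upp_def by blast+
  then show "i \<in> I" using pq(3,4) by (rule convex_setD[OF spread_pathD(1)[OF P]])
qed

text \<open>Composing in either order multiplies the same scalars, so both endomorphisms are nonzero
  at once. Then no lower or upper point of one spread is missing from the corresponding set of the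
  other.\<close>

lemma spread_hom_nonzero_eq:
  assumes P: "spread_path I n c0 b d" and P': "spread_path K n' c0' b' d'"
    and h: "spread_hom I K a c" and h': "spread_hom K I a' c'" and i: "i \<in> low I" and nz: "a' i * a i \<noteq> 0"
  shows "I = K"
proof -
  note p = spread_homD[OF h] and q = spread_homD[OF h']
  obtain k where k: "\<forall>i\<in>low I. a' i * a i = k" "\<forall>i\<in>upp I. c' i * c i = k"
    using spread_endo_scalar[OF P spread_hom_comp[OF h h']] by blast
  obtain k' where k': "\<forall>i\<in>low K. a i * a' i = k'" "\<forall>i\<in>upp K. c i * c' i = k'"
    using spread_endo_scalar[OF P' spread_hom_comp[OF h' h]] by blast
  have "k \<noteq> 0" using k(1) i nz by auto
  moreover have "k' \<noteq> 0" using k'(1) p(2)[of i] nz by (cases "i \<in> low K") (auto simp: mult.commute)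
  ultimately have "j \<in> low I \<longleftrightarrow> j \<in> low K" "j \<in> upp I \<longleftrightarrow> j \<in> upp K" for j
    using k k' p(1,2)[of j] p(3,4)[of j] by force+
  then have "low I = low K" "upp I = upp K" by blast+
  then show ?thesis using spread_from_boundary[OF P] spread_from_boundary[OF P'] by (intro Set.set_eqI) simp
qed

section \<open>Blocks of a morphism between sums of spread boundaries\<close>

definition unit_elem :: "'j set \<Rightarrow> 'j \<Rightarrow> 'j \<Rightarrow> 'k::field" where
  "unit_elem J j = (\<lambda>j'\<in>J. if j' = j then 1 else 0)"

text \<open>The scalar by which a morphism of sums maps the summand \<open>j\<close> to the summand \<open>l\<close> at \<open>i\<close>.\<close>

definition component ::
  "'j set \<Rightarrow> ('j \<Rightarrow> (int \<times> int) set) \<Rightarrow> ('l \<Rightarrow> (int \<times> int) set) \<Rightarrow>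
    (int \<times> int \<Rightarrow> ('j \<Rightarrow> 'k::field) \<Rightarrow> 'l \<Rightarrow> 'k) \<Rightarrow> 'l \<Rightarrow> 'j \<Rightarrow> int \<times> int \<Rightarrow> 'k" where
  "component J X Y \<phi> l j i = (if i \<in> X j \<and> i \<in> Y l then \<phi> i (unit_elem J j) l else 0)"

context
  fixes J :: "'j set" and L :: "'l set" and X :: "'j \<Rightarrow> (int \<times> int) set" and Y :: "'l \<Rightarrow> (int \<times> int) set"
    and \<phi> :: "int \<times> int \<Rightarrow> ('j \<Rightarrow> 'k::field) \<Rightarrow> 'l \<Rightarrow> 'k"
  assumes J: "finite J" and L: "finite L"
    and b: "rep_bij (rep_sum J (\<lambda>j. spread_rep (X j)) :: ('k, 'j \<Rightarrow> 'k) rep) (rep_sum L (\<lambda>l. spread_rep (Y l))) \<phi>"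
begin

lemma unit_elem_carrier:
  "j \<in> J \<Longrightarrow> i \<in> X j \<Longrightarrow> unit_elem J j \<in> carrier (vsp (rep_sum J (\<lambda>j. spread_rep (X j)) :: ('k, 'j \<Rightarrow> 'k) rep) i)"
  by (auto simp: spread_sum_carrier[OF J] unit_elem_def)

lemma zero_component: "l \<in> L \<Longrightarrow> \<phi> i (\<lambda>j\<in>J. 0) l = 0"
  using lin_surjD(4)[OF rep_bijD(2)[OF b, of i]] by (simp add: spread_sum_simps)

lemma component_step:
  assumes j: "j \<in> J" and l: "l \<in> L" and i: "i \<in> X j"
  shows "i + (1,0) \<in> Y l \<Longrightarrow> component J X Y \<phi> l j (i + (1,0)) = component J X Y \<phi> l j i"
    "i + (0,1) \<in> Y l \<Longrightarrow> component J X Y \<phi> l j (i + (0,1)) = component J X Y \<phi> l j i"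
proof -
  note e = rep_bijD(3,4)[OF b unit_elem_carrier[OF j i]]
  \<comment> \<open>A unit step sends a unit vector to itself or to zero, so the equations
    \<open>e\<close> can be read at the coordinate \<open>l\<close>.\<close>
  have act: "(\<lambda>j'\<in>J. if i \<in> X j' \<and> i + v \<in> X j' then unit_elem J j j' else 0) =
      (if i + v \<in> X j then unit_elem J j else (\<lambda>j\<in>J. 0 :: 'k))" for v
    using i by (auto simp: unit_elem_def fun_eq_iff)
  show "component J X Y \<phi> l j (i + (1,0)) = component J X Y \<phi> l j i" if "i + (1,0) \<in> Y l"
    using fun_cong[OF e(1)[unfolded spread_sum_simps act], of l] l i that zero_component[OF l]
    by (auto simp: component_def split: if_splits)
  show "component J X Y \<phi> l j (i + (0,1)) = component J X Y \<phi> l j i" if "i + (0,1) \<in> Y l"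
    using fun_cong[OF e(2)[unfolded spread_sum_simps act], of l] l i that zero_component[OF l]
    by (auto simp: component_def split: if_splits)
qed

text \<open>Linearity, by induction on the set of summands kept in the truncation
  \<open>r F\<close>; a summand that does not contain \<open>i\<close> has coefficient zero.\<close>

lemma component_expand:
  assumes w: "w \<in> carrier (vsp (rep_sum J (\<lambda>j. spread_rep (X j)) :: ('k, 'j \<Rightarrow> 'k) rep) i)"
    and l: "l \<in> L" and i: "i \<in> Y l"
  shows "\<phi> i w l = (\<Sum>j\<in>J. w j * component J X Y \<phi> l j i)"
proof -
  let ?V = "vsp (rep_sum J (\<lambda>j. spread_rep (X j)) :: ('k, 'j \<Rightarrow> 'k) rep) i"
  note s = lin_surjD[OF rep_bijD(2)[OF b, of i]]
  note c = spread_sum_carrier[OF J]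
  define r where "r F = (\<lambda>j\<in>J. if j \<in> F then w j else 0)" for F
  have w': "w \<in> extensional J" "\<And>j. j \<in> J \<Longrightarrow> i \<notin> X j \<Longrightarrow> w j = 0" using w by (auto simp: c)
  have rc: "r F \<in> carrier ?V" for F using w' by (auto simp: c r_def)
  have "\<phi> i (r F) l = (\<Sum>j\<in>F. w j * component J X Y \<phi> l j i)" if "F \<subseteq> J" for F
    using finite_subset[OF that J] that
  proof (induction F rule: finite_induct)
    case empty
    have r0: "r {} = (\<lambda>j\<in>J. 0)" by (simp add: r_def)
    show ?case unfolding r0 sum.empty by (rule zero_component[OF l])
  next
    case (insert j F)
    then have j: "j \<in> J" and IH: "\<phi> i (r F) l = (\<Sum>j\<in>F. w j * component J X Y \<phi> l j i)" by auto
    show ?case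
    proof (cases "i \<in> X j")
      case True
      have u: "unit_elem J j \<in> carrier ?V" by (rule unit_elem_carrier[OF j True])
      have cu: "w j \<odot>\<^bsub>?V\<^esub> unit_elem J j \<in> carrier ?V" using u by (auto simp: c spread_sum_simps)
      have "r (insert j F) = r F \<oplus>\<^bsub>?V\<^esub> (w j \<odot>\<^bsub>?V\<^esub> unit_elem J j)"
        using insert.hyps(2) by (auto simp: r_def spread_sum_simps unit_elem_def fun_eq_iff)
      then have "\<phi> i (r (insert j F)) l = \<phi> i (r F) l + w j * \<phi> i (unit_elem J j) l"
        using s(2)[OF rc cu] s(3)[OF u] l by (simp add: spread_sum_simps)
      then show ?thesis using IH insert.hyps True i by (simp add: component_def)
    next
      case False
      then have "r (insert j F) = r F" using w'(2)[OF j False] by (auto simp: r_def fun_eq_iff)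
      then show ?thesis using IH insert.hyps False by (simp add: component_def)
    qed
  qed
  moreover have "r J = w" using w'(1) by (auto simp: r_def fun_eq_iff extensional_def)
  ultimately show ?thesis by (metis order_refl)
qed

end

lemma component_spread_hom:
  fixes I :: "'j \<Rightarrow> (int \<times> int) set" and I' :: "'l \<Rightarrow> (int \<times> int) set"
    and \<phi> \<psi> :: "int \<times> int \<Rightarrow> ('j \<Rightarrow> 'k::field) \<Rightarrow> 'l \<Rightarrow> 'k"
  assumes J: "finite J" and L: "finite L"
    and b: "bnd_bij (bnd_sum J (\<lambda>j. spread_bnd (I j))) (bnd_sum L (\<lambda>l. spread_bnd (I' l))) \<phi> \<psi>"
    and j: "j \<in> J" and l: "l \<in> L"
  shows "spread_hom (I j) (I' l) (component J (low \<circ> I) (low \<circ> I') \<phi> l j) (component J (upp \<circ> I) (upp \<circ> I') \<psi> l j)"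
proof -
  let ?P = "bnd_sum J (\<lambda>j. spread_bnd (I j)) :: ('k, 'j \<Rightarrow> 'k, 'j \<Rightarrow> 'k) bnd"
  let ?Q = "bnd_sum L (\<lambda>l. spread_bnd (I' l)) :: ('k, 'l \<Rightarrow> 'k, 'l \<Rightarrow> 'k) bnd"
  have B: "rep_bij (rep_sum J (\<lambda>j. spread_rep ((low \<circ> I) j)) :: ('k, 'j \<Rightarrow> 'k) rep) (rep_sum L (\<lambda>l. spread_rep ((low \<circ> I') l))) \<phi>"
    and D: "rep_bij (rep_sum J (\<lambda>j. spread_rep ((upp \<circ> I) j)) :: ('k, 'j \<Rightarrow> 'k) rep) (rep_sum L (\<lambda>l. spread_rep ((upp \<circ> I') l))) \<psi>"
    using b by (simp_all add: bnd_bij_def bnd_sum_simps spread_bnd_simps)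
  note sB = component_step[OF J L B j l] and sD = component_step[OF J L D j l]
  have f: "component J (low \<circ> I) (low \<circ> I') \<phi> l j i = component J (upp \<circ> I) (upp \<circ> I') \<psi> l j i"
    if i: "i \<in> upp (I j)" "i + (0,1) \<notin> upp (I j)" "i \<in> low (I' l)" "i - (1,0) \<notin> low (I' l)" for i
  proof -
    let ?e = "unit_elem J j :: 'j \<Rightarrow> 'k"
    have ue: "?e \<in> carrier (vsp (rep_sum J (\<lambda>j. spread_rep ((upp \<circ> I) j)) :: ('k, 'j \<Rightarrow> 'k) rep) i)"
      using unit_elem_carrier[OF J L D j, of i] i(1) by simp
    have "?e \<in> kery (bndD ?P) i"
      using ue i(2) by (auto simp: kery_def bnd_sum_simps spread_bnd_simps spread_sum_simps unit_elem_def fun_eq_iff)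
    then have eq: "bndf ?Q i (\<psi> i ?e) = \<phi> i ` bndf ?P i ?e" using b unfolding bnd_bij_def by blast
    \<comment> \<open>A representative of the coset attached to the unit vector. The coordinate
      \<open>l\<close> of its image is determined, because there the coset in the target is a single
      scalar.\<close>
    define b0 where "b0 = (if i \<in> low (I j) then ?e else (\<lambda>j\<in>J. 0))"
    have "b0 \<in> bndf ?P i ?e"
      by (auto simp: b0_def bnd_sum_simps spread_bnd_simps spread_sum_carrier[OF J] unit_elem_def spread_rep_simps)
    then have "\<phi> i b0 \<in> bndf ?Q i (\<psi> i ?e)" unfolding eq by (rule imageI)
    then have "\<phi> i b0 l = \<psi> i ?e l" using l i(3,4) by (simp add: bnd_sum_simps spread_bnd_simps)
    moreover have "\<phi> i b0 l = component J (low \<circ> I) (low \<circ> I') \<phi> l j i"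
      using i(3) zero_component[OF J L B l] by (simp add: component_def b0_def)
    moreover have "\<psi> i ?e l = component J (upp \<circ> I) (upp \<circ> I') \<psi> l j i"
      using rep_bijD(5)[OF D ue] l i(1) by (auto simp: component_def spread_sum_carrier[OF L])
    ultimately show ?thesis by simp
  qed
  let ?a = "component J (low \<circ> I) (low \<circ> I') \<phi> l j" and ?c = "component J (upp \<circ> I) (upp \<circ> I') \<psi> l j"
  have 1: "?a i \<noteq> 0 \<Longrightarrow> i \<in> low (I j) \<and> i \<in> low (I' l)" "?c i \<noteq> 0 \<Longrightarrow> i \<in> upp (I j) \<and> i \<in> upp (I' l)" for i
    by (simp_all add: component_def split: if_splits)
  have 2: "i \<in> low (I j) \<Longrightarrow> i + (1,0) \<in> low (I' l) \<Longrightarrow> ?a (i + (1,0)) = ?a i" for i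
    by (rule sB(1)) simp_all
  have 3: "i \<in> low (I j) \<Longrightarrow> i + (0,1) \<in> low (I' l) \<Longrightarrow> ?a (i + (0,1)) = ?a i" for i
    by (rule sB(2)) simp_all
  have 4: "i \<in> upp (I j) \<Longrightarrow> i + (1,0) \<in> upp (I' l) \<Longrightarrow> ?c (i + (1,0)) = ?c i" for i
    by (rule sD(1)) simp_all
  have 5: "i \<in> upp (I j) \<Longrightarrow> i + (0,1) \<in> upp (I' l) \<Longrightarrow> ?c (i + (0,1)) = ?c i" for i
    by (rule sD(2)) simp_all
  show ?thesis unfolding spread_hom_def using 1 2 3 4 5 f by blast
qed

lemma right_inverse_card_le:
  fixes A :: "'j \<Rightarrow> 'l \<Rightarrow> 'k::field" and A' :: "'l \<Rightarrow> 'j \<Rightarrow> 'k"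
  assumes J: "finite J" and L: "finite L"
    and inv: "\<And>j j'. j \<in> J \<Longrightarrow> j' \<in> J \<Longrightarrow> (\<Sum>l\<in>L. A j l * A' l j') = (if j = j' then 1 else 0)"
  shows "card J \<le> card L"
proof (rule ccontr)
  assume less: "\<not> card J \<le> card L"
  define m where "m = card J"
  define n where "n = card L"
  have nm: "n < m" using less by (simp add: m_def n_def)
  obtain f where f: "bij_betw f {0..<m} J" using ex_bij_betw_nat_finite[OF J] m_def by blast
  obtain g where g: "bij_betw g {0..<n} L" using ex_bij_betw_nat_finite[OF L] n_def by blast
  \<comment> \<open>Padded with zeros to square matrices, a right inverse is a left inverse, but has a zero row.\<close>
  define M where "M = mat m m (\<lambda>(r, s). if s < n then A (f r) (g s) else 0)"
  define M' where "M' = mat m m (\<lambda>(r, s). if r < n then A' (g r) (f s) else 0)"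
  have c: "M \<in> carrier_mat m m" "M' \<in> carrier_mat m m" by (simp_all add: M_def M'_def)
  have "M * M' = 1\<^sub>m m"
  proof (rule eq_matI)
    fix r s assume rs: "r < dim_row (1\<^sub>m m :: 'k mat)" "s < dim_col (1\<^sub>m m :: 'k mat)"
    then have fr: "f r \<in> J" "f s \<in> J" "f r = f s \<longleftrightarrow> r = s"
      using f by (auto simp: bij_betw_def inj_on_def)
    have "(M * M') $$ (r, s) = (\<Sum>k\<in>{0..<m}. (if k < n then A (f r) (g k) else 0) * (if k < n then A' (g k) (f s) else 0))"
      using rs by (simp add: M_def M'_def scalar_prod_def)
    also have "\<dots> = (\<Sum>k\<in>{0..<n}. A (f r) (g k) * A' (g k) (f s))"
      using nm by (intro sum.mono_neutral_cong_right) auto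
    also have "\<dots> = (\<Sum>l\<in>L. A (f r) l * A' l (f s))"
      by (rule sum.reindex_bij_betw[OF g])
    also have "\<dots> = 1\<^sub>m m $$ (r, s)" using inv[OF fr(1,2)] fr(3) rs by simp
    finally show "(M * M') $$ (r, s) = 1\<^sub>m m $$ (r, s)" .
  qed (simp_all add: M_def M'_def)
  then have "M' * M = 1\<^sub>m m" by (rule mat_mult_left_right_inverse[OF c])
  then have "(M' * M) $$ (n, n) = 1" using nm by simp
  moreover have "(M' * M) $$ (n, n) = 0" using nm by (simp add: M_def M'_def scalar_prod_def)
  ultimately show False by simp
qed

text \<open>One of the two inverse relations yields one inequality; exchanging the two sums yields
  the other.\<close>

lemma spread_multiplicity_le:
  fixes I :: "'j \<Rightarrow> (int \<times> int) set" and I' :: "'l \<Rightarrow> (int \<times> int) set"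
    and \<phi> \<psi> :: "int \<times> int \<Rightarrow> ('j \<Rightarrow> 'k::field) \<Rightarrow> 'l \<Rightarrow> 'k"
  assumes J: "finite J" and L: "finite L"
    and b: "bnd_bij (bnd_sum J (\<lambda>j. spread_bnd (I j))) (bnd_sum L (\<lambda>l. spread_bnd (I' l))) \<phi> \<psi>"
    and b': "bnd_bij (bnd_sum L (\<lambda>l. spread_bnd (I' l))) (bnd_sum J (\<lambda>j. spread_bnd (I j))) \<phi>' \<psi>'"
    and inv: "\<And>i m. m \<in> carrier (vsp (rep_sum J (\<lambda>j. spread_rep (low (I j))) :: ('k, 'j \<Rightarrow> 'k) rep) i) \<Longrightarrow> \<phi>' i (\<phi> i m) = m"
    and P: "\<And>j. j \<in> J \<Longrightarrow> \<exists>n c b d. spread_path (I j) n c b d"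
    and P': "\<And>l. l \<in> L \<Longrightarrow> \<exists>n c b d. spread_path (I' l) n c b d"
  shows "card {j \<in> J. I j = X} \<le> card {l \<in> L. I' l = X}"
proof (cases "\<exists>j\<in>J. I j = X")
  case False
  then have "{j \<in> J. I j = X} = {}" by blast
  then show ?thesis by (metis card.empty zero_le)
next
  case True
  then obtain n c b d where X: "spread_path X n c b d" using P by blast
  let ?i = "b 0"
  have i: "?i \<in> low X" using spread_pathD(4)[OF X] by simp
  have B: "rep_bij (rep_sum J (\<lambda>j. spread_rep ((low \<circ> I) j)) :: ('k, 'j \<Rightarrow> 'k) rep) (rep_sum L (\<lambda>l. spread_rep ((low \<circ> I') l))) \<phi>"
    and B': "rep_bij (rep_sum L (\<lambda>l. spread_rep ((low \<circ> I') l)) :: ('k, 'l \<Rightarrow> 'k) rep) (rep_sum J (\<lambda>j. spread_rep ((low \<circ> I) j))) \<phi>'"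
    using assms(3,4) by (simp_all add: bnd_bij_def bnd_sum_simps spread_bnd_simps)
  define A where "A l j = component J (low \<circ> I) (low \<circ> I') \<phi> l j ?i" for l j
  define A' where "A' j l = component L (low \<circ> I') (low \<circ> I) \<phi>' j l ?i" for j l
  have "(\<Sum>l\<in>{l \<in> L. I' l = X}. A' j l * A l j') = (if j = j' then 1 else 0)"
    if "j \<in> {j \<in> J. I j = X}" "j' \<in> {j \<in> J. I j = X}" for j j'
  proof -
    have j: "j \<in> J" "I j = X" and j': "j' \<in> J" "I j' = X" using that by auto
    have u: "unit_elem J j' \<in> carrier (vsp (rep_sum J (\<lambda>j. spread_rep ((low \<circ> I) j)) :: ('k, 'j \<Rightarrow> 'k) rep) ?i)"
      using unit_elem_carrier[OF J L B j'(1), of ?i] i j'(2) by simp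
    let ?w = "\<phi> ?i (unit_elem J j')"
    have w: "?w \<in> carrier (vsp (rep_sum L (\<lambda>l. spread_rep ((low \<circ> I') l)) :: ('k, 'l \<Rightarrow> 'k) rep) ?i)"
      by (rule rep_bijD(5)[OF B u])
    \<comment> \<open>A summand \<open>l\<close> with a nonzero product is the middle term of a
      nonzero composite from \<open>X\<close> to \<open>X\<close>, hence equal to
      \<open>X\<close>.\<close>
    have "(\<Sum>l\<in>{l \<in> L. I' l = X}. A' j l * A l j') = (\<Sum>l\<in>L. A' j l * A l j')"
    proof (rule sum.mono_neutral_left[OF L])
      show "\<forall>l\<in>L - {l \<in> L. I' l = X}. A' j l * A l j' = 0"
      proof
        fix l assume l: "l \<in> L - {l \<in> L. I' l = X}"
        then obtain n' c' b' d' where Y: "spread_path (I' l) n' c' b' d'" using P' by blast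
        show "A' j l * A l j' = 0"
        proof (rule ccontr)
          assume nz: "A' j l * A l j' \<noteq> 0"
          have "X = I' l"
            using spread_hom_nonzero_eq[OF X Y component_spread_hom[OF J L assms(3) j'(1), of l, unfolded j'(2)]
              component_spread_hom[OF L J assms(4) _ j(1), of l, unfolded j(2)] i] nz l
            unfolding A_def A'_def by blast
          then show False using l by blast
        qed
      qed
    qed blast
    also have "\<dots> = (\<Sum>l\<in>L. ?w l * component L (low \<circ> I') (low \<circ> I) \<phi>' j l ?i)"
      using i j'(2) by (intro sum.cong refl) (auto simp: A_def A'_def component_def)
    also have "\<dots> = \<phi>' ?i ?w j"
      by (rule component_expand[OF L J B' w j(1), symmetric]) (simp add: i j(2))
    also have "\<dots> = unit_elem J j' j" using inv u by simp
    finally show ?thesis using j(1) by (simp add: unit_elem_def)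
  qed
  then show ?thesis by (intro right_inverse_card_le[of _ _ A' A]) (use J L in simp_all)
qed

text \<open>The bijection runs from \<open>L\<close> to \<open>J\<close>, the direction that
  \<open>sum_map\<close> expects.\<close>

lemma bij_betw_of_fibres:
  assumes J: "finite J" and L: "finite L"
    and card: "\<And>x. card {j \<in> J. f j = x} = card {l \<in> L. g l = x}"
  shows "\<exists>\<tau>. bij_betw \<tau> L J \<and> (\<forall>l\<in>L. f (\<tau> l) = g l)"
proof -
  have "\<forall>x. \<exists>h. bij_betw h {l \<in> L. g l = x} {j \<in> J. f j = x}"
    using card J L by (intro allI finite_same_card_bij) simp_all
  then obtain h where h: "\<And>x. bij_betw (h x) {l \<in> L. g l = x} {j \<in> J. f j = x}" by metis
  define \<tau> where "\<tau> l = h (g l) l" for l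
  have t: "\<tau> l \<in> J" "f (\<tau> l) = g l" if "l \<in> L" for l
    using bij_betwE[OF h[of "g l"]] that unfolding \<tau>_def by blast+
  have "inj_on \<tau> L"
  proof (rule inj_onI)
    fix l l' assume l: "l \<in> L" "l' \<in> L" and eq: "\<tau> l = \<tau> l'"
    have "g l = g l'" using t(2)[OF l(1)] t(2)[OF l(2)] eq by simp
    then show "l = l'" using inj_onD[OF bij_betw_imp_inj_on[OF h[of "g l"]], of l l'] l eq
      unfolding \<tau>_def by simp
  qed
  moreover have "\<tau> ` L = J"
  proof
    show "\<tau> ` L \<subseteq> J" using t(1) by blast
    show "J \<subseteq> \<tau> ` L"
    proof
      fix j assume "j \<in> J"
      then have "j \<in> h (f j) ` {l \<in> L. g l = f j}" using bij_betw_imp_surj_on[OF h[of "f j"]] by simp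
      then obtain l where "l \<in> L" "g l = f j" "j = h (f j) l" by blast
      then have "j = \<tau> l" by (simp add: \<tau>_def)
      then show "j \<in> \<tau> ` L" using \<open>l \<in> L\<close> by blast
    qed
  qed
  ultimately show ?thesis using t(2) unfolding bij_betw_def by blast
qed

section \<open>Spread-decomposable representations\<close>

lemma bnd_isoI: "is_bnd P \<Longrightarrow> bnd_bij P Q \<phi> \<psi> \<Longrightarrow> bnd_iso P Q"
  using bnd_iso_iff by blast

lemma bnd_iso_sym:
  assumes "bnd_iso P Q"
  shows "bnd_iso Q P"
proof -
  have P: "is_bnd P" and Q: "is_bnd Q" using assms unfolding bnd_iso_def by blast+
  then obtain \<phi> \<psi> where b: "bnd_bij P Q \<phi> \<psi>" using assms bnd_iso_iff by blast
  show ?thesis by (rule bnd_isoI[OF Q bnd_bij_inv[OF P b]])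
qed

lemma bnd_iso_trans:
  assumes "bnd_iso P Q" "bnd_iso Q R"
  shows "bnd_iso P R"
proof -
  have P: "is_bnd P" and Q: "is_bnd Q" using assms unfolding bnd_iso_def by blast+
  obtain \<phi> \<psi> where b: "bnd_bij P Q \<phi> \<psi>" using assms(1) bnd_iso_iff[OF P] by blast
  obtain \<phi>' \<psi>' where c: "bnd_bij Q R \<phi>' \<psi>'" using assms(2) bnd_iso_iff[OF Q] by blast
  show ?thesis by (rule bnd_isoI[OF P bnd_bij_comp[OF P b c]])
qed

text \<open>Unit vectors are nonzero, so each spread lies in the support of \<open>M\<close>. At a
  point \<open>i\<close> a finite spanning set involves only finitely many coordinates, so only
  finitely many spreads contain \<open>i\<close>; as spreads are not empty, the finite support
  accounts for all of \<open>J\<close>.\<close>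

lemma finite_spread_sum:
  fixes M :: "('k::field, 'a) rep" and I :: "'j \<Rightarrow> (int \<times> int) set"
  assumes M: "is_rep0 M" and I: "\<And>j. j \<in> J \<Longrightarrow> I j \<noteq> {}"
    and b: "rep_bij M (rep_sum J (\<lambda>j. spread_rep (I j)) :: ('k, 'j \<Rightarrow> 'k) rep) \<phi>"
  shows "finite J" "j \<in> J \<Longrightarrow> finite (I j)"
proof -
  let ?S = "rep_sum J (\<lambda>j. spread_rep (I j)) :: ('k, 'j \<Rightarrow> 'k) rep"
  let ?supp = "{i. carrier (vsp M i) \<noteq> {\<zero>\<^bsub>vsp M i\<^esub>}}"
  have Mr: "is_rep M" and fin: "finite ?supp" using M unfolding is_rep0_def by blast+
  have S: "is_rep ?S" by (rule rep_bij_is_rep[OF Mr b])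
  have carr: "h \<in> carrier (vsp ?S i) \<longleftrightarrow>
      h \<in> (\<Pi>\<^sub>E j\<in>J. if i \<in> I j then UNIV else {0}) \<and> finite {j \<in> J. h j \<noteq> 0}" for h i
    by (simp add: rep_sum_def spread_rep_simps)
  have e: "unit_elem J j \<in> carrier (vsp ?S i)" if "j \<in> J" "i \<in> I j" for i j
  proof -
    have "{j' \<in> J. unit_elem J j j' \<noteq> (0 :: 'k)} \<subseteq> {j}" by (auto simp: unit_elem_def)
    then have "finite {j' \<in> J. unit_elem J j j' \<noteq> (0 :: 'k)}" by (rule finite_subset) simp
    moreover have "(unit_elem J j :: 'j \<Rightarrow> 'k) \<in> (\<Pi>\<^sub>E j\<in>J. if i \<in> I j then UNIV else {0})"
      using that by (auto simp: unit_elem_def)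
    ultimately show ?thesis unfolding carr by blast
  qed
  have sub: "i \<in> ?supp" if "j \<in> J" "i \<in> I j" for i j
  proof -
    have "carrier (vsp M i) \<noteq> {\<zero>\<^bsub>vsp M i\<^esub>}"
    proof
      assume "carrier (vsp M i) = {\<zero>\<^bsub>vsp M i\<^esub>}"
      then have "carrier (vsp ?S i) = {\<zero>\<^bsub>vsp ?S i\<^esub>}"
        using rep_bijD(6)[OF b, of i] lin_surjD(4)[OF rep_bijD(2)[OF b, of i]] by simp
      then have "unit_elem J j = (\<lambda>j\<in>J. 0 :: 'k)" using e[OF that] by (simp add: spread_sum_simps)
      then have "unit_elem J j j = (0 :: 'k)" using that(1) by simp
      then show False using that(1) by (simp add: unit_elem_def)
    qed
    then show ?thesis by simp
  qed
  show "j \<in> J \<Longrightarrow> finite (I j)" using sub finite_subset[OF _ fin, of "I j"] by blast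
  have fi: "finite {j \<in> J. i \<in> I j}" for i
  proof -
    interpret V: vectorspace class_ring "vsp ?S i" by (rule is_repD(1)[OF S])
    obtain A where A: "finite A" "A \<subseteq> carrier (vsp ?S i)" "V.span A = carrier (vsp ?S i)"
      using is_repD(2)[OF S, of i] unfolding V.fin_dim_def by blast
    \<comment> \<open>The coordinates in which some vector of the spanning set is nonzero. The
      vectors supported on \<open>U\<close> form a subspace that contains the span, and hence every
      unit vector available at \<open>i\<close>.\<close>
    define U where "U = (\<Union>h\<in>A. {j \<in> J. h j \<noteq> 0})"
    have U: "finite U" unfolding U_def
    proof (rule finite_UN_I[OF A(1)])
      fix h assume "h \<in> A"
      then show "finite {j \<in> J. h j \<noteq> 0}" using A(2) carr by blast
    qed
    define W where "W = {h \<in> carrier (vsp ?S i). \<forall>j\<in>J. j \<notin> U \<longrightarrow> h j = 0}"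
    have "submodule class_ring W (vsp ?S i)"
      unfolding submodule_iff[OF is_repD(1)[OF S]]
    proof (intro conjI ballI allI)
      show "W \<subseteq> carrier (vsp ?S i)" unfolding W_def by blast
      show "\<zero>\<^bsub>vsp ?S i\<^esub> \<in> W" unfolding W_def using vs_zero[OF is_repD(1)[OF S]]
        by (simp add: spread_sum_simps)
      show "u \<oplus>\<^bsub>vsp ?S i\<^esub> v \<in> W" if "u \<in> W" "v \<in> W" for u v
        using that vs_add[OF is_repD(1)[OF S], of u i v] unfolding W_def by (simp add: spread_sum_simps)
      show "c \<odot>\<^bsub>vsp ?S i\<^esub> v \<in> W" if "v \<in> W" for c v
        using that vs_smult[OF is_repD(1)[OF S], of v i c] unfolding W_def by (simp add: spread_sum_simps)
    qed
    moreover have "A \<subseteq> W" using A(2) unfolding W_def U_def by blast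
    ultimately have "V.span A \<subseteq> W" using V.span_is_subset by blast
    then have "j \<in> U" if "j \<in> J" "i \<in> I j" for j
    proof -
      have "unit_elem J j \<in> W" using e[OF that] A(3) \<open>V.span A \<subseteq> W\<close> by blast
      moreover have "unit_elem J j j \<noteq> (0 :: 'k)" using that(1) by (simp add: unit_elem_def)
      ultimately show ?thesis using that(1) unfolding W_def by blast
    qed
    then have "{j \<in> J. i \<in> I j} \<subseteq> U" by blast
    then show ?thesis using U by (rule finite_subset)
  qed
  have "J \<subseteq> (\<Union>i\<in>?supp. {j \<in> J. i \<in> I j})"
  proof
    fix j assume j: "j \<in> J"
    then obtain i where "i \<in> I j" using I by blast
    then show "j \<in> (\<Union>i\<in>?supp. {j \<in> J. i \<in> I j})" using sub[OF j] j by blast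
  qed
  then show "finite J" using fi fin by (meson finite_UN_I finite_subset)
qed

lemma spread_decomposition:
  fixes M :: "('k::field, 'a) rep"
  assumes M: "is_rep0 M" and dec: "spread_decomposable M"
  shows "\<exists>(J :: nat set) I. finite J \<and> (\<forall>j\<in>J. \<exists>n c b d. spread_path (I j) n c b d) \<and>
    (\<exists>\<phi>. rep_bij M (rep_sum J (\<lambda>j. spread_rep (I j)) :: ('k, nat \<Rightarrow> 'k) rep) \<phi>) \<and>
    bnd_iso (boundary M) (bnd_sum J (\<lambda>j. spread_bnd (I j)) :: ('k, nat \<Rightarrow> 'k, nat \<Rightarrow> 'k) bnd)"
proof -
  have Mr: "is_rep M" using M unfolding is_rep0_def by blast
  obtain J :: "nat set" and I where I: "\<And>j. j \<in> J \<Longrightarrow> spread (I j)"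
    and iso: "rep_iso M (rep_sum J (\<lambda>j. spread_rep (I j)) :: ('k, nat \<Rightarrow> 'k) rep)"
    using dec unfolding spread_decomposable_def by blast
  let ?S = "rep_sum J (\<lambda>j. spread_rep (I j)) :: ('k, nat \<Rightarrow> 'k) rep"
  obtain \<phi> where b: "rep_bij M ?S \<phi>" using iso rep_iso_iff[OF Mr] by blast
  have ne: "\<And>j. j \<in> J \<Longrightarrow> I j \<noteq> {}" using I unfolding spread_def by blast
  have J: "finite J" by (rule finite_spread_sum(1)[OF M ne b])
  have P: "\<exists>n c b d. spread_path (I j) n c b d" if "j \<in> J" for j
    by (rule spread_path_exists[OF I[OF that] finite_spread_sum(2)[OF M ne b that]])
  have conv: "\<And>j. j \<in> J \<Longrightarrow> convex_set (I j)" using P spread_pathD(1) by blast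
  have S: "is_rep ?S" by (rule rep_bij_is_rep[OF Mr b])
  have "bnd_iso (boundary M) (boundary ?S)"
    by (rule bnd_isoI[OF is_bnd_boundary[OF Mr] boundary_bij[OF Mr b]])
  moreover obtain \<phi>' \<psi>' where "bnd_bij (boundary ?S) (bnd_sum J (\<lambda>j. spread_bnd (I j))) \<phi>' \<psi>'"
    using boundary_spread_sum[OF J S conv] by blast
  then have "bnd_iso (boundary ?S) (bnd_sum J (\<lambda>j. spread_bnd (I j)))"
    by (rule bnd_isoI[OF is_bnd_boundary[OF S]])
  ultimately have "bnd_iso (boundary M) (bnd_sum J (\<lambda>j. spread_bnd (I j)))" by (rule bnd_iso_trans)
  then show ?thesis using J P b by blast
qed

lemma spread_bnd_values:
  "bndf (spread_bnd I) i d \<subseteq> carrier (vsp (bndB (spread_bnd I)) i)"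
  "bndg (spread_bnd I) i d \<subseteq> carrier (vsp (bndB (spread_bnd I)) i)"
  unfolding spread_bnd_simps by blast+

lemma bc_rep_values:
  "bndf (bc_rep c) i d \<subseteq> carrier (vsp (bndB (bc_rep c)) i)"
  "bndg (bc_rep c) i d \<subseteq> carrier (vsp (bndB (bc_rep c)) i)"
  by (auto simp: bc_rep_def Let_def)

text \<open>Ensures that the choice in \<open>boundary_components\<close> yields a decomposition.
  The components come from the curves of the spreads, with the 1 by 1 identity matrix.\<close>

lemma bc_decomposition_exists:
  fixes M :: "('k::field, 'a) rep"
  assumes "is_rep0 M" "spread_decomposable M"
  shows "\<exists>cs. bc_decomposition M cs"
proof -
  obtain J :: "nat set" and I where J: "finite J" and P: "\<forall>j\<in>J. \<exists>n c b d. spread_path (I j) n c b d"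
    and iso: "bnd_iso (boundary M) (bnd_sum J (\<lambda>j. spread_bnd (I j)) :: ('k, nat \<Rightarrow> 'k, nat \<Rightarrow> 'k) bnd)"
    using spread_decomposition[OF assms] by blast
  have "\<exists>c :: curve \<times> 'k mat. boundary_component c \<and> (\<exists>\<phi> \<psi>. bnd_bij (spread_bnd (I j)) (bc_rep c) \<phi> \<psi>)"
    if j: "j \<in> J" for j
  proof -
    obtain n c b d where "spread_path (I j) n c b d" using P j by blast
    then show ?thesis using spread_curve_boundary_component spread_bnd_bc_rep by blast
  qed
  then obtain c :: "nat \<Rightarrow> curve \<times> 'k mat" where
    c: "\<forall>j\<in>J. boundary_component (c j) \<and> (\<exists>\<phi> \<psi>. bnd_bij (spread_bnd (I j)) (bc_rep (c j)) \<phi> \<psi>)"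
    using bchoice[of J "\<lambda>j c. boundary_component c \<and> (\<exists>\<phi> \<psi>. bnd_bij (spread_bnd (I j)) (bc_rep c) \<phi> \<psi>)"] by blast
  define n where "n = card J"
  \<comment> \<open>\<open>bc_decomposition\<close> speaks of lists, so the index set is enumerated
    by an initial segment of the natural numbers.\<close>
  obtain \<tau> where \<tau>: "bij_betw \<tau> {..<n} J"
    using ex_bij_betw_nat_finite[OF J] unfolding n_def atLeast0LessThan by blast
  define cs where "cs = map (\<lambda>k. c (\<tau> k)) [0..<n]"
  have len: "length cs = n" by (simp add: cs_def)
  have \<tau>J: "\<tau> k \<in> J" if "k \<in> {..<n}" for k using bij_betwE[OF \<tau>] that by blast
  have "\<forall>k\<in>{..<n}. \<exists>f. bnd_bij (spread_bnd (I (\<tau> k))) (bc_rep (cs ! k)) (fst f) (snd f)"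
  proof
    fix k assume k: "k \<in> {..<n}"
    obtain \<phi> \<psi> where "bnd_bij (spread_bnd (I (\<tau> k))) (bc_rep (c (\<tau> k))) \<phi> \<psi>"
      using c \<tau>J[OF k] by blast
    then show "\<exists>f. bnd_bij (spread_bnd (I (\<tau> k))) (bc_rep (cs ! k)) (fst f) (snd f)"
      using k by (intro exI[of _ "(\<phi>, \<psi>)"]) (simp add: cs_def)
  qed
  then obtain f where f: "\<forall>k\<in>{..<n}. bnd_bij (spread_bnd (I (\<tau> k))) (bc_rep (cs ! k)) (fst (f k)) (snd (f k))"
    using bchoice[of "{..<n}" "\<lambda>k f. bnd_bij (spread_bnd (I (\<tau> k))) (bc_rep (cs ! k)) (fst f) (snd f)"] by blast
  have "bnd_bij (bnd_sum J (\<lambda>j. spread_bnd (I j))) (bnd_sum {..<n} (\<lambda>k. bc_rep (cs ! k)))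
      (sum_map {..<n} \<tau> (\<lambda>k. fst (f k))) (sum_map {..<n} \<tau> (\<lambda>k. snd (f k)))"
    by (rule bnd_bij_sum[where P = "\<lambda>j. spread_bnd (I j)" and Q = "\<lambda>k. bc_rep (cs ! k)", OF _ \<tau>])
      (use f spread_bnd_values in blast)+
  then have "bnd_iso (bnd_sum J (\<lambda>j. spread_bnd (I j))) (bnd_sum {..<length cs} (\<lambda>k. bc_rep (cs ! k)))"
    unfolding len using bnd_isoI iso unfolding bnd_iso_def[of "boundary M"] by blast
  then have "bnd_iso (boundary M) (bnd_sum {..<length cs} (\<lambda>k. bc_rep (cs ! k)))"
    using bnd_iso_trans[OF iso] by blast
  moreover have "\<forall>c\<in>set cs. boundary_component c" using c \<tau>J by (auto simp: cs_def)
  ultimately show ?thesis unfolding bc_decomposition_def by blast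
qed

text \<open>Similarity and rotational equivalence are reflexive, so a boundary component belongs to
  its own class.\<close>

lemma bc_class_eq:
  fixes c c' :: "curve \<times> 'k::field mat"
  assumes "boundary_component c" "boundary_component c'" "bc_class c = bc_class c'"
  shows "bc_equiv c c'"
proof -
  have "snd c' \<in> carrier_mat (dim_row (snd c')) (dim_row (snd c'))"
    using assms(2) by (auto simp: boundary_component_def invertible_mat_def split: prod.splits)
  then have "similar_mat (snd c') (snd c')" by (rule similar_mat_refl)
  moreover have "rotationally_equivalent (fst c') (fst c')"
    unfolding rotationally_equivalent_def by (rule exI[of _ 0]) simp
  ultimately have "c' \<in> bc_class c'" using assms(2) unfolding bc_class_def bc_equiv_def by blast
  then show ?thesis using assms(3) unfolding bc_class_def by blast
qed

lemma bc_decomposition_classes: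
  fixes M :: "('k::field, 'a) rep" and N :: "('k, 'b) rep"
  assumes M: "bc_decomposition M cs" and N: "bc_decomposition N cs'"
    and eq: "image_mset bc_class (mset cs) = image_mset bc_class (mset cs')"
  shows "bnd_iso (boundary M) (boundary N)"
proof -
  have bc: "\<forall>c\<in>set cs. boundary_component c" "\<forall>c\<in>set cs'. boundary_component c"
    and isoM: "bnd_iso (boundary M) (bnd_sum {..<length cs} (\<lambda>j. bc_rep (cs ! j)))"
    and isoN: "bnd_iso (boundary N) (bnd_sum {..<length cs'} (\<lambda>j. bc_rep (cs' ! j)))"
    using M N unfolding bc_decomposition_def by blast+
  have "mset (map bc_class cs) = mset (map bc_class cs')" using eq by simp
  \<comment> \<open>Equal multisets of classes give a permutation that matches the two lists class
    by class.\<close>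
  then obtain \<tau> where "bij_betw \<tau> {..<length (map bc_class cs)} {..<length (map bc_class cs')}"
    "\<forall>i<length (map bc_class cs). map bc_class cs ! i = map bc_class cs' ! (\<tau> i)"
    using permutation_Ex_bij by blast
  then have \<tau>: "bij_betw \<tau> {..<length cs} {..<length cs'}"
    and cl: "\<And>i. i < length cs \<Longrightarrow> bc_class (cs ! i) = bc_class (cs' ! (\<tau> i))"
    using bij_betwE[of \<tau> "{..<length cs}" "{..<length cs'}"] by simp_all
  have \<tau>l: "\<tau> i < length cs'" if "i < length cs" for i using bij_betwE[OF \<tau>] that by simp
  have "\<forall>i\<in>{..<length cs}. \<exists>f. bnd_bij (bc_rep (cs' ! \<tau> i)) (bc_rep (cs ! i)) (fst f) (snd f)"
  proof
    fix i assume "i \<in> {..<length cs}"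
    then have i: "i < length cs" by simp
    have b: "boundary_component (cs' ! \<tau> i)" "boundary_component (cs ! i)" using bc \<tau>l[OF i] i by simp_all
    have "bc_equiv (cs' ! \<tau> i) (cs ! i)" by (rule bc_class_eq[OF b cl[OF i, symmetric]])
    moreover have "invertible_mat (snd (cs' ! \<tau> i))" "invertible_mat (snd (cs ! i))"
      using b by (auto simp: boundary_component_def split: prod.splits)
    ultimately obtain \<phi> \<psi> where "bnd_bij (bc_rep (cs' ! \<tau> i)) (bc_rep (cs ! i)) \<phi> \<psi>"
      using bc_equiv_bij by blast
    then show "\<exists>f. bnd_bij (bc_rep (cs' ! \<tau> i)) (bc_rep (cs ! i)) (fst f) (snd f)"
      by (intro exI[of _ "(\<phi>, \<psi>)"]) simp
  qed
  then obtain f where f: "\<forall>i\<in>{..<length cs}. bnd_bij (bc_rep (cs' ! \<tau> i)) (bc_rep (cs ! i)) (fst (f i)) (snd (f i))"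
    using bchoice[of "{..<length cs}" "\<lambda>i f. bnd_bij (bc_rep (cs' ! \<tau> i)) (bc_rep (cs ! i)) (fst f) (snd f)"] by blast
  have "bnd_bij (bnd_sum {..<length cs'} (\<lambda>j. bc_rep (cs' ! j))) (bnd_sum {..<length cs} (\<lambda>j. bc_rep (cs ! j)))
      (sum_map {..<length cs} \<tau> (\<lambda>k. fst (f k))) (sum_map {..<length cs} \<tau> (\<lambda>k. snd (f k)))"
    by (rule bnd_bij_sum[where P = "\<lambda>j. bc_rep (cs' ! j)" and Q = "\<lambda>j. bc_rep (cs ! j)", OF _ \<tau>])
      (use f bc_rep_values in blast)+
  then have "bnd_iso (bnd_sum {..<length cs'} (\<lambda>j. bc_rep (cs' ! j))) (bnd_sum {..<length cs} (\<lambda>j. bc_rep (cs ! j)))"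
    using bnd_isoI isoN unfolding bnd_iso_def[of "boundary N"] by blast
  then show ?thesis using bnd_iso_trans[OF isoM] bnd_iso_sym[OF bnd_iso_trans[OF isoN]] by blast
qed

lemma rep_bij_id:
  fixes M :: "('k::field, 'a) rep"
  shows "rep_bij M M (\<lambda>i m. m)"
  unfolding rep_bij_def lin_iso_def lin_surj_def by simp

lemma rep_iso_of_boundary_iso:
  fixes M :: "('k::field, 'a) rep" and N :: "('k, 'b) rep"
  assumes M: "is_rep0 M" "spread_decomposable M" and N: "is_rep0 N" "spread_decomposable N"
    and iso: "bnd_iso (boundary M) (boundary N)"
  shows "rep_iso M N"
proof -
  have Mr: "is_rep M" and Nr: "is_rep N" using M(1) N(1) unfolding is_rep0_def by blast+
  obtain J :: "nat set" and I \<alpha> where J: "finite J" and P: "\<forall>j\<in>J. \<exists>n c b d. spread_path (I j) n c b d"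
    and \<alpha>: "rep_bij M (rep_sum J (\<lambda>j. spread_rep (I j)) :: ('k, nat \<Rightarrow> 'k) rep) \<alpha>"
    and isoM: "bnd_iso (boundary M) (bnd_sum J (\<lambda>j. spread_bnd (I j)) :: ('k, nat \<Rightarrow> 'k, nat \<Rightarrow> 'k) bnd)"
    using spread_decomposition[OF M] by blast
  obtain L :: "nat set" and I' \<beta> where L: "finite L" and P': "\<forall>l\<in>L. \<exists>n c b d. spread_path (I' l) n c b d"
    and \<beta>: "rep_bij N (rep_sum L (\<lambda>l. spread_rep (I' l)) :: ('k, nat \<Rightarrow> 'k) rep) \<beta>"
    and isoN: "bnd_iso (boundary N) (bnd_sum L (\<lambda>l. spread_bnd (I' l)) :: ('k, nat \<Rightarrow> 'k, nat \<Rightarrow> 'k) bnd)"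
    using spread_decomposition[OF N] by blast
  let ?P = "bnd_sum J (\<lambda>j. spread_bnd (I j)) :: ('k, nat \<Rightarrow> 'k, nat \<Rightarrow> 'k) bnd"
  let ?Q = "bnd_sum L (\<lambda>l. spread_bnd (I' l)) :: ('k, nat \<Rightarrow> 'k, nat \<Rightarrow> 'k) bnd"
  have PQ: "bnd_iso ?P ?Q" by (rule bnd_iso_trans[OF bnd_iso_sym[OF isoM] bnd_iso_trans[OF iso isoN]])
  then have Pb: "is_bnd ?P" unfolding bnd_iso_def by blast
  obtain \<phi> \<psi> where b: "bnd_bij ?P ?Q \<phi> \<psi>" using PQ bnd_iso_iff[OF Pb] by blast
  note b' = bnd_bij_inv[OF Pb b]
  have B: "rep_bij (bndB ?P) (bndB ?Q) \<phi>" using b unfolding bnd_bij_def by blast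
  have Bs: "bndB ?P = rep_sum J (\<lambda>j. spread_rep (low (I j)))" "bndB ?Q = rep_sum L (\<lambda>l. spread_rep (low (I' l)))"
    by (simp_all add: bnd_sum_simps spread_bnd_simps)
  note inv = rep_inv_inverse[OF B, unfolded Bs]
  \<comment> \<open>The same lemma is applied to the isomorphism and to its inverse.\<close>
  have "card {j \<in> J. I j = X} = card {l \<in> L. I' l = X}" for X
  proof (rule antisym)
    show "card {j \<in> J. I j = X} \<le> card {l \<in> L. I' l = X}"
      by (rule spread_multiplicity_le[OF J L b b' _ P[rule_format] P'[rule_format]]) (simp_all add: Bs inv(1))
    show "card {l \<in> L. I' l = X} \<le> card {j \<in> J. I j = X}"
      by (rule spread_multiplicity_le[OF L J b' b _ P'[rule_format] P[rule_format]]) (simp_all add: Bs inv(2))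
  qed
  then obtain \<tau> where \<tau>: "bij_betw \<tau> L J" "\<forall>l\<in>L. I (\<tau> l) = I' l"
    using bij_betw_of_fibres[OF J L] by blast
  have "rep_bij (rep_sum J (\<lambda>j. spread_rep (I j)) :: ('k, nat \<Rightarrow> 'k) rep) (rep_sum L (\<lambda>l. spread_rep (I' l)))
      (sum_map L \<tau> (\<lambda>l i m. m))"
    by (rule rep_bij_sum[where F = "\<lambda>j. spread_rep (I j)" and G = "\<lambda>l. spread_rep (I' l)", OF L \<tau>(1)])
      (use \<tau>(2) in \<open>simp add: rep_bij_id\<close>)
  then have "rep_bij M N (\<lambda>i m. rep_inv N \<beta> i (sum_map L \<tau> (\<lambda>l i m. m) i (\<alpha> i m)))"
    by (intro rep_bij_comp[OF rep_bij_comp[OF \<alpha>] rep_bij_inv[OF Nr \<beta>]])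
  then show ?thesis using rep_iso_iff[OF Mr] by blast
qed

theorem corollaryG:
  fixes M :: "('k::field, 'a) rep" and N :: "('k, 'b) rep"
  assumes "is_rep0 M" and "is_rep0 N"
    and "spread_decomposable M" and "spread_decomposable N"
  shows "(rep_iso M N \<longleftrightarrow> bnd_iso (boundary M) (boundary N)) \<and>
         (bnd_iso (boundary M) (boundary N) \<longleftrightarrow> boundary_components M = boundary_components N)"
proof (intro conjI iffI)
  have Mr: "is_rep M" using assms(1) unfolding is_rep0_def by blast
  show "bnd_iso (boundary M) (boundary N)" if iso: "rep_iso M N"
  proof -
    obtain \<phi> where b: "rep_bij M N \<phi>" using iso rep_iso_iff[OF Mr] by blast
    show ?thesis by (rule bnd_isoI[OF is_bnd_boundary[OF Mr] boundary_bij[OF Mr b]])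
  qed
  show "rep_iso M N" if "bnd_iso (boundary M) (boundary N)"
    using rep_iso_of_boundary_iso[OF assms(1,3,2,4) that] .
  show "boundary_components M = boundary_components N" if iso: "bnd_iso (boundary M) (boundary N)"
  proof -
    \<comment> \<open>The boundaries being isomorphic, the two predicates coincide, so the choice
      operator picks the same list for both.\<close>
    have "bc_decomposition M cs \<longleftrightarrow> bc_decomposition N cs" for cs
      unfolding bc_decomposition_def using bnd_iso_trans[OF iso] bnd_iso_trans[OF bnd_iso_sym[OF iso]] by blast
    then have "bc_decomposition M = bc_decomposition N" by blast
    then show ?thesis unfolding boundary_components_def by simp
  qed
  show "bnd_iso (boundary M) (boundary N)" if eq: "boundary_components M = boundary_components N"
  proof (rule bc_decomposition_classes)
    show "bc_decomposition M (SOME cs. bc_decomposition M cs)"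
      using bc_decomposition_exists[OF assms(1,3)] by (rule someI_ex)
    show "bc_decomposition N (SOME cs. bc_decomposition N cs)"
      using bc_decomposition_exists[OF assms(2,4)] by (rule someI_ex)
  qed (use eq in \<open>simp add: boundary_components_def\<close>)
qed

end
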